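(* Let $L$ consist of a single ternary relation symbol $R$, and let $\mathcal{K}_0$, $\mu$, $\mathcal{K}_\mu$ be as in the context. Suppose the following assumption holds: (i) if $A\leq B_1,B_2\in\mathcal{K}_\mu$ and the free amalgam of $B_1$ and $B_2$ over $A$ is not in $\mathcal{K}_\mu$, then either there exist $a,a'\in A$ and $b_i\in B_i\setminus A$ with $\{a,a',b_i\}\in R^{B_i}$ (for $i=1,2$), or there exist $Y\subseteq A$ with $\delta(Y)\geq 3$ and minimally simply algebraic extensions $Y\leq Z_i\subseteq B_i$ ($i=1,2$) which are isomorphic over $Y$ with $Z_i\setminus Y\subseteq B_i\setminus A$; and (ii) $(\mathcal{K}_\mu,\leq)$ is an amalgamation class. Suppose also that $\mu(Y,Z)\geq 3$ for all minimally simply algebraic extensions $Y\leq Z$ in $\mathcal{K}_0$ with $\delta(Y)\geq 3$. Let $\mathcal{N}_\mu$ be the generic structure of $(\mathcal{K}_\mu,\leq)$ and $\mathcal{M}_0(L)$ the generic structure of $(\mathcal{C}_0(L),\leq)$. Let $X\leq\mathcal{N}_\mu$ with $d(X)=3$. Then the localization $G_X(\mathcal{N}_\mu)$ is isomorphic to $G(\mathcal{M}_0(L))$.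
   Context: In an $L$-structure $A$, $R^A$ is a set of 3-element subsets of $A$; substructures are induced. For finite $A$, $\delta(A)=|A|-|R^A|$. $\mathcal{C}_0(L)$: finite $L$-structures all of whose subsets have $\delta\geq0$. For $A\subseteq B\in\mathcal{C}_0(L)$, $A\leq B$ means $\delta(A)\leq\delta(B')$ whenever $A\subseteq B'\subseteq B$. $\bar{\mathcal{C}}_0(L)$: $L$-structures all of whose finite substructures lie in $\mathcal{C}_0(L)$; there $A\leq B$ means $\delta(C)\geq\delta(C\cap A)$ for all finite $C\subseteq B$. For finite $A\subseteq B\in\bar{\mathcal{C}}_0(L)$, $d(A)=d_B(A)=\min\{\delta(A'):A\subseteq A'\subseteq B\text{ finite}\}$; ${\rm cl}_B(A)=\{c:d_B(A\cup\{c\})=d_B(A)\}$, extended to infinite sets by unions over finite subsets. $(B,{\rm cl}_B)$ is a pregeometry with geometry $G(B)$ (points ${\rm cl}_B(x)\setminus{\rm cl}_B(\emptyset)$ for $x\notin{\rm cl}_B(\emptyset)$, induced closure); for $Y\subseteq B$, $G_Y(B)$ is the geometry of the localized pregeometry with closure $Z\mapsto{\rm cl}_B(Y\cup Z)$. Free amalgam over a common substructure: disjoint union with union of relations. For $Y\leq Z$, $Y\neq Z$: algebraic if $\delta(Y)=\delta(Z)$; simply algebraic if also $\delta(Z')>\delta(Y)$ for $Y\subsetneq Z'\subsetneq Z$; minimally simply algebraic (msa) if also $Y'\subseteq Y'\cup(Z\setminus Y)$ is not simply algebraic for all $Y'\subsetneq Y$. $\mu$ is a function from isomorphism types of msa extensions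 in $\mathcal{C}_0(L)$ to non-negative integers; $\mathcal{C}_\mu(L)$ is the class of $A\in\mathcal{C}_0(L)$ not containing, for any msa $Y\leq Z$, a copy of $Y$ together with $\mu(Y,Z)+1$ copies of $Z$ over it whose parts outside $Y$ are pairwise disjoint. $\mathcal{K}_0=\{A\in\mathcal{C}_0(L): B\leq A\text{ for all }B\subseteq A\text{ with }|B|\leq 3\}$ and $\mathcal{K}_\mu=\mathcal{K}_0\cap\mathcal{C}_\mu(L)$. Amalgamation class and generic structure: $(\mathcal{A},\leq)$ with $\mathcal{A}\subseteq\mathcal{C}_0(L)$ closed under self-sufficient substructures and with amalgamation (if $A\leq B_1,B_2\in\mathcal{A}$ there are $C\in\mathcal{A}$ and embeddings $f_i:B_i\to C$, $f_i(B_i)\leq C$, agreeing on $A$); its generic structure is the unique countable $\mathcal{M}\in\bar{\mathcal{C}}_0(L)$ that is the union of a chain $A_0\leq A_1\leq\cdots$ in $\mathcal{A}$ such that for finite $A\leq\mathcal{M}$ and $A\leq B\in\mathcal{A}$ there is an embedding of $B$ into $\mathcal{M}$ over $A$ with self-sufficient image. $(\mathcal{C}_0(L),\leq)$ is an amalgamation class.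
   Formalization: The formal statement additionally assumes that R is nonempty in N_μ; without it the claim fails: if μ=0 on the extension {a,b}≤{a,b,c} with {a,b,c} in R, then N_μ is a pure set and its localization is a trivial geometry. *)

theory Defs
  imports Main "HOL-Library.Countable_Set"
begin

section \<open>Structures, predimension and self-sufficiency\<close>

datatype 'a lstruct = LStruct (pts: "'a set") (rel: "'a set set")

definition is_lstruct :: "'a lstruct \<Rightarrow> bool" where
  "is_lstruct A \<longleftrightarrow> (\<forall>r\<in>rel A. r \<subseteq> pts A \<and> card r = 3)"

definition induced :: "'a lstruct \<Rightarrow> 'a set \<Rightarrow> 'a lstruct" where
  "induced B S = LStruct S {r \<in> rel B. r \<subseteq> S}"

definition embedding :: "('a \<Rightarrow> 'b) \<Rightarrow> 'a lstruct \<Rightarrow> 'b lstruct \<Rightarrow> bool" where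
  "embedding f A B \<longleftrightarrow> inj_on f (pts A) \<and> f ` pts A \<subseteq> pts B \<and>
     (\<forall>r. r \<subseteq> pts A \<longrightarrow> (f ` r \<in> rel B \<longleftrightarrow> r \<in> rel A))"

definition isomorphism :: "('a \<Rightarrow> 'b) \<Rightarrow> 'a lstruct \<Rightarrow> 'b lstruct \<Rightarrow> bool" where
  "isomorphism f A B \<longleftrightarrow> embedding f A B \<and> f ` pts A = pts B"

text \<open>The predimension of the substructure of \<open>B\<close> induced on the finite set \<open>S \<subseteq> pts B\<close>.\<close>

definition delta :: "'a lstruct \<Rightarrow> 'a set \<Rightarrow> int" where
  "delta B S = int (card S) - int (card {r \<in> rel B. r \<subseteq> S})"

definition C0 :: "'a lstruct set" where
  "C0 = {A. is_lstruct A \<and> finite (pts A) \<and> (\<forall>S\<subseteq>pts A. delta A S \<ge> 0)}"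

definition C0bar :: "'a lstruct set" where
  "C0bar = {A. is_lstruct A \<and> (\<forall>S\<subseteq>pts A. finite S \<longrightarrow> induced A S \<in> C0)}"

text \<open>\<open>selfsuff A B\<close> is \<open>A \<le> B\<close>, in the form that is meaningful for arbitrary structures; for finite
  \<open>B\<close> it is the condition that no superset of \<open>A\<close> has smaller predimension, see
  \<open>selfsuff_finite_iff\<close> below.\<close>

definition selfsuff :: "'a set \<Rightarrow> 'a lstruct \<Rightarrow> bool" where
  "selfsuff A B \<longleftrightarrow> A \<subseteq> pts B \<and>
     (\<forall>C\<subseteq>pts B. finite C \<longrightarrow> delta B C \<ge> delta B (C \<inter> A))"

lemma delta_submodular:
  assumes "finite A" "finite C"
  shows "delta B (C \<union> A) + delta B (C \<inter> A) \<le> delta B C + delta B A"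
proof -
  let ?R = "\<lambda>S. {r \<in> rel B. r \<subseteq> S}"
  have fin: "finite (?R S)" if "finite S" for S
    by (rule finite_subset[of _ "Pow S"]) (use that in auto)
  have "card (?R C) + card (?R A) = card (?R C \<union> ?R A) + card (?R C \<inter> ?R A)"
    by (rule card_Un_Int) (use fin assms in auto)
  moreover have "?R C \<inter> ?R A = ?R (C \<inter> A)" by auto
  moreover have "card (?R C \<union> ?R A) \<le> card (?R (C \<union> A))"
    by (rule card_mono) (use fin assms in auto)
  moreover have "card C + card A = card (C \<union> A) + card (C \<inter> A)"
    by (rule card_Un_Int) (use assms in auto)
  ultimately show ?thesis unfolding delta_def by simp
qed

lemma selfsuff_finite_iff:
  assumes "finite (pts B)"
  shows "selfsuff A B \<longleftrightarrow>
    A \<subseteq> pts B \<and> (\<forall>B'. A \<subseteq> B' \<and> B' \<subseteq> pts B \<longrightarrow> delta B A \<le> delta B B')"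
proof (intro iffI conjI allI impI)
  fix B' assume "selfsuff A B" and B': "A \<subseteq> B' \<and> B' \<subseteq> pts B"
  then have "delta B B' \<ge> delta B (B' \<inter> A)"
    unfolding selfsuff_def using assms finite_subset by blast
  moreover have "B' \<inter> A = A" using B' by blast
  ultimately show "delta B A \<le> delta B B'" by simp
next
  assume asm: "A \<subseteq> pts B \<and> (\<forall>B'. A \<subseteq> B' \<and> B' \<subseteq> pts B \<longrightarrow> delta B A \<le> delta B B')"
  have "delta B (C \<inter> A) \<le> delta B C" if "C \<subseteq> pts B" for C
  proof -
    have "finite A" "finite C" using asm that assms finite_subset by blast+
    moreover have "delta B A \<le> delta B (C \<union> A)" using asm that by simp
    ultimately show ?thesis using delta_submodular[of A C B] by simp
  qed
  then show "selfsuff A B" unfolding selfsuff_def using asm by simp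
qed (simp add: selfsuff_def)

section \<open>Dimension, closure and geometries\<close>

definition dim :: "'a lstruct \<Rightarrow> 'a set \<Rightarrow> int" where
  "dim B A = (LEAST k. \<exists>A'. A \<subseteq> A' \<and> A' \<subseteq> pts B \<and> finite A' \<and> k = delta B A')"

text \<open>The closure of a finite set \<open>A\<close> is \<open>fin_cl B A\<close>; the union over finite subsets in \<open>cl\<close> is
  consistent with this, see \<open>cl_finite\<close> below.\<close>

definition fin_cl :: "'a lstruct \<Rightarrow> 'a set \<Rightarrow> 'a set" where
  "fin_cl B A = {c \<in> pts B. dim B (A \<union> {c}) = dim B A}"

definition cl :: "'a lstruct \<Rightarrow> 'a set \<Rightarrow> 'a set" where
  "cl B X = (\<Union>A\<in>{A. finite A \<and> A \<subseteq> X}. fin_cl B A)"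

lemma dim_attained:
  assumes "B \<in> C0bar" "finite A" "A \<subseteq> pts B"
  obtains A' where "A \<subseteq> A'" "A' \<subseteq> pts B" "finite A'" "dim B A = delta B A'"
    "\<And>A''. A \<subseteq> A'' \<Longrightarrow> A'' \<subseteq> pts B \<Longrightarrow> finite A'' \<Longrightarrow> dim B A \<le> delta B A''"
proof -
  let ?P = "\<lambda>A'. A \<subseteq> A' \<and> A' \<subseteq> pts B \<and> finite A'"
  have nonneg: "0 \<le> delta B S" if "S \<subseteq> pts B" "finite S" for S
  proof -
    have "induced B S \<in> C0" using assms(1) that unfolding C0bar_def by blast
    then have "0 \<le> delta (induced B S) S" unfolding C0_def induced_def by auto
    moreover have "{r \<in> rel (induced B S). r \<subseteq> S} = {r \<in> rel B. r \<subseteq> S}"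
      unfolding induced_def by auto
    ultimately show ?thesis unfolding delta_def by simp
  qed
  obtain A' where A': "?P A'" "\<And>y. ?P y \<Longrightarrow> nat (delta B A') \<le> nat (delta B y)"
    using ex_has_least_nat[of ?P A "\<lambda>S. nat (delta B S)"] assms by blast
  have min: "delta B A' \<le> delta B y" if "?P y" for y
    using A'(2)[OF that] nonneg[of y] nonneg[of A'] that A'(1) by simp
  have "dim B A = delta B A'"
    unfolding dim_def by (rule Least_equality) (use A'(1) min in auto)
  then show ?thesis using that[of A'] A'(1) min by auto
qed

lemma cl_finite:
  assumes B: "B \<in> C0bar" and X: "finite X" "X \<subseteq> pts B"
  shows "cl B X = fin_cl B X"
proof
  show "fin_cl B X \<subseteq> cl B X" unfolding cl_def using X by blast
  show "cl B X \<subseteq> fin_cl B X"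
  proof
    fix c assume "c \<in> cl B X"
    then obtain A where A: "finite A" "A \<subseteq> X" and c: "c \<in> pts B" "dim B (A \<union> {c}) = dim B A"
      unfolding cl_def fin_cl_def by blast
    have Ap: "A \<subseteq> pts B" using A X by blast
    have A1: "dim B A \<le> delta B A''" if "A \<subseteq> A''" "A'' \<subseteq> pts B" "finite A''" for A''
      by (rule dim_attained[OF B A(1) Ap]) (use that in blast)
    obtain A2 where A2: "A \<union> {c} \<subseteq> A2" "A2 \<subseteq> pts B" "finite A2" "dim B (A \<union> {c}) = delta B A2"
      by (rule dim_attained[OF B, of "A \<union> {c}"]) (use A Ap c(1) in auto)
    obtain X1 where X1: "X \<subseteq> X1" "X1 \<subseteq> pts B" "finite X1" "dim B X = delta B X1"
      "\<And>A''. X \<subseteq> A'' \<Longrightarrow> A'' \<subseteq> pts B \<Longrightarrow> finite A'' \<Longrightarrow> dim B X \<le> delta B A''"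
      by (rule dim_attained[OF B X]) blast
    obtain X2 where X2: "X \<union> {c} \<subseteq> X2" "X2 \<subseteq> pts B" "finite X2" "dim B (X \<union> {c}) = delta B X2"
      "\<And>A''. X \<union> {c} \<subseteq> A'' \<Longrightarrow> A'' \<subseteq> pts B \<Longrightarrow> finite A'' \<Longrightarrow> dim B (X \<union> {c}) \<le> delta B A''"
      by (rule dim_attained[OF B, of "X \<union> {c}"]) (use X c(1) in auto)
    have "dim B A \<le> delta B (X1 \<inter> A2)"
      by (rule A1) (use A A2 X1 in auto)
    moreover have "dim B (X \<union> {c}) \<le> delta B (X1 \<union> A2)"
      by (rule X2(5)) (use A2 X1 in auto)
    moreover have "dim B X \<le> delta B X2"
      by (rule X1(5)) (use X2 in auto)
    ultimately have "dim B (X \<union> {c}) = dim B X"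
      using delta_submodular[OF A2(3) X1(3), of B] A2(4) X1(4) X2(4) c(2) by linarith
    then show "c \<in> fin_cl B X" unfolding fin_cl_def using c(1) by simp
  qed
qed

text \<open>A geometry is its set of points together with its closure operator; the operator matters only
  on sets of points. The points of the geometry of a pregeometry are subsets of its carrier.\<close>

type_synonym 'p geometry = "'p set \<times> ('p set \<Rightarrow> 'p set)"

definition geom_points :: "'a set \<Rightarrow> ('a set \<Rightarrow> 'a set) \<Rightarrow> 'a set set" where
  "geom_points S c = {c {x} - c {} | x. x \<in> S \<and> x \<notin> c {}}"

definition geometry_of :: "'a set \<Rightarrow> ('a set \<Rightarrow> 'a set) \<Rightarrow> 'a set geometry" where
  "geometry_of S c =
     (geom_points S c, \<lambda>P. {q \<in> geom_points S c. q \<subseteq> c (\<Union>P)})"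

definition Geom :: "'a lstruct \<Rightarrow> 'a set geometry" where
  "Geom B = geometry_of (pts B) (cl B)"

definition Geom_loc :: "'a set \<Rightarrow> 'a lstruct \<Rightarrow> 'a set geometry" where
  "Geom_loc Y B = geometry_of (pts B) (\<lambda>Z. cl B (Y \<union> Z))"

definition geometry_isomorphic :: "'p geometry \<Rightarrow> 'q geometry \<Rightarrow> bool" where
  "geometry_isomorphic G H \<longleftrightarrow>
     (\<exists>f. bij_betw f (fst G) (fst H) \<and> (\<forall>P\<subseteq>fst G. f ` snd G P = snd H (f ` P)))"

section \<open>Algebraic extensions and the classes\<close>

definition algebraic_ext :: "'a set \<Rightarrow> 'a lstruct \<Rightarrow> bool" where
  "algebraic_ext Y Z \<longleftrightarrow>
     Z \<in> C0 \<and> selfsuff Y Z \<and> Y \<noteq> pts Z \<and> delta Z Y = delta Z (pts Z)"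

definition simply_algebraic :: "'a set \<Rightarrow> 'a lstruct \<Rightarrow> bool" where
  "simply_algebraic Y Z \<longleftrightarrow> algebraic_ext Y Z \<and>
     (\<forall>Z'. Y \<subset> Z' \<and> Z' \<subset> pts Z \<longrightarrow> delta Z Z' > delta Z Y)"

definition msa :: "'a set \<Rightarrow> 'a lstruct \<Rightarrow> bool" where
  "msa Y Z \<longleftrightarrow> simply_algebraic Y Z \<and>
     (\<forall>Y'. Y' \<subset> Y \<longrightarrow> \<not> simply_algebraic Y' (induced Z (Y' \<union> (pts Z - Y))))"

text \<open>Every finite structure has a copy on a set of natural numbers, so a function on isomorphism
  types of msa extensions is an isomorphism-invariant function on the msa extensions living
  on natural numbers.\<close>

definition iso_invariant :: "(nat set \<Rightarrow> nat lstruct \<Rightarrow> nat) \<Rightarrow> bool" where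
  "iso_invariant \<mu> \<longleftrightarrow> (\<forall>Y Z Y' Z' f. msa Y Z \<and> msa Y' Z' \<and> isomorphism f Z Z' \<and> f ` Y = Y'
      \<longrightarrow> \<mu> Y Z = \<mu> Y' Z')"

definition Cmu :: "(nat set \<Rightarrow> nat lstruct \<Rightarrow> nat) \<Rightarrow> 'a lstruct set" where
  "Cmu \<mu> = {A \<in> C0. \<not> (\<exists>Y Z. \<exists>f :: nat \<Rightarrow> nat \<Rightarrow> 'a. msa Y Z \<and>
      (\<forall>i<\<mu> Y Z + 1. embedding (f i) Z A) \<and>
      (\<forall>i<\<mu> Y Z + 1. \<forall>j<\<mu> Y Z + 1. i \<noteq> j \<longrightarrow>
         (\<forall>y\<in>Y. f i y = f j y) \<and> f i ` (pts Z - Y) \<inter> f j ` (pts Z - Y) = {}))}"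

definition K0 :: "'a lstruct set" where
  "K0 = {A \<in> C0. \<forall>B\<subseteq>pts A. card B \<le> 3 \<longrightarrow> selfsuff B A}"

definition Kmu :: "(nat set \<Rightarrow> nat lstruct \<Rightarrow> nat) \<Rightarrow> 'a lstruct set" where
  "Kmu \<mu> = K0 \<inter> Cmu \<mu>"

section \<open>Amalgamation and generic structures\<close>

text \<open>To be applied to structures meeting exactly in a common substructure.\<close>

definition free_amalgam :: "'a lstruct \<Rightarrow> 'a lstruct \<Rightarrow> 'a lstruct" where
  "free_amalgam B1 B2 = LStruct (pts B1 \<union> pts B2) (rel B1 \<union> rel B2)"

definition amalgamation_class :: "nat lstruct set \<Rightarrow> bool" where
  "amalgamation_class \<A> \<longleftrightarrow> \<A> \<subseteq> C0 \<and>
     (\<forall>B\<in>\<A>. \<forall>A. selfsuff A B \<longrightarrow> induced B A \<in> \<A>) \<and>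
     (\<forall>B1\<in>\<A>. \<forall>B2\<in>\<A>. \<forall>A. selfsuff A B1 \<and> selfsuff A B2 \<and> induced B1 A = induced B2 A \<longrightarrow>
        (\<exists>C\<in>\<A>. \<exists>f1 f2. embedding f1 B1 C \<and> embedding f2 B2 C \<and>
           selfsuff (f1 ` pts B1) C \<and> selfsuff (f2 ` pts B2) C \<and> (\<forall>a\<in>A. f1 a = f2 a)))"

text \<open>The class is given by its members on natural numbers, whereas \<open>M\<close> may live on any type. Hence
  membership of the \<open>A i\<close> is up to isomorphism, and a self-sufficient substructure of \<open>M\<close> with an
  extension in the class is given as the image of a self-sufficient embedding \<open>e\<close>.\<close>

definition is_generic :: "nat lstruct set \<Rightarrow> 'a lstruct \<Rightarrow> bool" where
  "is_generic \<A> M \<longleftrightarrow> countable (pts M) \<and> M \<in> C0bar \<and>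
     (\<exists>A :: nat \<Rightarrow> 'a set.
        (\<forall>i. \<exists>B\<in>\<A>. \<exists>g. isomorphism g B (induced M (A i))) \<and>
        (\<forall>i. selfsuff (A i) (induced M (A (Suc i)))) \<and>
        (\<Union>i. A i) = pts M) \<and>
     (\<forall>B\<in>\<A>. \<forall>A e. selfsuff A B \<and> embedding e (induced B A) M \<and> selfsuff (e ` A) M \<longrightarrow>
        (\<exists>f. embedding f B M \<and> (\<forall>a\<in>A. f a = e a) \<and> selfsuff (f ` pts B) M))"

end

theory Submission
  imports Defs "HOL-Library.Nat_Bijection"
begin

text \<open>
  The isomorphism is built by back-and-forth between finite self-sufficient subsets of \<open>N\<close> containing
  \<open>X\<close> and finite self-sufficient subsets of \<open>M\<close>, matched so that the dimension over \<open>X\<close> on the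
  \<open>N\<close> side equals the dimension on the \<open>M\<close> side. The dimension function of an extension \<open>A \<le> B\<close>
  depends only on the dimension function of \<open>A\<close> and on the relations of \<open>B\<close> not inside \<open>A\<close>, so going
  forth one simply transfers these relations to \<open>M\<close>.

  Going back, the relations \<open>r\<close> transferred to \<open>N\<close> would in general violate \<open>Kmu\<close>. Each incidence
  \<open>p \<in> r\<close> is therefore replaced by a long cycle of new points whose consecutive points are related
  through one label: once \<open>p\<close> itself, otherwise one of three non-collinear points of \<open>X\<close>. Over \<open>X\<close> all
  points of the cycle are interalgebraic with \<open>p\<close>, and \<open>r\<close> is replaced by a triangle joining its three
  cycles, which does not change the dimension over \<open>X\<close>. Cycle points lie in at most three relations, so
  they cannot belong to the base of four disjoint copies of an msa extension, and such a copy contains a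
  cycle entirely or not at all. The cycle lengths grow so fast that two disjoint copies of the same
  size contain no cycle, whence all copies lie in \<open>A\<close>.
\<close>

section \<open>Predimension and embeddings\<close>

text \<open>The offset 3 between the two dimensions arises because the points of \<open>X\<close>
  become loops in the localization, while the loops of \<open>M\<close> have dimension 0. The same 3
  supplies the labels: \<open>X\<close> contains three points forming no relation, and in
  \<open>K0\<close> a set containing such a triple has predimension at least 3, the very bound
  required of sets with four or more points; two labels would guarantee only 2. Dimensions over
  \<open>X\<close> are computed on sets containing \<open>X\<close>, where all these labels are
  present. Cycles are attached to incidences and not to points, since a point may lie in many
  relations to be replaced. This way each cycle takes part in one triangle only and degrees stay at
  most 3, whereas \<open>\<mu> Y Z \<ge> 3\<close> makes a forbidden configuration consist of at
  least four copies. That bound says nothing about bases of predimension at most 2. In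
  \<open>K0\<close> these are pairs extended by one related point, and two copies would be two
  relations with two common points; one copy is permitted because \<open>N\<close> has a
  relation.\<close>

definition predim :: "'a set set \<Rightarrow> 'a set \<Rightarrow> int" where
  "predim R W = int (card W) - int (card {r \<in> R. r \<subseteq> W})"

lemma delta_predim: "delta B W = predim (rel B) W"
  by (simp add: delta_def predim_def)

lemma finite_rels_in: "finite W \<Longrightarrow> finite {r \<in> R. r \<subseteq> W}"
  by (rule finite_subset[of _ "Pow W"]) auto

lemma predim_le_card: "predim R W \<le> int (card W)"
  by (simp add: predim_def)

lemma predim_Un:
  assumes "finite W" "R \<inter> S = {}"
  shows "predim (R \<union> S) W = predim R W - int (card {r \<in> S. r \<subseteq> W})"
proof -
  have "{r \<in> R \<union> S. r \<subseteq> W} = {r \<in> R. r \<subseteq> W} \<union> {r \<in> S. r \<subseteq> W}" by auto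
  moreover have "card ({r \<in> R. r \<subseteq> W} \<union> {r \<in> S. r \<subseteq> W})
      = card {r \<in> R. r \<subseteq> W} + card {r \<in> S. r \<subseteq> W}"
    by (rule card_Un_disjoint) (use assms finite_rels_in in auto)
  ultimately show ?thesis by (simp add: predim_def)
qed

lemma predim_insert:
  assumes "finite W" "y \<notin> W"
  shows "predim R (insert y W) = predim R W + 1 - int (card {r \<in> R. y \<in> r \<and> r \<subseteq> insert y W})"
proof -
  have "{r \<in> R. r \<subseteq> insert y W} = {r \<in> R. r \<subseteq> W} \<union> {r \<in> R. y \<in> r \<and> r \<subseteq> insert y W}"
    using assms by auto
  moreover have "card ({r \<in> R. r \<subseteq> W} \<union> {r \<in> R. y \<in> r \<and> r \<subseteq> insert y W})
      = card {r \<in> R. r \<subseteq> W} + card {r \<in> R. y \<in> r \<and> r \<subseteq> insert y W}"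
    by (rule card_Un_disjoint)
      (use assms finite_rels_in[of W R] finite_rels_in[of "insert y W" R] in
        \<open>auto elim: rev_finite_subset\<close>)
  ultimately show ?thesis using assms by (simp add: predim_def)
qed

lemma predim_cong:
  assumes "\<And>r. r \<subseteq> W \<Longrightarrow> r \<in> R \<longleftrightarrow> r \<in> R'"
  shows "predim R W = predim R' W"
proof -
  have "{r \<in> R. r \<subseteq> W} = {r \<in> R'. r \<subseteq> W}" using assms by auto
  then show ?thesis by (simp add: predim_def)
qed

lemma delta_induced: "W \<subseteq> S \<Longrightarrow> delta (induced B S) W = delta B W"
  unfolding delta_predim by (rule predim_cong) (auto simp: induced_def)

lemma pts_induced [simp]: "pts (induced B S) = S"
  by (simp add: induced_def)

lemma rel_induced [simp]: "rel (induced B S) = {r \<in> rel B. r \<subseteq> S}"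
  by (simp add: induced_def)

lemma delta_embedding:
  assumes "embedding f A B" "W \<subseteq> pts A"
  shows "delta B (f ` W) = delta A W"
proof -
  have inj: "inj_on f (pts A)" and rel: "\<And>r. r \<subseteq> pts A \<Longrightarrow> f ` r \<in> rel B \<longleftrightarrow> r \<in> rel A"
    using assms(1) by (auto simp: embedding_def)
  have "{r \<in> rel B. r \<subseteq> f ` W} = (`) f ` {r \<in> rel A. r \<subseteq> W}"
  proof (intro subset_antisym subsetI)
    fix r assume "r \<in> {r \<in> rel B. r \<subseteq> f ` W}"
    then obtain r' where "r' \<subseteq> W" "r = f ` r'" "r \<in> rel B" by (auto simp: subset_image_iff)
    then show "r \<in> (`) f ` {r \<in> rel A. r \<subseteq> W}" using rel[of r'] assms(2) by auto
  next
    fix r assume "r \<in> (`) f ` {r \<in> rel A. r \<subseteq> W}"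
    then obtain r' where r': "r' \<in> rel A" "r' \<subseteq> W" "r = f ` r'" by blast
    moreover have "r' \<subseteq> pts A" using r'(2) assms(2) by blast
    ultimately show "r \<in> {r \<in> rel B. r \<subseteq> f ` W}" using rel[of r'] by blast
  qed
  moreover have "inj_on ((`) f) {r \<in> rel A. r \<subseteq> W}"
    by (rule inj_on_subset[OF inj_on_image_Pow[OF inj]]) (use assms(2) in auto)
  moreover have "card (f ` W) = card W"
    by (rule card_image) (use inj assms(2) inj_on_subset in blast)
  ultimately show ?thesis by (simp add: delta_def card_image)
qed

lemma embedding_comp:
  assumes "embedding f A B" "embedding g B C"
  shows "embedding (\<lambda>x. g (f x)) A C"
proof -
  have 1: "f ` pts A \<subseteq> pts B" using assms by (simp add: embedding_def)
  have "inj_on (g \<circ> f) (pts A)"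
    by (rule comp_inj_on) (use assms in \<open>auto simp: embedding_def intro: inj_on_subset\<close>)
  moreover have "(\<lambda>x. g (f x)) ` r \<in> rel C \<longleftrightarrow> r \<in> rel A" if "r \<subseteq> pts A" for r
  proof -
    have "f ` r \<subseteq> pts B" using that 1 by blast
    moreover have "(\<lambda>x. g (f x)) ` r = g ` f ` r" by (simp add: image_image)
    ultimately show ?thesis using assms that by (simp add: embedding_def)
  qed
  moreover have "(\<lambda>x. g (f x)) ` pts A \<subseteq> pts C" using assms 1 by (force simp: embedding_def)
  ultimately show ?thesis by (simp add: embedding_def comp_def)
qed

lemma embedding_inv:
  assumes "isomorphism g B A"
  shows "embedding (inv_into (pts B) g) A B"
proof -
  let ?h = "inv_into (pts B) g"
  have inj: "inj_on g (pts B)" and im: "g ` pts B = pts A"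
    and rel: "\<And>r. r \<subseteq> pts B \<Longrightarrow> g ` r \<in> rel A \<longleftrightarrow> r \<in> rel B"
    using assms by (auto simp: isomorphism_def embedding_def)
  have "?h ` r \<in> rel B \<longleftrightarrow> r \<in> rel A" if "r \<subseteq> pts A" for r
  proof -
    have "?h ` r \<subseteq> pts B" using that im by (blast intro: inv_into_into)
    moreover have "g ` ?h ` r = r" using that im image_inv_into_cancel by metis
    ultimately show ?thesis using rel[of "?h ` r"] by simp
  qed
  moreover have "inj_on ?h (pts A)" by (rule inj_on_inv_into) (simp add: im)
  moreover have "?h ` pts A \<subseteq> pts B" using im by (blast intro: inv_into_into)
  ultimately show ?thesis by (simp add: embedding_def)
qed

lemma embedding_is_lstruct:
  assumes "embedding f A B" "is_lstruct B" "\<And>r. r \<in> rel A \<Longrightarrow> r \<subseteq> pts A"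
  shows "is_lstruct A"
  unfolding is_lstruct_def
proof (intro ballI conjI)
  fix r assume r: "r \<in> rel A"
  show "r \<subseteq> pts A" using assms(3) r by blast
  then have "inj_on f r" "f ` r \<in> rel B"
    using assms(1) r by (auto simp: embedding_def intro: inj_on_subset)
  then have "card (f ` r) = card r" "f ` r \<in> rel B" by (simp_all add: card_image)
  then show "card r = 3" using assms(2) by (simp add: is_lstruct_def)
qed

lemma delta_card_le2:
  assumes "is_lstruct A" "finite W" "card W \<le> 2"
  shows "delta A W = int (card W)"
proof -
  have "\<not> r \<subseteq> W" if "r \<in> rel A" for r
    using assms card_mono[OF assms(2), of r] that by (auto simp: is_lstruct_def)
  then have "{r \<in> rel A. r \<subseteq> W} = {}" by blast
  then show ?thesis by (simp only: delta_def) simp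
qed

lemma delta_card_3:
  assumes "is_lstruct A" "card W = 3"
  shows "delta A W = (if W \<in> rel A then 2 else 3)"
proof -
  have fin: "finite W" using assms(2) card.infinite by fastforce
  have "r = W" if "r \<in> rel A" "r \<subseteq> W" for r
    using assms that card_subset_eq[OF fin] by (simp add: is_lstruct_def)
  then have "{r \<in> rel A. r \<subseteq> W} = (if W \<in> rel A then {W} else {})" by auto
  then show ?thesis using assms(2) by (simp only: delta_def) simp
qed

lemma delta_ge_min:
  assumes "is_lstruct A" "finite W" "4 \<le> card W \<Longrightarrow> 3 \<le> delta A W"
  shows "int (min (card W) 2) \<le> delta A W"
proof -
  consider "card W \<le> 2" | "card W = 3" | "4 \<le> card W" by linarith
  then show ?thesis
    using delta_card_le2[OF assms(1,2)] delta_card_3[OF assms(1), of W] assms(3) by cases auto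
qed

text \<open>Four points carrying three relations would have predimension at most 1, less than a pair
  of them. So four points always contain a triple that is no relation, and its self-sufficiency
  gives the bound 3. Conversely, sets of at most three points have predimension at most 3, and
  supersets of at most three points are settled by their size. From here on membership in
  \<open>K0\<close> is a matter of counting.\<close>

lemma K0_iff:
  "A \<in> K0 \<longleftrightarrow> is_lstruct A \<and> finite (pts A) \<and> (\<forall>W\<subseteq>pts A. 4 \<le> card W \<longrightarrow> 3 \<le> delta A W)"
proof (intro iffI conjI allI impI)
  assume K: "A \<in> K0"
  then show l: "is_lstruct A" and fin: "finite (pts A)" by (auto simp: K0_def C0_def)
  fix W assume W: "W \<subseteq> pts A" "4 \<le> card W"
  then obtain Q where Q: "Q \<subseteq> W" "card Q = 4" by (metis obtain_subset_with_card_n)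
  have fQ: "finite Q" using Q card.infinite by fastforce
  have ss: "delta A (C \<inter> B) \<le> delta A C" if "card B \<le> 3" "B \<subseteq> Q" "C \<subseteq> pts A" for B C
  proof -
    have "selfsuff B A" using K that Q W by (auto simp: K0_def)
    moreover have "finite C" using that fin finite_subset by blast
    ultimately show ?thesis using that by (simp add: selfsuff_def)
  qed
  have "\<exists>B\<subseteq>Q. card B = 3 \<and> B \<notin> rel A"
  proof (rule ccontr)
    assume neg: "\<not> ?thesis"
    have "card Q = Suc 3" using Q(2) by simp
    then obtain a Q' where a: "Q = insert a Q'" "a \<notin> Q'" "card Q' = 3"
      by (metis card_Suc_eq)
    then obtain b c d where b: "Q' = {b,c,d}" "b \<noteq> c" "b \<noteq> d" "c \<noteq> d" by (auto simp: card_3_iff)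
    have "{{a,b,c},{a,b,d},{a,c,d}} \<subseteq> {r \<in> rel A. r \<subseteq> Q}"
      using neg a b by auto
    from card_mono[OF finite_rels_in[OF fQ] this]
    have "3 \<le> card {r \<in> rel A. r \<subseteq> Q}" using a b by (auto simp: insert_eq_iff doubleton_eq_iff)
    then have "delta A Q \<le> 1" using Q by (simp add: delta_def)
    moreover have "delta A (Q \<inter> {a,b}) \<le> delta A Q"
      by (rule ss) (use a b Q W in \<open>auto simp: card_insert_if\<close>)
    moreover have "Q \<inter> {a,b} = {a,b}" using a b by auto
    moreover have "delta A {a,b} = 2" using delta_card_le2[OF l, of "{a,b}"] a b by auto
    ultimately show False by simp
  qed
  then obtain B where B: "B \<subseteq> Q" "card B = 3" "B \<notin> rel A" by blast
  then have "delta A (W \<inter> B) \<le> delta A W" using ss[of B W] W by simp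
  moreover have "W \<inter> B = B" using B Q by auto
  ultimately show "3 \<le> delta A W" using delta_card_3[OF l B(2)] B by simp
next
  assume asm: "is_lstruct A \<and> finite (pts A) \<and> (\<forall>W\<subseteq>pts A. 4 \<le> card W \<longrightarrow> 3 \<le> delta A W)"
  then have l: "is_lstruct A" and fin: "finite (pts A)"
    and big: "\<And>W. W \<subseteq> pts A \<Longrightarrow> 4 \<le> card W \<Longrightarrow> 3 \<le> delta A W" by auto
  have low: "int (min (card W) 2) \<le> delta A W" if "W \<subseteq> pts A" for W
    using delta_ge_min[OF l finite_subset[OF that fin]] big[OF that] by simp
  have "selfsuff B A" if B: "B \<subseteq> pts A" "card B \<le> 3" for B
    unfolding selfsuff_finite_iff[OF fin]
  proof (intro conjI allI impI B(1))
    fix B' assume B': "B \<subseteq> B' \<and> B' \<subseteq> pts A"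
    then have f: "finite B'" "finite B" using fin by (auto intro: finite_subset)
    show "delta A B \<le> delta A B'"
    proof (cases "B = B'")
      case False
      then have lt: "card B < card B'" using B' f psubset_card_mono by blast
      show ?thesis
      proof (cases "4 \<le> card B'")
        case True
        then show ?thesis using big[of B'] B' B predim_le_card[of "rel A" B] by (simp add: delta_predim)
      next
        case False
        then have "delta A B = int (card B)" using lt delta_card_le2[OF l f(2)] by simp
        then show ?thesis using low[of B'] B' lt False by auto
      qed
    qed simp
  qed
  moreover have "0 \<le> delta A S" if "S \<subseteq> pts A" for S using low[OF that] by linarith
  ultimately show "A \<in> K0" using l fin by (simp add: K0_def C0_def)
qed

lemma K0_low:
  assumes "A \<in> K0" "W \<subseteq> pts A"
  shows "int (min (card W) 2) \<le> delta A W"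
  using assms by (intro delta_ge_min) (auto simp: K0_iff intro: finite_subset)

lemma K0_embedding:
  assumes "embedding f A B" "B \<in> K0" "\<And>r. r \<in> rel A \<Longrightarrow> r \<subseteq> pts A"
  shows "A \<in> K0"
proof -
  have inj: "inj_on f (pts A)" and im: "f ` pts A \<subseteq> pts B" using assms(1) by (auto simp: embedding_def)
  have "finite (pts A)" using inj im assms(2) by (auto simp: K0_iff dest: inj_on_finite)
  moreover have "3 \<le> delta A W" if W: "W \<subseteq> pts A" "4 \<le> card W" for W
  proof -
    have "card (f ` W) = card W" by (rule card_image) (use inj W inj_on_subset in blast)
    moreover have "f ` W \<subseteq> pts B" using im W by blast
    ultimately show ?thesis using assms(2) delta_embedding[OF assms(1) W(1)] W(2)
      by (metis K0_iff)
  qed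
  moreover have "is_lstruct A"
    using embedding_is_lstruct[OF assms(1) _ assms(3)] assms(2) by (simp add: K0_iff)
  ultimately show ?thesis by (simp add: K0_iff)
qed

lemma K0_subset_C0: "A \<in> K0 \<Longrightarrow> A \<in> C0"
  by (simp add: K0_def)

lemma Cmu_copies:
  assumes "A \<in> Cmu \<mu>" "msa Y Z" "\<forall>i<\<mu> Y Z + 1. embedding (f i) Z A"
    "\<forall>i<\<mu> Y Z + 1. \<forall>j<\<mu> Y Z + 1. i \<noteq> j \<longrightarrow>
       (\<forall>y\<in>Y. f i y = f j y) \<and> f i ` (pts Z - Y) \<inter> f j ` (pts Z - Y) = {}"
  shows False
  using assms unfolding Cmu_def mem_Collect_eq by (elim conjE notE) (intro exI conjI)

lemma CmuI:
  assumes "A \<in> C0"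
    and "\<And>Y Z f. msa Y Z \<Longrightarrow> \<forall>i<\<mu> Y Z + 1. embedding (f i) Z A \<Longrightarrow>
      \<forall>i<\<mu> Y Z + 1. \<forall>j<\<mu> Y Z + 1. i \<noteq> j \<longrightarrow>
         (\<forall>y\<in>Y. f i y = f j y) \<and> f i ` (pts Z - Y) \<inter> f j ` (pts Z - Y) = {} \<Longrightarrow> False"
  shows "A \<in> Cmu \<mu>"
  unfolding Cmu_def mem_Collect_eq using assms(1)
  by (intro conjI notI) (assumption, elim exE conjE, rule assms(2))

text \<open>Forbidden configurations are arbitrary substructures, so copies in \<open>A\<close> can
  be pushed forward to \<open>B\<close>. Hence every finite substructure of the generic structure
  belongs to the class up to isomorphism, self-sufficient or not.\<close>

lemma Kmu_embedding:
  assumes "embedding f A B" "B \<in> Kmu \<mu>" "\<And>r. r \<in> rel A \<Longrightarrow> r \<subseteq> pts A"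
  shows "A \<in> Kmu \<mu>"
proof -
  have K: "A \<in> K0" using K0_embedding[OF assms(1) _ assms(3)] assms(2) by (simp add: Kmu_def)
  have inj: "inj_on f (pts A)" using assms(1) by (simp add: embedding_def)
  have False if msa: "msa Y Z" and emb: "\<forall>i<\<mu> Y Z + 1. embedding (g i) Z A"
    and dis: "\<forall>i<\<mu> Y Z + 1. \<forall>j<\<mu> Y Z + 1. i \<noteq> j \<longrightarrow>
         (\<forall>y\<in>Y. g i y = g j y) \<and> g i ` (pts Z - Y) \<inter> g j ` (pts Z - Y) = {}" for Y Z g
  proof -
    let ?g = "\<lambda>i x. f (g i x)"
    have "embedding (?g i) Z B" if "i < \<mu> Y Z + 1" for i
      using embedding_comp[OF _ assms(1)] emb that by blast
    moreover have "?g i ` (pts Z - Y) \<inter> ?g j ` (pts Z - Y) = {}"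
      if ij: "i < \<mu> Y Z + 1" "j < \<mu> Y Z + 1" "i \<noteq> j" for i j
    proof -
      have *: "g i ` pts Z \<subseteq> pts A" "g j ` pts Z \<subseteq> pts A" using emb ij by (auto simp: embedding_def)
      have "g i ` (pts Z - Y) \<inter> g j ` (pts Z - Y) = {}" using dis ij by blast
      moreover have "g i ` (pts Z - Y) \<subseteq> pts A" "g j ` (pts Z - Y) \<subseteq> pts A" using * by auto
      ultimately have "f ` (g i ` (pts Z - Y)) \<inter> f ` (g j ` (pts Z - Y)) = {}"
        using inj_on_image_Int[OF inj] by (metis image_empty)
      then show ?thesis by (simp add: image_image)
    qed
    moreover have "\<forall>y\<in>Y. ?g i y = ?g j y"
      if "i < \<mu> Y Z + 1" "j < \<mu> Y Z + 1" "i \<noteq> j" for i j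
      using dis that by metis
    moreover have "B \<in> Cmu \<mu>" using assms(2) by (simp add: Kmu_def)
    ultimately show False using Cmu_copies[of B \<mu> Y Z ?g] msa by blast
  qed
  then have "A \<in> Cmu \<mu>" by (intro CmuI K0_subset_C0[OF K])
  then show ?thesis using K by (simp add: Kmu_def)
qed

section \<open>Minimally simply algebraic extensions\<close>

lemma C0_induced:
  assumes "B \<in> C0" "S \<subseteq> pts B"
  shows "induced B S \<in> C0"
proof -
  have "finite S" using assms finite_subset by (auto simp: C0_def)
  moreover have "0 \<le> delta (induced B S) W" if "W \<subseteq> S" for W
    using assms that by (auto simp: C0_def delta_induced)
  ultimately show ?thesis using assms by (auto simp: C0_def is_lstruct_def)
qed

lemma C0_D:
  assumes "B \<in> C0"
  shows "is_lstruct B" "finite (pts B)" "\<And>W. W \<subseteq> pts B \<Longrightarrow> 0 \<le> delta B W"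
  using assms by (auto simp: C0_def)

lemma simply_algebraic_iff:
  assumes "Z \<in> C0"
  shows "simply_algebraic Y Z \<longleftrightarrow> Y \<subset> pts Z \<and> delta Z (pts Z) = delta Z Y \<and>
    (\<forall>Z'. Y \<subset> Z' \<and> Z' \<subset> pts Z \<longrightarrow> delta Z Y < delta Z Z')"
proof -
  have "delta Z Y \<le> delta Z B'" if "Y \<subset> pts Z" "delta Z (pts Z) = delta Z Y"
     "\<forall>Z'. Y \<subset> Z' \<and> Z' \<subset> pts Z \<longrightarrow> delta Z Y < delta Z Z'" "Y \<subseteq> B'" "B' \<subseteq> pts Z" for B'
    using that by (metis order_le_less order_less_imp_le psubsetI)
  then show ?thesis
    using assms C0_D(2)[OF assms]
    by (auto simp: simply_algebraic_def algebraic_ext_def selfsuff_finite_iff)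
qed

lemma msa_D:
  assumes "msa Y Z"
  shows "Z \<in> C0" "Y \<subset> pts Z" "delta Z (pts Z) = delta Z Y"
    "\<And>Z'. Y \<subset> Z' \<Longrightarrow> Z' \<subset> pts Z \<Longrightarrow> delta Z Y < delta Z Z'"
    "\<And>Y'. Y' \<subset> Y \<Longrightarrow> \<not> simply_algebraic Y' (induced Z (Y' \<union> (pts Z - Y)))"
proof -
  show "Z \<in> C0" using assms by (simp add: msa_def simply_algebraic_def algebraic_ext_def)
  then show "Y \<subset> pts Z" "delta Z (pts Z) = delta Z Y"
    "\<And>Z'. Y \<subset> Z' \<Longrightarrow> Z' \<subset> pts Z \<Longrightarrow> delta Z Y < delta Z Z'"
    using assms by (simp_all add: msa_def simply_algebraic_iff)
  show "\<And>Y'. Y' \<subset> Y \<Longrightarrow> \<not> simply_algebraic Y' (induced Z (Y' \<union> (pts Z - Y)))"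
    using assms by (simp add: msa_def)
qed

text \<open>If every relation through \<open>y\<close> stayed inside \<open>Y\<close>, deleting
  \<open>y\<close> would shift the predimension of all sets between \<open>Y\<close> and
  \<open>Z\<close> by the same constant \<open>c\<close>, and \<open>Y - {y}\<close> would still be
  a base, against minimality.\<close>

lemma msa_base_point_related:
  assumes "msa Y Z" "y \<in> Y"
  shows "\<exists>r\<in>rel Z. y \<in> r \<and> r \<inter> (pts Z - Y) \<noteq> {}"
proof (rule ccontr)
  assume neg: "\<not> ?thesis"
  note Z = msa_D[OF assms(1)]
  let ?Y = "Y - {y}"
  let ?Z = "induced Z (?Y \<union> (pts Z - Y))"
  have fin: "finite (pts Z)" and l: "is_lstruct Z" using C0_D[OF Z(1)] by auto
  define c where "c = int (card {r \<in> rel Z. y \<in> r}) - 1"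
  have shift: "delta Z W = delta Z (insert y W) + c" if W: "?Y \<subseteq> W" "W \<subseteq> pts Z" "y \<notin> W" for W
  proof -
    have "finite W" using W fin finite_subset by blast
    moreover have "{r \<in> rel Z. y \<in> r \<and> r \<subseteq> insert y W} = {r \<in> rel Z. y \<in> r}"
      using neg l W by (auto simp: is_lstruct_def) blast
    ultimately show ?thesis using predim_insert[of W y "rel Z"] W(3) by (simp add: delta_predim c_def)
  qed
  have pZ: "pts ?Z = pts Z - {y}" using assms(2) Z(2) by auto
  have dZ: "delta ?Z W = delta Z (insert y W) + c" if "?Y \<subseteq> W" "W \<subseteq> pts Z - {y}" for W
    using shift[of W] that delta_induced[of W "pts ?Z" Z] pZ by auto
  have iy: "insert y ?Y = Y" "insert y (pts Z - {y}) = pts Z" using assms(2) Z(2) by auto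
  have "simply_algebraic ?Y ?Z"
    proof (subst simply_algebraic_iff)
      show "?Z \<in> C0" by (rule C0_induced[OF Z(1)]) (use Z(2) in auto)
      have "delta ?Z ?Y < delta ?Z Z'" if "?Y \<subset> Z'" "Z' \<subset> pts ?Z" for Z'
      proof -
        have "Y \<subset> insert y Z'" "insert y Z' \<subset> pts Z" using that assms(2) Z(2) pZ by auto
        then show ?thesis using Z(4)[of "insert y Z'"] dZ[of ?Y] dZ[of Z'] that pZ iy Z(2) by auto
      qed
      moreover have "?Y \<subset> pts ?Z" using pZ Z(2) assms(2) by blast
      moreover have "delta ?Z (pts ?Z) = delta ?Z ?Y"
        using dZ[of ?Y] dZ[of "pts Z - {y}"] Z(2,3) unfolding pZ iy by fastforce
      ultimately show "?Y \<subset> pts ?Z \<and> delta ?Z (pts ?Z) = delta ?Z ?Y \<and>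
          (\<forall>Z'. ?Y \<subset> Z' \<and> Z' \<subset> pts ?Z \<longrightarrow> delta ?Z ?Y < delta ?Z Z')"
        by blast
    qed
  then show False using Z(5)[of ?Y] assms(2) by blast
qed

text \<open>Removing a point on at most one relation does not raise the predimension, so by
  simplicity only \<open>Y\<close> is left. Then the extension adds \<open>z\<close> by a single
  relation \<open>r\<close>, for which the pair \<open>r - {z}\<close> is already a base. The bound
  on \<open>delta Z Y\<close> makes this pair a proper subset of \<open>Y\<close>, against
  minimality.\<close>

lemma msa_new_point_degree:
  assumes "msa Y Z" "3 \<le> delta Z Y" "z \<in> pts Z - Y"
  shows "2 \<le> card {r \<in> rel Z. z \<in> r}"
proof (rule ccontr)
  assume neg: "\<not> ?thesis"
  note Z = msa_D[OF assms(1)]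
  have fin: "finite (pts Z)" and l: "is_lstruct Z" using C0_D[OF Z(1)] by auto
  have sub: "\<And>r. r \<in> rel Z \<Longrightarrow> r \<subseteq> pts Z" using l by (simp add: is_lstruct_def)
  let ?W = "pts Z - {z}"
  have iz: "insert z ?W = pts Z" using assms(3) by auto
  have "{r \<in> rel Z. z \<in> r \<and> r \<subseteq> insert z ?W} = {r \<in> rel Z. z \<in> r}" using sub iz by auto
  then have d: "delta Z (pts Z) = delta Z ?W + 1 - int (card {r \<in> rel Z. z \<in> r})"
    using predim_insert[of ?W z "rel Z"] fin iz by (simp add: delta_predim)
  have W: "Y \<subseteq> ?W" "?W \<subset> pts Z" using Z(2) assms(3) by auto
  have WY: "?W = Y"
  proof (rule ccontr)
    assume "?W \<noteq> Y"
    then have "delta Z Y < delta Z ?W" using Z(4)[of ?W] W by auto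
    then show False using d Z(3) neg by simp
  qed
  then have "card {r \<in> rel Z. z \<in> r} = 1" using d Z(3) by simp
  then obtain r where r: "{r \<in> rel Z. z \<in> r} = {r}" by (auto simp: card_1_singleton_iff)
  then have r1: "r \<in> rel Z" "z \<in> r" by auto
  have rp: "r \<subseteq> pts Z" "card r = 3" using l r1 by (auto simp: is_lstruct_def)
  let ?Y = "r - {z}"
  have fr: "finite r" using rp fin finite_subset by blast
  have cY: "card ?Y = 2" using rp r1 fr by simp
  have YY: "?Y \<subset> Y"
  proof -
    have "?Y \<subseteq> Y" using rp WY by auto
    moreover have "?Y \<noteq> Y" using assms(2) predim_le_card[of "rel Z" ?Y] cY by (auto simp: delta_predim)
    ultimately show ?thesis by blast
  qed
  have e: "?Y \<union> (pts Z - Y) = r" using WY r1 assms(3) Z(2) by auto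
  have c0: "induced Z r \<in> C0" using C0_induced[OF Z(1)] rp by blast
  have "simply_algebraic ?Y (induced Z r)"
    unfolding simply_algebraic_iff[OF c0]
  proof (intro conjI allI impI)
    show "?Y \<subset> pts (induced Z r)" using r1 by auto
    show "delta (induced Z r) (pts (induced Z r)) = delta (induced Z r) ?Y"
      using delta_card_3[OF l rp(2)] delta_card_le2[OF l, of ?Y] cY fr r1 by (simp add: delta_induced)
    fix Z' assume "?Y \<subset> Z' \<and> Z' \<subset> pts (induced Z r)"
    then have False using r1 by auto
    then show "delta (induced Z r) ?Y < delta (induced Z r) Z'" ..
  qed
  then show False using Z(5)[OF YY] e by simp
qed

text \<open>This is the case that the lower bound on \<open>\<mu>\<close> does not cover. In
  \<open>K0\<close> a set of four or more points has predimension at least 3, which leaves only a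
  single relation over two of its points.\<close>

lemma msa_K0_low:
  assumes "msa Y Z" "Z \<in> K0" "delta Z Y \<le> 2"
  shows "card (pts Z) = 3" "pts Z \<in> rel Z" "card Y = 2"
proof -
  note Z = msa_D[OF assms(1)]
  have l: "is_lstruct Z" and fin: "finite (pts Z)"
    and big: "4 \<le> card (pts Z) \<Longrightarrow> 3 \<le> delta Z (pts Z)" using assms(2) by (auto simp: K0_iff)
  have fY: "finite Y" using Z(2) fin finite_subset by blast
  have lt: "card Y < card (pts Z)" using Z(2) fin psubset_card_mono by blast
  have c: "card (pts Z) \<le> 3" using big assms(3) Z(3) by linarith
  have dY: "delta Z Y = int (card Y)" using delta_card_le2[OF l fY] c lt by simp
  show c3: "card (pts Z) = 3"
    using c dY lt Z(3) delta_card_le2[OF l fin] by (cases "card (pts Z) \<le> 2") auto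
  then show "pts Z \<in> rel Z" "card Y = 2"
    using delta_card_3[OF l c3] dY Z(3) assms(3) by (auto split: if_splits)
qed

text \<open>Two relations sharing two points would give four points of predimension at most
  2.\<close>

lemma K0_linear:
  assumes "A \<in> K0" "r1 \<in> rel A" "r2 \<in> rel A" "r1 \<noteq> r2"
  shows "card (r1 \<inter> r2) \<le> 1"
proof (rule ccontr)
  assume neg: "\<not> ?thesis"
  have l: "is_lstruct A" using assms(1) by (simp add: K0_iff)
  have r: "r1 \<subseteq> pts A" "r2 \<subseteq> pts A" "card r1 = 3" "card r2 = 3"
    using l assms by (auto simp: is_lstruct_def)
  have f: "finite r1" "finite r2" using r card.infinite by fastforce+
  have "card (r1 \<inter> r2) < 3"
  proof (rule ccontr)
    assume "\<not> card (r1 \<inter> r2) < 3"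
    then have "r1 \<inter> r2 = r1" using f r card_seteq[of r1 "r1 \<inter> r2"] by simp
    then have "r1 \<subseteq> r2" by blast
    then show False using card_subset_eq[OF f(2)] r assms(4) by simp
  qed
  then have 2: "card (r1 \<inter> r2) = 2" using neg by simp
  then have c: "card (r1 \<union> r2) = 4" using card_Un_Int[OF f] r by simp
  have "card {r1, r2} \<le> card {r \<in> rel A. r \<subseteq> r1 \<union> r2}"
    by (rule card_mono) (use f assms finite_rels_in in auto)
  then have "delta A (r1 \<union> r2) \<le> 2" using c assms(4) by (simp add: delta_def)
  moreover have "3 \<le> delta A (r1 \<union> r2)" using assms(1) c r by (simp add: K0_iff)
  ultimately show False by simp
qed

section \<open>Replacing relations by cycles\<close>

text \<open>\<open>S\<close> is the set of relations on \<open>H\<close> to be replaced. Number \<open>i\<close> stands for the incidence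
  \<open>base i \<in> host i\<close>; its cycle \<open>u i 0, \<dots>, u i (L i - 1)\<close> has the relations \<open>edge i k\<close>, labelled
  \<open>lab i k\<close>. Adjacent labels differ so that no two relations share two points.\<close>

locale cycle_gadget =
  fixes H A :: "'a set" and RA S :: "'a set set" and X3 :: "'a set" and m :: nat
    and base :: "nat \<Rightarrow> 'a" and host :: "nat \<Rightarrow> 'a set"
    and u :: "nat \<Rightarrow> nat \<Rightarrow> 'a" and L :: "nat \<Rightarrow> nat" and lab :: "nat \<Rightarrow> nat \<Rightarrow> 'a"
  assumes finH: "finite H" and AH: "A \<subseteq> H"
    and RA: "\<And>r. r \<in> RA \<Longrightarrow> r \<subseteq> A \<and> card r = 3"
    and S: "\<And>r. r \<in> S \<Longrightarrow> r \<subseteq> H \<and> card r = 3 \<and> \<not> r \<subseteq> A"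
    and X3: "X3 \<subseteq> A"
    and incidences: "bij_betw (\<lambda>i. (base i, host i)) {..<m} {(p, r). r \<in> S \<and> p \<in> r}"
    and u_inj: "inj (\<lambda>(i, k). u i k)" and u_new: "\<And>i k. u i k \<notin> H"
    and L3: "\<And>i. 3 \<le> L i"
    and L_fast: "\<And>i. card H + (\<Sum>j<i. L j) < L i"
    and lab0: "\<And>i. lab i 0 = base i"
    and lab_X3: "\<And>i. lab i ` {0<..<L i} = X3"
    and lab_adj: "\<And>i k. k < L i \<Longrightarrow> lab i k \<noteq> lab i (Suc k mod L i)"
begin

section \<open>Edges, cycles and triangles\<close>

definition edge :: "nat \<Rightarrow> nat \<Rightarrow> 'a set" where
  "edge i k = {u i k, lab i k, u i (Suc k mod L i)}"

definition E :: "'a set set" where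
  "E = {edge i k | i k. i < m \<and> k < L i}"

definition U :: "'a set" where
  "U = {u i k | i k. i < m \<and> k < L i}"

text \<open>Since each cycle has one host, triangles of different relations are disjoint, and a
  cycle meets only one triangle, in its point with index 0.\<close>

definition tri :: "'a set \<Rightarrow> 'a set" where
  "tri r = (\<lambda>i. u i 0) ` {i. i < m \<and> host i = r}"

definition T :: "'a set set" where "T = tri ` S"

text \<open>On sets containing \<open>X3\<close> the points of a cycle are interalgebraic with its base, so a set \<open>W\<close> can be
  enlarged to \<open>full (supp W)\<close> without increasing the predimension, and there a triangle \<open>tri r\<close> is
  present iff \<open>r\<close> is.\<close>

definition supp :: "'a set \<Rightarrow> 'a set" where
  "supp W = (W \<inter> H) \<union> {base i | i. i < m \<and> (\<exists>k<L i. u i k \<in> W)}"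

definition full :: "'a set \<Rightarrow> 'a set" where
  "full P = P \<union> {u i k | i k. i < m \<and> k < L i \<and> base i \<in> P}"

lemma u_eq [simp]: "u i k = u i' k' \<longleftrightarrow> i = i' \<and> k = k'"
  using u_inj by (force simp: inj_def)

lemma Lpos: "0 < L i" using L3[of i] by linarith

lemma incidence: "i < m \<Longrightarrow> host i \<in> S \<and> base i \<in> host i"
  using bij_betw_apply[OF incidences, of i] by simp

lemma base_H: "i < m \<Longrightarrow> base i \<in> H"
  using incidence S by blast

lemma lab_H: "i < m \<Longrightarrow> k < L i \<Longrightarrow> lab i k \<in> H"
proof (cases "k = 0")
  case False
  assume "i < m" "k < L i"
  then have "lab i k \<in> X3" using lab_X3[of i] False by auto
  then show ?thesis using X3 AH by blast
qed (simp add: lab0 base_H)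

lemma lab_new [simp]: "i < m \<Longrightarrow> k < L i \<Longrightarrow> u j l \<noteq> lab i k"
  using lab_H u_new by metis

lemma finU: "finite U"
proof -
  have "U = (\<lambda>(i, k). u i k) ` (SIGMA i:{..<m}. {..<L i})" by (auto simp: U_def)
  then show ?thesis by simp
qed

lemma HU: "H \<inter> U = {}" using u_new by (auto simp: U_def)

lemma next_lt: "Suc k mod L i < L i" using Lpos by simp

lemma next_cases: "k < L i \<Longrightarrow> Suc k mod L i = (if Suc k = L i then 0 else Suc k)"
  using le_neq_implies_less mod_less Suc_leI by (metis mod_self)

lemma next_neq: "k < L i \<Longrightarrow> Suc k mod L i \<noteq> k"
  using next_cases[of k i] L3[of i] by auto

lemma next_next: "k < L i \<Longrightarrow> k' < L i \<Longrightarrow> k' = Suc k mod L i \<Longrightarrow> Suc k' mod L i \<noteq> k"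
  using next_cases[of k i] next_cases[of k' i] L3[of i] by (auto split: if_splits)

lemma u_in_edge:
  assumes "i < m" "k < L i"
  shows "u j l \<in> edge i k \<longleftrightarrow> j = i \<and> (l = k \<or> l = Suc k mod L i)"
  using assms by (auto simp: edge_def)

lemma edge_eq:
  assumes "i < m" "k < L i" "j < m" "l < L j" "edge i k = edge j l"
  shows "i = j \<and> k = l"
proof -
  have 1: "u i k \<in> edge j l" "u i (Suc k mod L i) \<in> edge j l"
    using assms(5)[symmetric] by (simp_all add: edge_def[of i k])
  then have "i = j" using u_in_edge[OF assms(3,4)] by blast
  moreover have "k = l"
  proof (rule ccontr)
    assume "k \<noteq> l"
    then have "k = Suc l mod L j" "Suc k mod L i = l"
      using 1 u_in_edge[OF assms(3,4)] next_neq[OF assms(2)] by auto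
    then show False using next_next[of l j k] assms \<open>i = j\<close> by auto
  qed
  ultimately show ?thesis ..
qed

lemma edge_card: "i < m \<Longrightarrow> k < L i \<Longrightarrow> card (edge i k) = 3"
  using next_neq[of k i] by (auto simp: edge_def card_insert_if dest: lab_new[symmetric])

lemma edge_sub: "i < m \<Longrightarrow> k < L i \<Longrightarrow> edge i k \<subseteq> H \<union> U"
  using lab_H[of i k] next_lt[of k i] by (auto simp: edge_def U_def)

lemma tri_mem: "u i k \<in> tri r \<longleftrightarrow> i < m \<and> k = 0 \<and> host i = r"
  by (auto simp: tri_def)

lemma tri_nonempty: "r \<in> S \<Longrightarrow> p \<in> r \<Longrightarrow> \<exists>i<m. base i = p \<and> host i = r"
proof -
  assume "r \<in> S" "p \<in> r"
  then have "(p, r) \<in> (\<lambda>i. (base i, host i)) ` {..<m}"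
    using incidences by (simp add: bij_betw_def)
  then show ?thesis by auto
qed

lemma tri_card: "r \<in> S \<Longrightarrow> card (tri r) = 3"
proof -
  assume r: "r \<in> S"
  let ?J = "{i. i < m \<and> host i = r}"
  have "inj_on base ?J"
    using incidences unfolding bij_betw_def inj_on_def by fastforce
  moreover have "base ` ?J = r" using incidence tri_nonempty[OF r] by fastforce
  ultimately have "card ?J = card r" using card_image by fastforce
  moreover have "card (tri r) = card ?J"
    unfolding tri_def by (rule card_image) (simp add: inj_on_def)
  ultimately show ?thesis using S r by simp
qed

lemma tri_sub: "tri r \<subseteq> U"
  using Lpos by (auto simp: tri_def U_def)

lemma tri_inj: "inj_on tri S"
proof (rule inj_onI)
  fix r r' assume r: "r \<in> S" "r' \<in> S" "tri r = tri r'"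
  then have "tri r \<noteq> {}" using tri_card[of r] by auto
  then obtain i where "i < m" "host i = r" by (auto simp: tri_def)
  then show "r = r'" using r tri_mem[of i 0 r] tri_mem[of i 0 r'] by auto
qed

lemma T_E_disjoint: "T \<inter> E = {}"
proof -
  have "tri r \<noteq> edge i k" if "i < m" "k < L i" for r i k
  proof
    assume "tri r = edge i k"
    then have "u i k \<in> tri r" "u i (Suc k mod L i) \<in> tri r" by (auto simp: edge_def)
    then show False using tri_mem next_neq[OF that(2)] by auto
  qed
  then show ?thesis by (auto simp: T_def E_def)
qed

lemma sub_H_E_disjoint: "(\<And>r. r \<in> Q \<Longrightarrow> r \<subseteq> H) \<Longrightarrow> Q \<inter> E = {}"
  using u_new by (fastforce simp: E_def edge_def)

lemma RA_T_disjoint: "RA \<inter> T = {}"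
proof -
  have "r \<noteq> tri s" if "r \<in> RA" for r s
  proof
    assume "r = tri s"
    then have "r \<subseteq> H \<inter> U" using RA[OF that] AH tri_sub by blast
    then have "r = {}" using HU by blast
    then show False using RA[OF that] by simp
  qed
  then show ?thesis by (auto simp: T_def)
qed

section \<open>Predimension before and after the replacement\<close>

lemma supp_sub: "supp W \<subseteq> H"
  using base_H by (auto simp: supp_def)

lemma full_H: "P \<subseteq> H \<Longrightarrow> full P \<inter> H = P"
  using u_new by (auto simp: full_def)

lemma full_sub: "P \<subseteq> H \<Longrightarrow> full P \<subseteq> H \<union> U"
  by (auto simp: full_def U_def)

lemma subset_full_supp: "W \<subseteq> H \<union> U \<Longrightarrow> W \<subseteq> full (supp W)"
  by (auto simp: full_def supp_def U_def)

text \<open>Charging each edge to its first point shows that a cycle has in \<open>W\<close> at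
  least as many points as edges. If the cycle meets \<open>W\<close> but its base is missing, some
  point of it has no edge in \<open>W\<close>, and this surplus pays for putting the base into
  \<open>supp W\<close>.\<close>

lemma predim_edges_lower:
  assumes W: "W \<subseteq> H \<union> U"
  shows "int (card (supp W)) - int (card {r \<in> Q. r \<subseteq> W}) \<le> predim (Q \<union> E) W"
proof -
  define V where "V i = {k. k < L i \<and> u i k \<in> W}" for i
  define N where "N i = {k. k \<in> V i \<and> edge i k \<subseteq> W}" for i
  define J where "J = {i. i < m \<and> V i \<noteq> {} \<and> base i \<notin> W}"
  have finW: "finite W" using W finH finU finite_subset by blast
  have fV: "finite (V i)" for i by (simp add: V_def)
  have NV: "card (N i) + (if i \<in> J then 1 else 0) \<le> card (V i)" if i: "i < m" for i
  proof (cases "i \<in> J")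
    case True
    \<comment> \<open>\<open>edge i 0\<close> contains the base, so it is not inside
      \<open>W\<close>. If \<open>u i 0\<close> is missing, the edge leaving the last point of the
      cycle in \<open>W\<close> is incomplete, because its far end lies beyond the maximum or is
      \<open>u i 0\<close>.\<close>
    obtain k where k: "k \<in> V i" "k \<notin> N i"
    proof (cases "0 \<in> V i")
      case True
      have "\<not> edge i 0 \<subseteq> W" using \<open>i \<in> J\<close> by (simp add: J_def edge_def lab0)
      then show ?thesis using that[of 0] True by (simp add: N_def)
    next
      case False
      let ?k = "Max (V i)"
      have k: "?k \<in> V i" using True fV by (simp add: J_def)
      then have kL: "?k < L i" by (simp add: V_def)
      have "Suc ?k mod L i \<notin> V i"
        using next_cases[OF kL] False Max_ge[OF fV, of "Suc ?k" i] by (auto split: if_splits)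
      then have "\<not> edge i ?k \<subseteq> W" using next_lt[of ?k i] by (auto simp: V_def edge_def)
      then show ?thesis using that[of ?k] k by (simp add: N_def)
    qed
    then have "N i \<subset> V i" by (auto simp: N_def)
    then have "card (N i) < card (V i)" by (rule psubset_card_mono[OF fV])
    then show ?thesis using True by simp
  next
    case False
    then show ?thesis using card_mono[OF fV, of "N i" i] by (auto simp: N_def)
  qed
  have WH: "W = (W \<inter> H) \<union> (\<Union>i\<in>{..<m}. u i ` V i)"
    using W by (auto simp: V_def U_def)
  have "card (\<Union>i\<in>{..<m}. u i ` V i) = (\<Sum>i<m. card (u i ` V i))"
    by (rule card_UN_disjoint) (auto simp: fV)
  also have "\<dots> = (\<Sum>i<m. card (V i))"
    by (intro sum.cong card_image refl) (simp add: inj_on_def)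
  finally have "card (\<Union>i\<in>{..<m}. u i ` V i) = (\<Sum>i<m. card (V i))" .
  moreover have "card ((W \<inter> H) \<union> (\<Union>i\<in>{..<m}. u i ` V i))
      = card (W \<inter> H) + card (\<Union>i\<in>{..<m}. u i ` V i)"
    by (rule card_Un_disjoint) (use finH fV u_new in auto)
  ultimately have cW: "card W = card (W \<inter> H) + (\<Sum>i<m. card (V i))" using WH by simp
  have "{r \<in> E. r \<subseteq> W} \<subseteq> (\<Union>i\<in>{..<m}. edge i ` N i)"
    by (auto simp: E_def N_def V_def) (auto simp: edge_def)
  then have "card {r \<in> E. r \<subseteq> W} \<le> card (\<Union>i\<in>{..<m}. edge i ` N i)"
    by (rule card_mono[rotated]) (auto simp: N_def fV)
  also have "\<dots> \<le> (\<Sum>i<m. card (edge i ` N i))" by (rule card_UN_le) simp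
  also have "\<dots> \<le> (\<Sum>i<m. card (N i))"
    by (intro sum_mono card_image_le) (simp add: N_def fV)
  finally have cE: "card {r \<in> E. r \<subseteq> W} \<le> (\<Sum>i<m. card (N i))" .
  have "{r \<in> Q \<union> E. r \<subseteq> W} = {r \<in> Q. r \<subseteq> W} \<union> {r \<in> E. r \<subseteq> W}" by auto
  then have cQ: "card {r \<in> Q \<union> E. r \<subseteq> W} \<le> card {r \<in> Q. r \<subseteq> W} + card {r \<in> E. r \<subseteq> W}"
    by (simp add: card_Un_le)
  have fJ: "finite J" by (simp add: J_def)
  \<comment> \<open>Several cycles may have the same base, so \<open>card J\<close> is only an upper
    bound for the number of points added.\<close>
  have "supp W \<subseteq> (W \<inter> H) \<union> base ` J"
    using base_H by (auto simp: supp_def J_def V_def)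
  then have "card (supp W) \<le> card ((W \<inter> H) \<union> base ` J)"
    by (rule card_mono[rotated]) (use finH fJ in auto)
  also have "\<dots> \<le> card (W \<inter> H) + card (base ` J)" by (rule card_Un_le)
  also have "\<dots> \<le> card (W \<inter> H) + card J" using card_image_le[OF fJ] by simp
  also have "card J = (\<Sum>i<m. if i \<in> J then 1 else 0)"
  proof -
    have "(\<Sum>i<m. if i \<in> J then 1 else 0) = card ({..<m} \<inter> J)" by (simp add: sum.If_cases Int_def)
    moreover have "{..<m} \<inter> J = J" by (auto simp: J_def)
    ultimately show ?thesis by simp
  qed
  finally have cS: "card (supp W) \<le> card (W \<inter> H) + (\<Sum>i<m. if i \<in> J then 1 else 0)" .
  have "(\<Sum>i<m. card (N i)) + (\<Sum>i<m. if i \<in> J then 1 else 0) \<le> (\<Sum>i<m. card (V i))"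
    unfolding sum.distrib[symmetric] by (rule sum_mono) (use NV in auto)
  then show ?thesis using cW cE cQ cS unfolding predim_def by linarith
qed

text \<open>A cycle over \<open>P\<close> closes up: with its base and all of \<open>X3\<close>
  present, every cycle point contributes an edge of its own, so the cycle costs nothing.\<close>

lemma predim_edges_full:
  assumes P: "X3 \<subseteq> P" "P \<subseteq> H" and Q: "Q \<inter> E = {}"
  shows "predim (Q \<union> E) (full P) \<le> int (card P) - int (card {r \<in> Q. r \<subseteq> full P})"
proof -
  define K where "K = {(i, k). i < m \<and> k < L i \<and> base i \<in> P}"
  have fK: "finite K"
    by (rule finite_subset[of _ "SIGMA i:{..<m}. {..<L i}"]) (auto simp: K_def)
  have fP: "finite P" using P finH finite_subset by blast
  have fu: "full P = P \<union> (\<lambda>(i, k). u i k) ` K" by (auto simp: full_def K_def)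
  have cf: "card (full P) \<le> card P + card K"
    unfolding fu using card_Un_le[of P "(\<lambda>(i, k). u i k) ` K"] card_image_le[OF fK, of "\<lambda>(i, k). u i k"]
    by linarith
  have ff: "finite (full P)" using fu fP fK by simp
  have "inj_on (\<lambda>(i, k). edge i k) K"
  proof (rule inj_onI, clarify)
    fix i k j l assume "(i, k) \<in> K" "(j, l) \<in> K" "edge i k = edge j l"
    then show "i = j \<and> k = l" using edge_eq[of i k j l] by (simp add: K_def)
  qed
  then have "card K = card ((\<lambda>(i, k). edge i k) ` K)" by (simp add: card_image)
  also have "\<dots> \<le> card {r \<in> E. r \<subseteq> full P}"
  proof (rule card_mono)
    show "finite {r \<in> E. r \<subseteq> full P}" using ff by (rule finite_rels_in)
    show "(\<lambda>(i, k). edge i k) ` K \<subseteq> {r \<in> E. r \<subseteq> full P}"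
    proof clarify
      fix i k assume ik: "(i, k) \<in> K"
      have "lab i k \<in> P"
      proof (cases "k = 0")
        case False
        then have "lab i k \<in> X3" using lab_X3[of i] ik by (auto simp: K_def)
        then show ?thesis using P by blast
      qed (use ik in \<open>simp add: lab0 K_def\<close>)
      then show "edge i k \<in> E \<and> edge i k \<subseteq> full P"
        using ik next_lt[of k i] by (auto simp: K_def E_def edge_def full_def)
    qed
  qed
  finally have "card K \<le> card {r \<in> E. r \<subseteq> full P}" .
  then show ?thesis using predim_Un[OF ff Q] cf by (simp add: predim_def)
qed

lemma tri_full: "r \<in> S \<Longrightarrow> P \<subseteq> H \<Longrightarrow> tri r \<subseteq> full P \<longleftrightarrow> r \<subseteq> P"
proof
  assume r: "r \<in> S" "P \<subseteq> H" "tri r \<subseteq> full P"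
  show "r \<subseteq> P"
  proof
    fix p assume "p \<in> r"
    then obtain i where i: "i < m" "base i = p" "host i = r" using tri_nonempty r by blast
    then have "u i 0 \<in> full P" using r by (auto simp: tri_def)
    then show "p \<in> P" using i r u_new by (auto simp: full_def)
  qed
next
  assume "r \<in> S" "P \<subseteq> H" "r \<subseteq> P"
  then show "tri r \<subseteq> full P" using incidence Lpos unfolding tri_def full_def by blast
qed

lemma count_T_full:
  assumes "P \<subseteq> H"
  shows "card {r \<in> T. r \<subseteq> full P} = card {r \<in> S. r \<subseteq> P}"
proof -
  have "{r \<in> T. r \<subseteq> full P} = tri ` {r \<in> S. r \<subseteq> P}"
    using tri_full assms by (auto simp: T_def)
  moreover have "inj_on tri {r \<in> S. r \<subseteq> P}" using tri_inj by (rule inj_on_subset) auto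
  ultimately show ?thesis by (simp add: card_image)
qed

lemma RA_H: "r \<in> RA \<Longrightarrow> r \<subseteq> H" using RA AH by blast

lemma RA_S_disjoint: "RA \<inter> S = {}" using RA S by blast

abbreviation "RC \<equiv> RA \<union> T \<union> E"

text \<open>A triangle inside \<open>W\<close> may come from a relation whose points are absent from
  \<open>W\<close>. They are put back by \<open>supp\<close>, at no cost by
  \<open>predim_edges_lower\<close>, and then \<open>r\<close> itself is counted in place of
  \<open>tri r\<close>.\<close>

lemma predim_replaced_lower:
  assumes W: "W \<subseteq> H \<union> U"
  shows "predim (RA \<union> S) (supp W) \<le> predim RC W"
proof -
  let ?P = "supp W"
  have fP: "finite ?P" using supp_sub finH finite_subset by blast
  have fW: "finite W" using W finH finU finite_subset by blast
  have "card {r \<in> RA \<union> T. r \<subseteq> W} \<le> card {r \<in> RA. r \<subseteq> W} + card {r \<in> T. r \<subseteq> W}"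
    using card_Un_le[of "{r \<in> RA. r \<subseteq> W}" "{r \<in> T. r \<subseteq> W}"] by (simp add: Collect_disj_eq[symmetric] conj_disj_distribR)
  moreover have "card {r \<in> RA. r \<subseteq> W} \<le> card {r \<in> RA. r \<subseteq> ?P}"
    by (rule card_mono[OF finite_rels_in[OF fP]]) (use RA_H in \<open>auto simp: supp_def\<close>)
  moreover have "card {r \<in> T. r \<subseteq> W} \<le> card {r \<in> S. r \<subseteq> ?P}"
  proof -
    have "{r \<in> T. r \<subseteq> W} \<subseteq> {r \<in> T. r \<subseteq> full ?P}" using subset_full_supp[OF W] by auto
    moreover have "finite {r \<in> T. r \<subseteq> full ?P}"
      by (rule finite_rels_in) (use full_sub[OF supp_sub, of W] finH finU finite_subset in blast)
    ultimately show ?thesis unfolding count_T_full[OF supp_sub, symmetric] by (intro card_mono)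
  qed
  moreover have "predim (RA \<union> S) ?P = predim RA ?P - int (card {r \<in> S. r \<subseteq> ?P})"
    by (rule predim_Un[OF fP RA_S_disjoint])
  ultimately show ?thesis using predim_edges_lower[OF W, of "RA \<union> T"] unfolding predim_def by linarith
qed

text \<open>The corresponding estimate when the relations on \<open>H\<close> are kept and only the
  cycles are added, as happens on the side of \<open>M\<close>.\<close>

lemma predim_cycles_lower:
  assumes W: "W \<subseteq> H \<union> U" and Q: "\<And>r. r \<in> Q \<Longrightarrow> r \<subseteq> H"
  shows "predim Q (supp W) \<le> predim (Q \<union> E) W"
proof -
  have fP: "finite (supp W)" using supp_sub finH finite_subset by blast
  have "card {r \<in> Q. r \<subseteq> W} \<le> card {r \<in> Q. r \<subseteq> supp W}"
    by (rule card_mono[OF finite_rels_in[OF fP]]) (use Q in \<open>auto simp: supp_def\<close>)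
  then show ?thesis using predim_edges_lower[OF W, of Q] unfolding predim_def by linarith
qed

lemma predim_replaced_full:
  assumes P: "X3 \<subseteq> P" "P \<subseteq> H"
  shows "predim RC (full P) \<le> predim (RA \<union> S) P"
proof -
  have fP: "finite P" "finite (full P)"
    using P full_sub[OF P(2)] finH finU finite_subset by blast+
  have "(RA \<union> T) \<inter> E = {}" using T_E_disjoint sub_H_E_disjoint[of RA] RA_H by blast
  note full = predim_edges_full[OF P this]
  have "predim (RA \<union> T) (full P) = predim RA (full P) - int (card {r \<in> T. r \<subseteq> full P})"
    by (rule predim_Un[OF fP(2) RA_T_disjoint])
  moreover have "{r \<in> RA. r \<subseteq> full P} = {r \<in> RA. r \<subseteq> P}"
    using RA_H full_H[OF P(2)] by blast
  moreover have "predim (RA \<union> S) P = predim RA P - int (card {r \<in> S. r \<subseteq> P})"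
    by (rule predim_Un[OF fP(1) RA_S_disjoint])
  ultimately show ?thesis using full count_T_full[OF P(2)] unfolding predim_def by simp
qed

lemma predim_cycles_full:
  assumes P: "X3 \<subseteq> P" "P \<subseteq> H" and Q: "\<And>r. r \<in> Q \<Longrightarrow> r \<subseteq> H"
  shows "predim (Q \<union> E) (full P) \<le> predim Q P"
proof -
  have "{r \<in> Q. r \<subseteq> full P} = {r \<in> Q. r \<subseteq> P}"
    using Q full_H[OF P(2)] by blast
  then show ?thesis
    using predim_edges_full[OF P sub_H_E_disjoint, of Q] Q unfolding predim_def by simp
qed


section \<open>Relations at cycle points\<close>

abbreviation "CS \<equiv> LStruct (H \<union> U) RC"

lemma CS_lstruct: "is_lstruct CS"
  unfolding is_lstruct_def
proof
  fix r assume "r \<in> rel CS"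
  then consider "r \<in> RA" | s where "s \<in> S" "r = tri s" | i k where "i < m" "k < L i" "r = edge i k"
    by (auto simp: T_def E_def)
  then show "r \<subseteq> pts CS \<and> card r = 3"
  proof cases
    case 1 then show ?thesis using RA AH by auto
  next
    case 2 then show ?thesis using tri_card tri_sub[of s] by auto
  next
    case 3 then show ?thesis using edge_card edge_sub by auto
  qed
qed

text \<open>The relations of \<open>S\<close> have disappeared from \<open>H\<close>: triangles and
  edges all use cycle points.\<close>

lemma RC_in_H:
  assumes "r \<in> RC" "r \<subseteq> H"
  shows "r \<in> RA"
proof -
  have "r \<notin> T"
  proof
    assume "r \<in> T"
    then obtain s where s: "s \<in> S" "r = tri s" by (auto simp: T_def)
    then have "r = {}" using assms(2) tri_sub[of s] HU by blast
    then show False using tri_card s by fastforce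
  qed
  moreover have "r \<notin> E" using assms(2) u_new by (auto simp: E_def edge_def)
  ultimately show ?thesis using assms(1) by blast
qed

definition prev :: "nat \<Rightarrow> nat \<Rightarrow> nat" where
  "prev i k = (if k = 0 then L i - 1 else k - 1)"

lemma next_prev: "k < L i \<Longrightarrow> l < L i \<Longrightarrow> k = Suc l mod L i \<longleftrightarrow> l = prev i k"
  using next_cases[of l i] by (auto simp: prev_def)

lemma rels_at_u:
  assumes "i < m" "k < L i"
  shows "{r \<in> RC. u i k \<in> r} \<subseteq>
    {edge i k, edge i (prev i k)} \<union> (if k = 0 then {tri (host i)} else {})"
proof
  fix r assume "r \<in> {r \<in> RC. u i k \<in> r}"
  then have r: "r \<in> RC" "u i k \<in> r" by auto
  then consider "r \<in> RA" | s where "s \<in> S" "r = tri s" | j l where "j < m" "l < L j" "r = edge j l"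
    by (auto simp: T_def E_def)
  then show "r \<in> {edge i k, edge i (prev i k)} \<union> (if k = 0 then {tri (host i)} else {})"
  proof cases
    case 1 then show ?thesis using r RA_H u_new by blast
  next
    case 2 then show ?thesis using r tri_mem by auto
  next
    case 3
    then have "i = j" "k = l \<or> k = Suc l mod L i" using r u_in_edge by auto
    then show ?thesis using 3 next_prev assms by auto
  qed
qed

text \<open>Two edges and at most one triangle. This is less than the number of copies, at least
  four, in a forbidden configuration with \<open>\<mu> Y Z \<ge> 3\<close>.\<close>

lemma degree_u_le: "i < m \<Longrightarrow> k < L i \<Longrightarrow> card {r \<in> RC. u i k \<in> r} \<le> 3"
proof -
  assume ik: "i < m" "k < L i"
  have "card {r \<in> RC. u i k \<in> r} \<le> card {edge i k, edge i (prev i k), tri (host i)}"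
    by (rule card_mono) (use rels_at_u[OF ik] in \<open>auto split: if_splits\<close>)
  also have "\<dots> \<le> 3" by (rule card_insert_le_m1) (auto simp: card_insert_if)
  finally show ?thesis .
qed

text \<open>A cycle point with positive index lies on its two edges only. So degree 2 inside
  \<open>W\<close> forces both edges into \<open>W\<close>, and with them the two neighbours and the
  label; this propagates along the cycle.\<close>

lemma cycle_in:
  assumes i: "i < m" and l: "l < L i" "u i l \<in> W"
    and deg: "\<And>k. k < L i \<Longrightarrow> u i k \<in> W \<Longrightarrow> 2 \<le> card {r \<in> RC. u i k \<in> r \<and> r \<subseteq> W}"
  shows "(\<forall>k<L i. u i k \<in> W) \<and> X3 \<subseteq> W"
proof -
  have both: "edge i k \<subseteq> W \<and> edge i (prev i k) \<subseteq> W" if k: "0 < k" "k < L i" "u i k \<in> W" for k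
  proof (rule ccontr)
    assume neg: "\<not> ?thesis"
    then obtain e where "{r \<in> RC. u i k \<in> r \<and> r \<subseteq> W} \<subseteq> {e}"
      using rels_at_u[OF i k(2)] k(1) by auto
    then have "card {r \<in> RC. u i k \<in> r \<and> r \<subseteq> W} \<le> card {e}" by (intro card_mono) auto
    then show False using deg[OF k(2,3)] by simp
  qed
  have one: "edge i 0 \<subseteq> W \<or> edge i (prev i 0) \<subseteq> W" if "u i 0 \<in> W"
  proof (rule ccontr)
    assume neg: "\<not> ?thesis"
    then have "{r \<in> RC. u i 0 \<in> r \<and> r \<subseteq> W} \<subseteq> {tri (host i)}"
      using rels_at_u[OF i Lpos] by auto
    then have "card {r \<in> RC. u i 0 \<in> r \<and> r \<subseteq> W} \<le> card {tri (host i)}" by (intro card_mono) auto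
    then show False using deg[OF Lpos that] by simp
  qed
  have up: "u i (Suc k) \<in> W" if "0 < k" "Suc k < L i" "u i k \<in> W" for k
    using both[of k] that by (auto simp: edge_def)
  have down: "u i (k - 1) \<in> W" if "0 < k" "k < L i" "u i k \<in> W" for k
    using both[of k] that by (auto simp: edge_def prev_def)
  \<comment> \<open>At \<open>u i 0\<close> the triangle may account for one of the two relations.
    At least one edge remains, and its other end has positive index; from there propagation runs up
    and down to the ends of the index range.\<close>
  obtain l' where l': "0 < l'" "l' < L i" "u i l' \<in> W"
  proof (cases "l = 0")
    case True
    then have "u i 1 \<in> W \<or> u i (L i - 1) \<in> W" using one l L3[of i] by (auto simp: edge_def prev_def)
    then show ?thesis using that[of 1] that[of "L i - 1"] L3[of i] by auto
  qed (use l that in blast)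
  have all: "u i k \<in> W" if "k < L i" for k
  proof (cases "l' \<le> k")
    case True
    then show ?thesis using that
    proof (induction k rule: dec_induct)
      case (step k) then show ?case using up[of k] l' by auto
    qed (rule l'(3))
  next
    case False
    then have "k \<le> l'" by simp
    then show ?thesis
    proof (induction rule: inc_induct)
      case (step n) then show ?case using down[of "Suc n"] l' by auto
    qed (rule l'(3))
  qed
  have "lab i k \<in> W" if "0 < k" "k < L i" for k
    using both[of k] all that by (auto simp: edge_def)
  then show ?thesis using all lab_X3[of i] by auto
qed

text \<open>Edges that are not consecutive share at most a label; consecutive ones share a cycle
  point and hence must not share the label. A triangle has at most one point on any cycle, and a
  relation inside \<open>A\<close> meets an edge at most in its label.\<close>

lemma linear_at_U:
  assumes r1: "r1 \<in> RC" "r1 \<inter> U \<noteq> {}" and r2: "r2 \<in> RC" and neq: "r1 \<noteq> r2"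
  shows "card (r1 \<inter> r2) \<le> 1"
proof -
  have te: "tri s \<inter> edge j l \<subseteq> {u j 0}" if "j < m" "l < L j" for s j l
  proof -
    have "u a 0 \<in> edge j l \<Longrightarrow> a = j" for a using u_in_edge[OF that] by blast
    then show ?thesis unfolding tri_def by auto
  qed
  have re: "r \<inter> edge j l \<subseteq> {lab j l}" if "r \<in> RA" for r j l
    using RA_H[OF that] u_new by (auto simp: edge_def)
  have rt: "r \<inter> tri s = {}" if "r \<in> RA" for r s
    using RA_H[OF that] tri_sub[of s] HU by blast
  have tt: "tri s \<inter> tri s' = {}" if "s \<noteq> s'" for s s'
    using that by (auto simp: tri_def)
  have ee1: "edge i k \<inter> edge i (Suc k mod L i) \<subseteq> {u i (Suc k mod L i)}"
    if ik: "i < m" "k < L i" for i k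
  proof -
    let ?l = "Suc k mod L i"
    have "?l < L i" by (rule next_lt)
    moreover have "k \<noteq> ?l" "Suc ?l mod L i \<noteq> k" "Suc ?l mod L i \<noteq> ?l"
      using next_neq[of k i] next_next[of k i ?l] next_neq[of ?l i] ik next_lt[of k i] by auto
    moreover have "lab i k \<noteq> u j l" "lab i ?l \<noteq> u j l" for j l
      using lab_new[OF ik, of j l] lab_new[OF ik(1) next_lt, of j l k] by metis+
    ultimately show ?thesis using lab_adj[OF ik(2)] unfolding edge_def by auto
  qed
  have ee: "\<exists>c. edge i k \<inter> edge j l \<subseteq> {c}"
    if ik: "i < m" "k < L i" and jl: "j < m" "l < L j" and ne: "edge i k \<noteq> edge j l" for i k j l
  proof (cases "i = j")
    case False
    then have "edge i k \<inter> edge j l \<subseteq> {lab i k}"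
      using lab_new[OF ik] lab_new[OF jl] by (auto simp: edge_def)
    then show ?thesis by blast
  next
    case True
    then have kl: "k \<noteq> l" using ne by auto
    consider "l = Suc k mod L i" | "k = Suc l mod L i" | "l \<noteq> Suc k mod L i" "k \<noteq> Suc l mod L i"
      by blast
    then show ?thesis
    proof cases
      case 1 then show ?thesis using ee1[OF ik] True by blast
    next
      case 2 then show ?thesis using ee1[OF jl] True by (metis Int_commute)
    next
      case 3
      have "Suc k mod L i \<noteq> Suc l mod L i"
        using kl next_cases[of k i] next_cases[of l i] ik jl True by (auto split: if_splits)
      then have "edge i k \<inter> edge j l \<subseteq> {lab i k}"
        using 3 True kl lab_new[OF ik] lab_new[OF jl] unfolding edge_def by auto
      then show ?thesis by blast
    qed
  qed
  have *: "\<exists>c. r1 \<inter> r2 \<subseteq> {c}"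
  proof -
    have "r1 \<notin> RA" using r1(2) RA_H HU by blast
    then consider s where "s \<in> S" "r1 = tri s" | i k where "i < m" "k < L i" "r1 = edge i k"
      using r1(1) by (auto simp: T_def E_def)
    note c1 = this
    consider "r2 \<in> RA" | s where "s \<in> S" "r2 = tri s" | i k where "i < m" "k < L i" "r2 = edge i k"
      using r2 by (auto simp: T_def E_def)
    then show ?thesis
    proof cases
      case 1
      from c1 show ?thesis using re[OF 1] rt[OF 1] by cases (auto simp: Int_commute)
    next
      case (2 s')
      from c1 show ?thesis
      proof cases
        case (1 s)
        then show ?thesis using tt[of s s'] 2 neq by auto
      next
        case (2 i k)
        then show ?thesis using te[OF 2(1,2), of s'] \<open>r2 = tri s'\<close> by (metis Int_commute)
      qed
    next
      case (3 j l)
      from c1 show ?thesis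
      proof cases
        case (1 s)
        then show ?thesis using te[OF 3(1,2), of s] 3 by blast
      next
        case (2 i k)
        then show ?thesis using ee[OF 2(1,2) 3(1,2)] 3 neq by blast
      qed
    qed
  qed
  then obtain c where "r1 \<inter> r2 \<subseteq> {c}" by blast
  then have "card (r1 \<inter> r2) \<le> card {c}" by (intro card_mono) auto
  then show ?thesis by simp
qed

section \<open>The enlarged structure belongs to the class\<close>

lemma finite_CS: "finite (H \<union> U)" using finH finU by simp

lemma predim_RC_H: "W \<subseteq> H \<Longrightarrow> predim RC W = predim RA W"
  by (rule predim_cong) (use RC_in_H in blast)

text \<open>A superset of \<open>A\<close> keeps \<open>A\<close> in its support, so its
  predimension is bounded below by that of a superset of \<open>A\<close> before the
  replacement.\<close>

lemma selfsuff_CS: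
  assumes "selfsuff A (LStruct H (RA \<union> S))"
  shows "selfsuff A CS"
proof -
  have f: "finite (pts CS)" using finite_CS by simp
  have f2: "finite (pts (LStruct H (RA \<union> S)))" using finH by simp
  show ?thesis
    unfolding selfsuff_finite_iff[OF f]
  proof (intro conjI allI impI)
    show "A \<subseteq> pts CS" using AH by auto
    fix W assume W: "A \<subseteq> W \<and> W \<subseteq> pts CS"
    have "A \<subseteq> supp W" using W AH by (auto simp: supp_def)
    then have "predim (RA \<union> S) A \<le> predim (RA \<union> S) (supp W)"
      using assms[unfolded selfsuff_finite_iff[OF f2]] supp_sub by (simp add: delta_predim)
    also have "\<dots> \<le> predim RC W" by (rule predim_replaced_lower) (use W in simp)
    also have "predim (RA \<union> S) A = predim RC A"
      unfolding predim_RC_H[OF AH] by (rule predim_cong) (use S in blast)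
    finally show "delta CS A \<le> delta CS W" by (simp add: delta_predim)
  qed
qed

text \<open>Cycle points of degree at most 1 in \<open>W\<close> can be removed without raising the
  predimension. When none is left, either \<open>W\<close> lies in \<open>H\<close>, where all
  relations are inside \<open>A\<close>, or \<open>W\<close> contains a whole cycle and with it
  \<open>X3\<close>. In the latter case \<open>W \<inter> A\<close> has predimension at least 3, and
  self-sufficiency of \<open>A\<close> carries this over to \<open>W\<close>.\<close>

lemma CS_K0:
  assumes ss: "selfsuff A (LStruct H (RA \<union> S))" and K: "LStruct A RA \<in> K0"
    and X3': "card X3 = 3" "X3 \<notin> RA"
  shows "CS \<in> K0"
proof -
  have lA: "is_lstruct (LStruct A RA)" using K by (simp add: K0_iff)
  have "3 \<le> predim RC W" if "W \<subseteq> H \<union> U" "4 \<le> card W" for W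
    using that
  proof (induction W rule: measure_induct_rule[of card])
    case (less W)
    have fW: "finite W" using less.prems(1) finite_CS finite_subset by blast
    show ?case
    proof (cases "\<exists>v\<in>W \<inter> U. card {r \<in> RC. v \<in> r \<and> r \<subseteq> W} \<le> 1")
      case True
      then obtain v where v: "v \<in> W" "v \<in> U" "card {r \<in> RC. v \<in> r \<and> r \<subseteq> W} \<le> 1" by blast
      let ?W = "W - {v}"
      have ins: "insert v ?W = W" using v by auto
      have cW: "card W = Suc (card ?W)" using v fW by (metis card_Suc_Diff1)
      have d: "predim RC W = predim RC ?W + 1 - int (card {r \<in> RC. v \<in> r \<and> r \<subseteq> W})"
        using predim_insert[of ?W v RC] fW ins by simp
      show ?thesis
      proof (cases "4 \<le> card ?W")
        case True
        then have "3 \<le> predim RC ?W" using less.IH[of ?W] cW less.prems by auto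
        then show ?thesis using d v(3) by linarith
      next
        case False
        then have c3: "card ?W = 3" using less.prems cW by simp
        note d3 = delta_card_3[OF CS_lstruct c3, unfolded delta_predim lstruct.sel]
        show ?thesis
        proof (cases "?W \<in> RC")
          case True
          \<comment> \<open>The three remaining points form a relation, so their predimension is
            only 2. A relation joining \<open>v\<close> to them would share two points with it;
            hence there is none, and adding \<open>v\<close> gives 3.\<close>
          have "r \<notin> {r \<in> RC. v \<in> r \<and> r \<subseteq> W}" for r
          proof
            assume r: "r \<in> {r \<in> RC. v \<in> r \<and> r \<subseteq> W}"
            then have "card (r \<inter> ?W) \<le> 1"
              using linear_at_U[of r ?W] True v by blast
            moreover have "r \<inter> ?W = r - {v}" using r by auto
            moreover have "card r = 3" using r CS_lstruct by (simp add: is_lstruct_def)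
            ultimately show False using r by (simp add: card_Diff_singleton)
          qed
          then have "{r \<in> RC. v \<in> r \<and> r \<subseteq> W} = {}" by blast
          then have "card {r \<in> RC. v \<in> r \<and> r \<subseteq> W} = 0" by (simp only: card.empty)
          then show ?thesis using d d3[unfolded if_P[OF True]] by linarith
        next
          case False
          then show ?thesis using d d3[unfolded if_not_P[OF False]] v(3) by linarith
        qed
      qed
    next
      case False
      then have deg: "\<And>v. v \<in> W \<Longrightarrow> v \<in> U \<Longrightarrow> 2 \<le> card {r \<in> RC. v \<in> r \<and> r \<subseteq> W}" by force
      have fWA: "finite (W \<inter> A)" using fW by simp
      show ?thesis
      proof (cases "W \<inter> U = {}")
        case True
        then have WH: "W \<subseteq> H" using less.prems by blast
        have "{r \<in> RA. r \<subseteq> W} = {r \<in> RA. r \<subseteq> W \<inter> A}" using RA by blast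
        moreover have "card W = card (W \<inter> A) + card (W - A)"
          using fW by (metis card_Int_Diff)
        ultimately have "predim RC W = predim RA (W \<inter> A) + int (card (W - A))"
          unfolding predim_RC_H[OF WH] by (simp add: predim_def)
        moreover have "int (min (card (W \<inter> A)) 2) \<le> predim RA (W \<inter> A)"
          using K0_low[OF K, of "W \<inter> A"] by (simp add: delta_predim)
        moreover have "4 \<le> card (W \<inter> A) \<longrightarrow> 3 \<le> predim RA (W \<inter> A)"
          using K by (simp add: K0_iff delta_predim)
        ultimately show ?thesis using less.prems(2) \<open>card W = card (W \<inter> A) + card (W - A)\<close>
          by linarith
      next
        case False
        then obtain i l where il: "i < m" "l < L i" "u i l \<in> W" by (auto simp: U_def)
        have "X3 \<subseteq> W"
          using cycle_in[OF il] deg il(1) by (auto simp: U_def)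
        then have XW: "X3 \<subseteq> W \<inter> A" using X3 by blast
        have "3 \<le> predim RA (W \<inter> A)"
        proof (cases "W \<inter> A = X3")
          case True
          then show ?thesis using delta_card_3[OF lA X3'(1)] X3'(2) by (simp add: delta_predim)
        next
          case False
          then have "card X3 < card (W \<inter> A)" using XW fWA psubset_card_mono by blast
          then show ?thesis using K X3' by (simp add: K0_iff delta_predim)
        qed
        also have "predim RA (W \<inter> A) = predim RC (W \<inter> A)" by (rule predim_RC_H[symmetric]) (use AH in blast)
        also have "\<dots> \<le> predim RC W"
          using selfsuff_CS[OF ss] less.prems fW by (auto simp: selfsuff_def delta_predim)
        finally show ?thesis .
      qed
    qed
  qed
  then show ?thesis using CS_lstruct finite_CS by (simp add: K0_iff delta_predim)
qed

text \<open>For a base of predimension at most 2, two copies already contradict linearity, and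
  \<open>line\<close> guarantees that a forbidden configuration has two. Otherwise there are at
  least four copies; they are driven out of the cycles and then into \<open>A\<close>, where
  \<open>K\<close> excludes them.\<close>

lemma CS_Kmu:
  assumes ss: "selfsuff A (LStruct H (RA \<union> S))" and K: "LStruct A RA \<in> Kmu \<mu>"
    and X3': "card X3 = 3" "X3 \<notin> RA"
    and mu3: "\<And>Y Z. msa Y Z \<Longrightarrow> Z \<in> K0 \<Longrightarrow> 3 \<le> delta Z Y \<Longrightarrow> 3 \<le> \<mu> Y Z"
    and line: "(B :: 'b lstruct) \<in> Kmu \<mu>" "r0 \<in> rel B"
  shows "CS \<in> Kmu \<mu>"
proof -
  have C: "CS \<in> K0" using CS_K0[OF ss _ X3'] K by (simp add: Kmu_def)
  have False if msa: "msa Y Z" and emb: "\<forall>i<\<mu> Y Z + 1. embedding (f i) Z CS"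
    and dis: "\<forall>i<\<mu> Y Z + 1. \<forall>j<\<mu> Y Z + 1. i \<noteq> j \<longrightarrow>
         (\<forall>y\<in>Y. f i y = f j y) \<and> f i ` (pts Z - Y) \<inter> f j ` (pts Z - Y) = {}" for Y Z f
  proof -
    note Z = msa_D[OF msa]
    have lZ: "is_lstruct Z" and fZ: "finite (pts Z)" using C0_D[OF Z(1)] by auto
    have relZ: "r \<subseteq> pts Z" if "r \<in> rel Z" for r using lZ that by (simp add: is_lstruct_def)
    define n where "n = \<mu> Y Z + 1"
    have n0: "0 < n" by (simp add: n_def)
    have inj: "inj_on (f i) (pts Z)" and im: "f i ` pts Z \<subseteq> H \<union> U"
      and rel: "\<And>r. r \<subseteq> pts Z \<Longrightarrow> f i ` r \<in> RC \<longleftrightarrow> r \<in> rel Z" if "i < n" for i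
      using emb that unfolding n_def by (auto simp: embedding_def)
    have same: "f i y = f j y" if "i < n" "j < n" "y \<in> Y" for i j y
      using dis that unfolding n_def by (cases "i = j") (simp, blast)
    have apart: "z \<in> Y \<and> z' = z" if "i < n" "j < n" "i \<noteq> j" "z \<in> pts Z" "z' \<in> pts Z" "f i z = f j z'"
      for i j z z'
    proof -
      have "z \<in> Y \<or> z' \<in> Y"
      proof (rule ccontr)
        assume "\<not> ?thesis"
        then have "f i z \<in> f i ` (pts Z - Y) \<inter> f j ` (pts Z - Y)" using that by blast
        then show False using dis that unfolding n_def by blast
      qed
      then have "z = z'"
      proof
        assume "z \<in> Y"
        then have "f j z = f j z'" using same[of i j z] that by simp
        then show ?thesis using inj[of j] that by (auto dest: inj_onD)
      next
        assume "z' \<in> Y"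
        then have "f i z = f i z'" using same[of i j z'] that by simp
        then show ?thesis using inj[of i] that by (auto dest: inj_onD)
      qed
      then show ?thesis using \<open>z \<in> Y \<or> z' \<in> Y\<close> by blast
    qed
    have ZK: "Z \<in> K0"
      by (rule K0_embedding[OF _ C relZ, of "f 0"]) (use emb in auto)
    show False
    proof (cases "delta Z Y \<le> 2")
      case True
      note low = msa_K0_low[OF msa ZK True]
      obtain z where z: "z \<in> pts Z" "z \<notin> Y" using Z(2) by blast
      have lB: "is_lstruct B" using line by (simp add: Kmu_def K0_iff)
      have r0: "card r0 = 3" "r0 \<subseteq> pts B" using lB line by (auto simp: is_lstruct_def)
      \<comment> \<open>Here \<open>Z\<close> is a single relation, so \<open>r0\<close> is a copy
        of it. With value 0, one copy would be forbidden in \<open>B\<close>.\<close>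
      have "\<mu> Y Z \<noteq> 0"
      proof
        assume mu0: "\<mu> Y Z = 0"
        have "finite r0" using r0 card.infinite by fastforce
        then obtain h where h: "bij_betw h (pts Z) r0"
          using finite_same_card_bij[OF fZ] low r0 by metis
        have "embedding h Z B"
          unfolding embedding_def
        proof (intro conjI allI impI)
          show "inj_on h (pts Z)" "h ` pts Z \<subseteq> pts B" using h r0 by (auto simp: bij_betw_def)
          fix s assume s: "s \<subseteq> pts Z"
          have hs: "card (h ` s) = card s"
            by (rule card_image) (use h s in \<open>auto simp: bij_betw_def intro: inj_on_subset\<close>)
          have full: "s = pts Z" if "card s = 3" using card_subset_eq[OF fZ s] that low by simp
          show "h ` s \<in> rel B \<longleftrightarrow> s \<in> rel Z"
          proof
            assume "h ` s \<in> rel B"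
            then have "card s = 3" using lB hs by (simp add: is_lstruct_def)
            then show "s \<in> rel Z" using full low by simp
          next
            assume "s \<in> rel Z"
            then have "s = pts Z" using full lZ by (simp add: is_lstruct_def)
            then show "h ` s \<in> rel B" using h line by (simp add: bij_betw_def)
          qed
        qed
        then show False
          using Cmu_copies[of B \<mu> Y Z "\<lambda>_. h"] line msa mu0 by (simp add: Kmu_def)
      qed
      then have n1: "1 < n" by (simp add: n_def)
      let ?r = "f 0 ` pts Z" and ?s = "f 1 ` pts Z"
      have rs: "?r \<in> RC" "?s \<in> RC" using rel[OF n0] rel[OF n1] low by auto
      have "f 0 z \<notin> ?s"
      proof
        assume "f 0 z \<in> ?s"
        then obtain z' where "z' \<in> pts Z" "f 0 z = f 1 z'" by blast
        then show False using apart[OF n0 n1, of z z'] z by simp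
      qed
      then have "?r \<noteq> ?s" using z by blast
      then have "card (?r \<inter> ?s) \<le> 1" using K0_linear[OF C] rs by simp
      moreover have "f 0 ` Y \<subseteq> ?r \<inter> ?s"
      proof
        fix v assume "v \<in> f 0 ` Y"
        then obtain y where "y \<in> Y" "v = f 0 y" by blast
        moreover from this have "v = f 1 y" using same[OF n0 n1] by simp
        ultimately show "v \<in> ?r \<inter> ?s" using Z(2) by blast
      qed
      then have "card (f 0 ` Y) \<le> card (?r \<inter> ?s)" using fZ by (intro card_mono) auto
      moreover have "card (f 0 ` Y) = 2"
        using low inj[OF n0] Z(2) card_image[of "f 0" Y] inj_on_subset by (metis psubset_imp_subset)
      ultimately show False by simp
    next
      case False
      then have d3: "3 \<le> delta Z Y" by simp
      then have n4: "4 \<le> n" using mu3[OF msa ZK] by (simp add: n_def)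
      \<comment> \<open>The point \<open>y\<close> lies on a relation \<open>r\<close> containing a
        new point. The copies send \<open>r\<close> to distinct relations through the common value
        of \<open>y\<close>: at least four, where a cycle point admits three.\<close>
      have baseU: "f i y \<notin> U" if y: "y \<in> Y" and i: "i < n" for i y
      proof
        assume "f i y \<in> U"
        then obtain a k where ak: "a < m" "k < L a" "f i y = u a k" by (auto simp: U_def)
        obtain r z where r: "r \<in> rel Z" "y \<in> r" "z \<in> r" "z \<in> pts Z - Y"
          using msa_base_point_related[OF msa y] by blast
        have "inj_on (\<lambda>j. f j ` r) {..<n}"
        proof (rule inj_onI, rule ccontr)
          fix j l assume jl: "j \<in> {..<n}" "l \<in> {..<n}" "f j ` r = f l ` r" "j \<noteq> l"
          then have "f j z \<in> f l ` r" using r by blast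
          then obtain w where "w \<in> r" "f j z = f l w" by blast
          then have "z \<in> Y" using apart[of j l z w] jl r relZ by blast
          then show False using r by blast
        qed
        then have "n = card ((\<lambda>j. f j ` r) ` {..<n})" by (simp add: card_image)
        also have "\<dots> \<le> card {r \<in> RC. u a k \<in> r}"
        proof (rule card_mono)
          show "finite {r \<in> RC. u a k \<in> r}"
            by (rule finite_subset[OF rels_at_u[OF ak(1,2)]]) simp
          show "(\<lambda>j. f j ` r) ` {..<n} \<subseteq> {r \<in> RC. u a k \<in> r}"
          proof
            fix s assume "s \<in> (\<lambda>j. f j ` r) ` {..<n}"
            then obtain j where j: "j < n" "s = f j ` r" by blast
            then have "s \<in> RC" using rel[of j r] r relZ by blast
            moreover have "u a k = f j y" using same[OF i j(1) y] ak by simp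
            ultimately show "s \<in> {r \<in> RC. u a k \<in> r}" using j r by blast
          qed
        qed
        also have "\<dots> \<le> 3" by (rule degree_u_le[OF ak(1,2)])
        finally show False using n4 by simp
      qed
      have deg: "2 \<le> card {r \<in> RC. v \<in> r \<and> r \<subseteq> f i ` pts Z}" if i: "i < n" and v: "v \<in> U" "v \<in> f i ` pts Z" for i v
      proof -
        obtain z where z: "z \<in> pts Z" "v = f i z" using v by blast
        then have "z \<in> pts Z - Y" using baseU[OF _ i] v by blast
        then have "2 \<le> card {r \<in> rel Z. z \<in> r}" by (rule msa_new_point_degree[OF msa d3])
        also have "\<dots> = card ((`) (f i) ` {r \<in> rel Z. z \<in> r})"
          by (rule card_image[symmetric], rule inj_on_subset[OF inj_on_image_Pow[OF inj[OF i]]])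
            (use relZ in auto)
        also have "\<dots> \<le> card {r \<in> RC. v \<in> r \<and> r \<subseteq> f i ` pts Z}"
        proof (rule card_mono)
          show "finite {r \<in> RC. v \<in> r \<and> r \<subseteq> f i ` pts Z}"
            by (rule finite_subset[of _ "Pow (f i ` pts Z)"]) (use fZ in auto)
          show "(`) (f i) ` {r \<in> rel Z. z \<in> r} \<subseteq> {r \<in> RC. v \<in> r \<and> r \<subseteq> f i ` pts Z}"
          proof
            fix s assume "s \<in> (`) (f i) ` {r \<in> rel Z. z \<in> r}"
            then obtain r where r: "r \<in> rel Z" "z \<in> r" "s = f i ` r" by blast
            then have "s \<in> RC" using rel[OF i, of r] relZ by blast
            then show "s \<in> {r \<in> RC. v \<in> r \<and> r \<subseteq> f i ` pts Z}"
              using r z relZ[OF r(1)] by blast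
          qed
        qed
        finally show ?thesis .
      qed
      define I where "I i = {a. a < m \<and> (\<exists>k<L a. u a k \<in> f i ` pts Z)}" for i
      have cyc: "u a k \<in> f i ` pts Z" if i: "i < n" and a: "a \<in> I i" and "k < L a" for i a k
      proof -
        obtain l where l: "a < m" "l < L a" "u a l \<in> f i ` pts Z" using a unfolding I_def by blast
        have "(\<forall>k<L a. u a k \<in> f i ` pts Z) \<and> X3 \<subseteq> f i ` pts Z"
        proof (rule cycle_in[OF l])
          fix k assume "k < L a" "u a k \<in> f i ` pts Z"
          then show "2 \<le> card {r \<in> RC. u a k \<in> r \<and> r \<subseteq> f i ` pts Z}"
            using deg[OF i] l(1) by (auto simp: U_def)
        qed
        then show ?thesis using that by blast
      qed
      \<comment> \<open>Here \<open>b\<close> is the last cycle met by the two copies. Copy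
        \<open>i\<close> contains all of it; copy \<open>j\<close> does not meet it, since a common
        point would lie in the base. So copy \<open>j\<close> lives on \<open>H\<close> and earlier
        cycles, which together have fewer points than cycle \<open>b\<close>, although both copies
        have the size of \<open>Z\<close>.\<close>
      have noI: False if ij: "i < n" "j < n" "i \<noteq> j" and b: "b \<in> I i" "\<And>c. c \<in> I j \<Longrightarrow> c \<le> b" for i j b
      proof -
        have bm: "b < m" using b by (simp add: I_def)
        have "b \<notin> I j"
        proof
          assume "b \<in> I j"
          then have "u b 0 \<in> f i ` pts Z" "u b 0 \<in> f j ` pts Z" using cyc ij b Lpos by auto
          then obtain z z' where z: "z \<in> pts Z" "u b 0 = f i z" "z' \<in> pts Z" "u b 0 = f j z'" by blast
          then have "z \<in> Y" using apart[OF ij, of z z'] by simp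
          moreover have "u b 0 \<in> U" using bm Lpos by (auto simp: U_def)
          ultimately show False using baseU[OF _ ij(1)] z by metis
        qed
        then have lt: "c < b" if "c \<in> I j" for c using b(2)[OF that] that by (metis le_neq_implies_less)
        have "u b ` {..<L b} \<subseteq> f i ` pts Z" using cyc[OF ij(1) b(1)] by blast
        then have "card (u b ` {..<L b}) \<le> card (f i ` pts Z)" using fZ by (intro card_mono) auto
        moreover have "card (u b ` {..<L b}) = L b" by (simp add: card_image inj_on_def)
        ultimately have 1: "L b \<le> card (pts Z)" using inj[OF ij(1)] by (simp add: card_image)
        have "f j ` pts Z \<subseteq> H \<union> (\<Union>c\<in>{..<b}. u c ` {..<L c})"
        proof
          fix v assume v: "v \<in> f j ` pts Z"
          show "v \<in> H \<union> (\<Union>c\<in>{..<b}. u c ` {..<L c})"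
          proof (cases "v \<in> H")
            case False
            then obtain c k where ck: "c < m" "k < L c" "v = u c k" using im[OF ij(2)] v by (auto simp: U_def)
            then have "c \<in> I j" using v by (auto simp: I_def)
            then show ?thesis using lt ck by blast
          qed simp
        qed
        then have "card (f j ` pts Z) \<le> card (H \<union> (\<Union>c\<in>{..<b}. u c ` {..<L c}))"
          by (rule card_mono[rotated]) (use finH in auto)
        also have "\<dots> \<le> card H + card (\<Union>c\<in>{..<b}. u c ` {..<L c})" by (rule card_Un_le)
        also have "card (\<Union>c\<in>{..<b}. u c ` {..<L c}) \<le> (\<Sum>c<b. card (u c ` {..<L c}))"
          by (rule card_UN_le) simp
        also have "(\<Sum>c<b. card (u c ` {..<L c})) = (\<Sum>c<b. L c)"
          by (simp add: card_image inj_on_def)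
        finally have "card (f j ` pts Z) \<le> card H + (\<Sum>c<b. L c)" by simp
        then have "card (pts Z) \<le> card H + (\<Sum>c<b. L c)" using inj[OF ij(2)] by (simp add: card_image)
        then show False using 1 L_fast[of b] by simp
      qed
      have fI: "finite (I i)" for i by (simp add: I_def)
      have Iempty: "I i = {}" if i: "i < n" for i
      proof (rule ccontr)
        assume ne: "I i \<noteq> {}"
        obtain j where j: "j < n" "j \<noteq> i" using n4 by (metis less_le_trans zero_less_numeral one_less_numeral_iff semiring_norm(76) zero_neq_one)
        let ?b = "Max (I i \<union> I j)"
        have "?b \<in> I i \<union> I j" using ne fI by (intro Max_in) auto
        moreover have "c \<le> ?b" if "c \<in> I i \<union> I j" for c using that fI by (intro Max_ge) auto
        ultimately show False using noI[OF i j(1), of ?b] noI[OF j(1) i, of ?b] j(2) by blast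
      qed
      have inH: "f i ` pts Z \<subseteq> H" if "i < n" for i
      proof
        fix v assume v: "v \<in> f i ` pts Z"
        show "v \<in> H"
        proof (rule ccontr)
          assume "v \<notin> H"
          then have "v \<in> U" using v im[OF that] by blast
          then obtain a k where "a < m" "k < L a" "v = u a k" by (auto simp: U_def)
          then have "a \<in> I i" using v unfolding I_def by blast
          then show False using Iempty[OF that] by blast
        qed
      qed
      \<comment> \<open>Every point of \<open>Z\<close> lies on a relation, and the relations inside
        \<open>H\<close> are those of \<open>RA\<close>.\<close>
      have inA: "f i z \<in> A" if i: "i < n" and z: "z \<in> pts Z" for i z
      proof -
        have "\<exists>r\<in>rel Z. z \<in> r"
        proof (cases "z \<in> Y")
          case True
          then show ?thesis using msa_base_point_related[OF msa] by blast
        next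
          case False
          then have "card {r \<in> rel Z. z \<in> r} \<noteq> 0" using msa_new_point_degree[OF msa d3, of z] z by simp
          then have "{r \<in> rel Z. z \<in> r} \<noteq> {}" by (metis card.empty)
          then show ?thesis by blast
        qed
        then obtain r where r: "r \<in> rel Z" "z \<in> r" by blast
        have "f i ` r \<in> RA"
          using RC_in_H[of "f i ` r"] rel[OF i, of r] r relZ[OF r(1)] inH[OF i] by blast
        then show ?thesis using RA r by blast
      qed
      have "embedding (f i) Z (LStruct A RA)" if i: "i < n" for i
        unfolding embedding_def
      proof (intro conjI allI impI)
        show "inj_on (f i) (pts Z)" using inj i by blast
        show "f i ` pts Z \<subseteq> pts (LStruct A RA)" using inA[OF i] by auto
        fix r assume r: "r \<subseteq> pts Z"
        have "f i ` r \<subseteq> H" using r inH[OF i] by blast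
        then have "f i ` r \<in> RA \<longleftrightarrow> f i ` r \<in> RC" using RC_in_H by blast
        then show "f i ` r \<in> rel (LStruct A RA) \<longleftrightarrow> r \<in> rel Z" unfolding lstruct.sel using rel[OF i r] by argo
      qed
      moreover have "LStruct A RA \<in> Cmu \<mu>" using K by (simp add: Kmu_def)
      ultimately show False using Cmu_copies[of "LStruct A RA" \<mu> Y Z f] msa dis unfolding n_def by blast
    qed
  qed
  then have "CS \<in> Cmu \<mu>" by (intro CmuI K0_subset_C0[OF C])
  then show ?thesis using C by (simp add: Kmu_def)
qed

end

section \<open>Matched extensions\<close>

text \<open>\<open>N\<close> and \<open>M\<close> are both read on one index set, so that comparing
  them means comparing two sets of relations on the same points.\<close>

definition pullback :: "('c \<Rightarrow> 'a) \<Rightarrow> 'c set \<Rightarrow> 'a lstruct \<Rightarrow> 'c set set" where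
  "pullback f C N = {r. r \<subseteq> C \<and> f ` r \<in> rel N}"

lemma pullback_embedding:
  assumes "inj_on f C" "f ` C \<subseteq> pts N"
  shows "embedding f (LStruct C (pullback f C N)) N"
  using assms by (auto simp: embedding_def pullback_def)

lemma embedding_pullback:
  assumes "embedding f (LStruct C R) N" "\<And>r. r \<in> R \<Longrightarrow> r \<subseteq> C"
  shows "pullback f C N = R"
  using assms by (auto simp: embedding_def pullback_def)

lemma pullback_delta:
  assumes "inj_on f C" "W \<subseteq> C" "f ` C \<subseteq> pts N"
  shows "predim (pullback f C N) W = delta N (f ` W)"
  using delta_embedding[OF pullback_embedding[OF assms(1,3)], of W] assms(2) by (simp add: delta_predim)

lemma pullback_card:
  assumes "is_lstruct N" "inj_on f C" "r \<in> pullback f C N"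
  shows "r \<subseteq> C \<and> card r = 3"
proof -
  have r: "r \<subseteq> C" "f ` r \<in> rel N" using assms(3) by (auto simp: pullback_def)
  then have "card (f ` r) = card r" using assms(2) card_image inj_on_subset by metis
  then show ?thesis using r assms(1) by (simp add: is_lstruct_def)
qed

lemma C0bar_D:
  assumes "N \<in> C0bar"
  shows "is_lstruct N" "\<And>W. W \<subseteq> pts N \<Longrightarrow> finite W \<Longrightarrow> 0 \<le> delta N W"
proof -
  show "is_lstruct N" using assms by (simp add: C0bar_def)
  show "0 \<le> delta N W" if "W \<subseteq> pts N" "finite W" for W
  proof -
    have "induced N W \<in> C0" using assms that by (simp add: C0bar_def)
    then show ?thesis using C0_D(3)[of "induced N W" W] delta_induced[of W W N] by simp
  qed
qed

lemma pullback_C0: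
  assumes "N \<in> C0bar" "finite C" "inj_on f C" "f ` C \<subseteq> pts N"
  shows "LStruct C (pullback f C N) \<in> C0"
proof -
  have "0 \<le> predim (pullback f C N) W" if W: "W \<subseteq> C" for W
  proof -
    have "f ` W \<subseteq> pts N" "finite (f ` W)" using W assms(2,4) finite_subset by blast+
    then show ?thesis using pullback_delta[OF assms(3) W assms(4)] C0bar_D(2)[OF assms(1)] by simp
  qed
  then show ?thesis
    using pullback_card[OF C0bar_D(1)[OF assms(1)] assms(3)] assms(2)
    by (auto simp: C0_def is_lstruct_def delta_predim)
qed

text \<open>Every \<open>W\<close> has at least the predimension of \<open>W \<inter> A\<close>.
  Structures built over a self-sufficient piece of \<open>M\<close> thus need no count of their
  own.\<close>

lemma C0_of_selfsuff:
  assumes "is_lstruct B" "finite (pts B)" "selfsuff A B" "induced B A \<in> C0"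
  shows "B \<in> C0"
proof -
  have "0 \<le> delta B W" if W: "W \<subseteq> pts B" for W
  proof -
    have "finite W" using W assms(2) by (rule finite_subset)
    then have "delta B (W \<inter> A) \<le> delta B W" using assms(3) W by (simp add: selfsuff_def)
    moreover have "0 \<le> delta B (W \<inter> A)"
      using C0_D(3)[OF assms(4), of "W \<inter> A"] delta_induced[of "W \<inter> A" A B] by simp
    ultimately show ?thesis by simp
  qed
  then show ?thesis using assms by (simp add: C0_def)
qed

text \<open>By submodularity, a superset of least predimension is self-sufficient.\<close>

lemma exists_hull:
  assumes "N \<in> C0bar" "finite F" "F \<subseteq> pts N"
  shows "\<exists>B. F \<subseteq> B \<and> finite B \<and> selfsuff B N"
proof -
  obtain B where B: "F \<subseteq> B" "B \<subseteq> pts N" "finite B" "dim N F = delta N B"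
    "\<And>B'. F \<subseteq> B' \<Longrightarrow> B' \<subseteq> pts N \<Longrightarrow> finite B' \<Longrightarrow> dim N F \<le> delta N B'"
    using dim_attained[OF assms] by metis
  have "delta N (C \<inter> B) \<le> delta N C" if C: "C \<subseteq> pts N" "finite C" for C
  proof -
    have "F \<subseteq> C \<union> B" "C \<union> B \<subseteq> pts N" "finite (C \<union> B)" using B(1-3) C by auto
    then have "delta N B \<le> delta N (C \<union> B)" using B(5)[of "C \<union> B"] B(4) by simp
    then show ?thesis using delta_submodular[OF B(3) C(2), of N] by simp
  qed
  then show ?thesis using B by (auto simp: selfsuff_def)
qed

lemma predim_split:
  assumes "finite W" "\<And>r. r \<in> R \<Longrightarrow> r \<subseteq> A" "\<And>r. r \<in> S \<Longrightarrow> \<not> r \<subseteq> A"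
  shows "predim (R \<union> S) W = predim R (W \<inter> A) + int (card (W - A)) - int (card {r \<in> S. r \<subseteq> W})"
proof -
  have "R \<inter> S = {}" using assms by blast
  moreover have "{r \<in> R. r \<subseteq> W} = {r \<in> R. r \<subseteq> W \<inter> A}" using assms(2) by blast
  moreover have "card W = card (W \<inter> A) + card (W - A)" using assms(1) by (metis card_Int_Diff)
  ultimately show ?thesis using predim_Un[OF assms(1), of R S] by (simp add: predim_def)
qed

text \<open>For \<open>A \<subseteq> W\<close> the difference between the predimensions of
  \<open>W\<close> and \<open>A\<close> involves only the points outside \<open>A\<close> and the
  relations in \<open>S\<close>. So the relations inside \<open>A\<close> can be exchanged for those
  of the other structure.\<close>

lemma selfsuff_swap:
  assumes "finite C" "A \<subseteq> C" "\<And>r. r \<in> R \<Longrightarrow> r \<subseteq> A" "\<And>r. r \<in> R' \<Longrightarrow> r \<subseteq> A"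
    "\<And>r. r \<in> S \<Longrightarrow> \<not> r \<subseteq> A" "selfsuff A (LStruct C (R \<union> S))"
  shows "selfsuff A (LStruct C (R' \<union> S))"
proof -
  have eq: "predim (Q \<union> S) W - predim (Q \<union> S) A = int (card (W - A)) - int (card {r \<in> S. r \<subseteq> W})"
    if "\<And>r. r \<in> Q \<Longrightarrow> r \<subseteq> A" "A \<subseteq> W" "W \<subseteq> C" for Q W
  proof -
    have fin: "finite W" "finite A" using that(3) assms(1,2) by (auto intro: finite_subset)
    have "card {r \<in> S. r \<subseteq> A} = 0" using assms(5) by (metis (no_types, lifting) card.empty empty_Collect_eq)
    then have "predim (Q \<union> S) A = predim Q A"
      using predim_split[OF fin(2), of Q A S] that(1) assms(5) by simp
    moreover have "W \<inter> A = A" using that by blast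
    ultimately show ?thesis using predim_split[OF fin(1), of Q A S] that(1) assms(5) by simp
  qed
  have f: "finite (pts (LStruct C Q))" for Q using assms(1) by simp
  show ?thesis
    unfolding selfsuff_finite_iff[OF f]
  proof (intro conjI allI impI)
    fix W assume W: "A \<subseteq> W \<and> W \<subseteq> pts (LStruct C (R' \<union> S))"
    then have "predim (R \<union> S) A \<le> predim (R \<union> S) W"
      using assms(6) by (simp add: selfsuff_finite_iff[OF f] delta_predim)
    then show "delta (LStruct C (R' \<union> S)) A \<le> delta (LStruct C (R' \<union> S)) W"
      using eq[of R W] eq[of R' W] assms(3,4) W by (simp add: delta_predim)
  qed (use assms(2) in simp)
qed

text \<open>Equivalently, the dimension of \<open>W\<close> over \<open>X\<close> computed from \<open>R1\<close>, where \<open>X\<close> has dimension 3,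
  is the dimension of \<open>W\<close> computed from \<open>R2\<close>.\<close>

definition matches :: "'c set \<Rightarrow> 'c set \<Rightarrow> 'c set set \<Rightarrow> 'c set set \<Rightarrow> bool" where
  "matches C X R1 R2 \<longleftrightarrow>
     (\<forall>W\<subseteq>C. X \<subseteq> W \<longrightarrow> (\<exists>W'. W \<subseteq> W' \<and> W' \<subseteq> C \<and> predim R2 W' + 3 \<le> predim R1 W)) \<and>
     (\<forall>W\<subseteq>C. \<exists>W'. W \<subseteq> W' \<and> X \<subseteq> W' \<and> W' \<subseteq> C \<and> predim R1 W' \<le> predim R2 W + 3)"

lemma matchesD1:
  "matches C X R1 R2 \<Longrightarrow> W \<subseteq> C \<Longrightarrow> X \<subseteq> W \<Longrightarrow> \<exists>W'. W \<subseteq> W' \<and> W' \<subseteq> C \<and> predim R2 W' + 3 \<le> predim R1 W"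
  unfolding matches_def by blast

lemma matchesD2:
  "matches C X R1 R2 \<Longrightarrow> W \<subseteq> C \<Longrightarrow> \<exists>W'. W \<subseteq> W' \<and> X \<subseteq> W' \<and> W' \<subseteq> C \<and> predim R1 W' \<le> predim R2 W + 3"
  unfolding matches_def by blast

text \<open>The part of \<open>W\<close> inside \<open>A\<close> is replaced by the set
  \<open>V\<close> that the matching of \<open>A\<close> provides, and the part outside is kept. The
  number of points outside \<open>A\<close> is unchanged and no relation of \<open>S\<close> is
  lost, so the predimension relative to the part in \<open>A\<close> does not grow.\<close>

lemma matches_extend:
  assumes "matches A X R1 R2" "finite C" "A \<subseteq> C" "X \<subseteq> A"
    "\<And>r. r \<in> R1 \<Longrightarrow> r \<subseteq> A" "\<And>r. r \<in> R2 \<Longrightarrow> r \<subseteq> A" "\<And>r. r \<in> S \<Longrightarrow> \<not> r \<subseteq> A"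
  shows "matches C X (R1 \<union> S) (R2 \<union> S)"
proof -
  have aux: "predim (R \<union> S) (V \<union> (W - A)) - predim R V \<le> predim (Q \<union> S) W - predim Q (W \<inter> A)"
    if "W \<subseteq> C" "W \<inter> A \<subseteq> V" "V \<subseteq> A" "\<And>r. r \<in> R \<Longrightarrow> r \<subseteq> A" "\<And>r. r \<in> Q \<Longrightarrow> r \<subseteq> A" for R Q V W
  proof -
    let ?W = "V \<union> (W - A)"
    have "W \<subseteq> C" "?W \<subseteq> C" using that assms(3) by auto
    then have fin: "finite W" "finite ?W" using assms(2) by (auto intro: finite_subset)
    have "card {r \<in> S. r \<subseteq> W} \<le> card {r \<in> S. r \<subseteq> ?W}"
      by (rule card_mono[OF finite_rels_in[OF fin(2)]]) (use that in auto)
    moreover have "?W \<inter> A = V" "?W - A = W - A" using that by auto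
    ultimately show ?thesis
      using predim_split[OF fin(1), of Q A S] predim_split[OF fin(2), of R A S] that assms(7) by simp
  qed
  have 1: "\<exists>W'. W \<subseteq> W' \<and> W' \<subseteq> C \<and> predim (R2 \<union> S) W' + 3 \<le> predim (R1 \<union> S) W" if W: "W \<subseteq> C" "X \<subseteq> W" for W
  proof -
    have WA: "W \<inter> A \<subseteq> A" "X \<subseteq> W \<inter> A" using W assms(4) by auto
    obtain V where V: "W \<inter> A \<subseteq> V" "V \<subseteq> A" "predim R2 V + 3 \<le> predim R1 (W \<inter> A)"
      using matchesD1[OF assms(1) WA] by blast
    have "predim (R2 \<union> S) (V \<union> (W - A)) + 3 \<le> predim (R1 \<union> S) W"
      using aux[OF W(1) V(1,2), of R2 R1] assms(5,6) V(3) by simp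
    moreover have "W \<subseteq> V \<union> (W - A)" "V \<union> (W - A) \<subseteq> C" using V W assms(3) by auto
    ultimately show ?thesis by blast
  qed
  have 2: "\<exists>W'. W \<subseteq> W' \<and> X \<subseteq> W' \<and> W' \<subseteq> C \<and> predim (R1 \<union> S) W' \<le> predim (R2 \<union> S) W + 3" if W: "W \<subseteq> C" for W
  proof -
    obtain V where V: "W \<inter> A \<subseteq> V" "X \<subseteq> V" "V \<subseteq> A" "predim R1 V \<le> predim R2 (W \<inter> A) + 3"
      using matchesD2[OF assms(1) Int_lower2[of W A]] by blast
    have "predim (R1 \<union> S) (V \<union> (W - A)) \<le> predim (R2 \<union> S) W + 3"
      using aux[OF W V(1,3), of R1 R2] assms(5,6) V(4) by simp
    moreover have "W \<subseteq> V \<union> (W - A)" "V \<union> (W - A) \<subseteq> C" "X \<subseteq> V \<union> (W - A)" using V W assms(3) by auto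
    ultimately show ?thesis by blast
  qed
  show ?thesis unfolding matches_def using 1 2 by blast
qed

text \<open>Only dimensions over \<open>X\<close> enter on the first side, so its relations can be
  changed as long as these are preserved. This is what allows \<open>S\<close> to be traded for
  triangles.\<close>

lemma matches_change:
  assumes "matches C X R R2"
    and "\<And>W. W \<subseteq> C \<Longrightarrow> X \<subseteq> W \<Longrightarrow> \<exists>W'. W \<subseteq> W' \<and> W' \<subseteq> C \<and> predim R W' \<le> predim R' W"
    and "\<And>W. W \<subseteq> C \<Longrightarrow> X \<subseteq> W \<Longrightarrow> \<exists>W'. W \<subseteq> W' \<and> W' \<subseteq> C \<and> predim R' W' \<le> predim R W"
  shows "matches C X R' R2"
proof -
  have "\<exists>W'. W \<subseteq> W' \<and> W' \<subseteq> C \<and> predim R2 W' + 3 \<le> predim R' W" if W: "W \<subseteq> C" "X \<subseteq> W" for W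
  proof -
    obtain V where V: "W \<subseteq> V" "V \<subseteq> C" "predim R V \<le> predim R' W" using assms(2)[OF W] by blast
    then obtain V' where "V \<subseteq> V'" "V' \<subseteq> C" "predim R2 V' + 3 \<le> predim R V"
      using matchesD1[OF assms(1) V(2)] W by blast
    then show ?thesis using V by (intro exI[of _ V']) auto
  qed
  moreover have "\<exists>W'. W \<subseteq> W' \<and> X \<subseteq> W' \<and> W' \<subseteq> C \<and> predim R' W' \<le> predim R2 W + 3" if W: "W \<subseteq> C" for W
  proof -
    obtain V where V: "W \<subseteq> V" "X \<subseteq> V" "V \<subseteq> C" "predim R V \<le> predim R2 W + 3"
      using matchesD2[OF assms(1) W] by blast
    obtain V' where "V \<subseteq> V'" "V' \<subseteq> C" "predim R' V' \<le> predim R V" using assms(3)[OF V(3,2)] by blast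
    then show ?thesis using V by (intro exI[of _ V']) auto
  qed
  ultimately show ?thesis unfolding matches_def by blast
qed

text \<open>The map \<open>f k \<mapsto> g k\<close> for \<open>k \<in> C\<close>; the index set consists of natural numbers because the classes
  in \<open>is_generic\<close> do.\<close>

definition partial_iso ::
  "'a lstruct \<Rightarrow> 'b lstruct \<Rightarrow> 'a set \<Rightarrow> nat set \<Rightarrow> (nat \<Rightarrow> 'a) \<Rightarrow> (nat \<Rightarrow> 'b) \<Rightarrow> bool" where
  "partial_iso N M X C f g \<longleftrightarrow> finite C \<and> inj_on f C \<and> inj_on g C \<and>
     selfsuff (f ` C) N \<and> selfsuff (g ` C) M \<and>
     (\<exists>X0\<subseteq>C. f ` X0 = X \<and> matches C X0 (pullback f C N) (pullback g C M))"

section \<open>Going forth\<close>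

lemma extend_enumeration:
  fixes C :: "nat set"
  assumes "finite C" "inj_on f C" "f ` C \<subseteq> B" "finite B"
  shows "\<exists>C' f'. C \<subseteq> C' \<and> finite C' \<and> (\<forall>k\<in>C. f' k = f k) \<and> inj_on f' C' \<and> f' ` C' = B"
proof -
  have "infinite (- C)" using assms(1) by (simp add: Compl_eq_Diff_UNIV)
  then obtain D where D: "finite D" "card D = card (B - f ` C)" "D \<subseteq> - C"
    by (meson infinite_arbitrarily_large)
  then obtain h where h: "bij_betw h D (B - f ` C)"
    using finite_same_card_bij[OF D(1)] assms(4) by blast
  define f' where "f' k = (if k \<in> C then f k else h k)" for k
  have "bij_betw f' C (f ` C)" using assms(2) by (simp add: f'_def bij_betw_def inj_on_def)
  moreover have "bij_betw f' D (B - f ` C)"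
    using h D(3) by (subst bij_betw_cong[of D f' h]) (auto simp: f'_def)
  ultimately have "bij_betw f' (C \<union> D) (f ` C \<union> (B - f ` C))"
    by (rule bij_betw_combine) blast
  moreover have "f ` C \<union> (B - f ` C) = B" using assms(3) by blast
  ultimately show ?thesis using assms(1) D(1)
    by (intro exI[of _ "C \<union> D"] exI[of _ f']) (auto simp: bij_betw_def f'_def)
qed

lemma selfsuff_pullback:
  assumes "selfsuff (f ` A) N" "A \<subseteq> C" "inj_on f C" "f ` C \<subseteq> pts N"
  shows "selfsuff A (LStruct C (pullback f C N))"
  unfolding selfsuff_def
proof (intro conjI allI impI)
  fix W assume W: "W \<subseteq> pts (LStruct C (pullback f C N))" "finite W"
  have 1: "f ` W \<inter> f ` A = f ` (W \<inter> A)" using inj_on_image_Int[OF assms(3)] W assms(2) by simp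
  have "f ` W \<subseteq> pts N" "finite (f ` W)" using W assms(4) by auto
  then have "delta N (f ` W \<inter> f ` A) \<le> delta N (f ` W)" using assms(1) by (simp add: selfsuff_def)
  moreover have "W \<subseteq> C" "W \<inter> A \<subseteq> C" using W by auto
  ultimately show "delta (LStruct C (pullback f C N)) (W \<inter> A) \<le> delta (LStruct C (pullback f C N)) W"
    using pullback_delta[OF assms(3) _ assms(4)] 1 by (simp add: delta_predim)
qed (use assms(2) in simp)

lemma pullback_cong: "(\<And>k. k \<in> C \<Longrightarrow> f k = g k) \<Longrightarrow> pullback f C N = pullback g C N"
  unfolding pullback_def by (metis (mono_tags, opaque_lifting) image_cong subsetD)

lemma pullback_decompose:
  assumes "A \<subseteq> C" "\<And>k. k \<in> A \<Longrightarrow> f' k = f k"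
  shows "pullback f' C N = pullback f A N \<union> {r \<in> pullback f' C N. \<not> r \<subseteq> A}"
proof -
  have "pullback f A N = pullback f' A N" using assms(2) by (intro pullback_cong) simp
  then show ?thesis using assms(1) by (auto simp: pullback_def)
qed

lemma generic_extend:
  assumes "is_generic \<A> M" "B \<in> \<A>" "selfsuff A B" "embedding e (induced B A) M" "selfsuff (e ` A) M"
  obtains f where "embedding f B M" "\<And>a. a \<in> A \<Longrightarrow> f a = e a" "selfsuff (f ` pts B) M"
proof -
  have "\<forall>B\<in>\<A>. \<forall>A e. selfsuff A B \<and> embedding e (induced B A) M \<and> selfsuff (e ` A) M \<longrightarrow>
        (\<exists>f. embedding f B M \<and> (\<forall>a\<in>A. f a = e a) \<and> selfsuff (f ` pts B) M)"
    using assms(1) by (simp add: is_generic_def)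
  then obtain f where "embedding f B M" "\<forall>a\<in>A. f a = e a" "selfsuff (f ` pts B) M"
    using assms(2-5) by meson
  then show ?thesis using that by simp
qed

lemma partial_iso_forth:
  assumes N: "N \<in> C0bar" and M: "is_generic C0 M" and p: "partial_iso N M X A f g" and b: "b \<in> pts N"
  shows "\<exists>C f' g'. partial_iso N M X C f' g' \<and> A \<subseteq> C \<and> (\<forall>k\<in>A. f' k = f k \<and> g' k = g k) \<and> b \<in> f' ` C"
proof -
  have MC: "M \<in> C0bar" using M by (simp add: is_generic_def)
  obtain X0 where A: "finite A" "inj_on f A" "inj_on g A" "selfsuff (f ` A) N" "selfsuff (g ` A) M"
    and X0: "X0 \<subseteq> A" "f ` X0 = X" "matches A X0 (pullback f A N) (pullback g A M)"
    using p unfolding partial_iso_def by blast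
  have fA: "f ` A \<subseteq> pts N" "g ` A \<subseteq> pts M" using A by (auto simp: selfsuff_def)
  obtain B where B: "insert b (f ` A) \<subseteq> B" "finite B" "selfsuff B N"
    using exists_hull[OF N, of "insert b (f ` A)"] b fA A(1) by auto
  obtain C f' where C: "A \<subseteq> C" "finite C" "\<forall>k\<in>A. f' k = f k" "inj_on f' C" "f' ` C = B"
    using extend_enumeration[OF A(1,2), of B] B by auto
  have BN: "f' ` C \<subseteq> pts N" using B C by (simp add: selfsuff_def)
  define S where "S = {r \<in> pullback f' C N. \<not> r \<subseteq> A}"
  let ?R1 = "pullback f A N" and ?R2 = "pullback g A M"
  have dec: "pullback f' C N = ?R1 \<union> S" unfolding S_def using pullback_decompose[of A C f' f N] C by blast
  have R1: "\<And>r. r \<in> ?R1 \<Longrightarrow> r \<subseteq> A" and R2: "\<And>r. r \<in> ?R2 \<Longrightarrow> r \<subseteq> A" by (auto simp: pullback_def)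
  have SA: "\<And>r. r \<in> S \<Longrightarrow> \<not> r \<subseteq> A" by (simp add: S_def)
  \<comment> \<open>Relations of \<open>M\<close> inside \<open>A\<close>, relations of
    \<open>N\<close> elsewhere.\<close>
  let ?B = "LStruct C (?R2 \<union> S)"
  have "f' ` A = f ` A" using C(3) by simp
  then have "selfsuff A (LStruct C (?R1 \<union> S))"
    using selfsuff_pullback[of f' A N C] A(4) C BN dec by simp
  then have ss: "selfsuff A ?B" using selfsuff_swap[OF C(2,1) R1 R2 SA] by blast
  have R2C: "r \<subseteq> C \<and> card r = 3" if "r \<in> ?R2 \<union> S" for r
    using that pullback_card[OF C0bar_D(1)[OF MC] A(3), of r] pullback_card[OF C0bar_D(1)[OF N] C(4), of r] C(1)
    by (auto simp: S_def)
  have ind: "induced ?B A = LStruct A ?R2" using R2 SA by (auto simp: induced_def)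
  have "?B \<in> C0"
  proof (rule C0_of_selfsuff[OF _ _ ss])
    show "is_lstruct ?B" using R2C by (auto simp: is_lstruct_def)
    show "finite (pts ?B)" using C by simp
    show "induced ?B A \<in> C0" unfolding ind by (rule pullback_C0[OF MC A(1,3) fA(2)])
  qed
  moreover have "embedding g (induced ?B A) M" unfolding ind by (rule pullback_embedding[OF A(3) fA(2)])
  ultimately obtain g' where g': "embedding g' ?B M" "\<And>a. a \<in> A \<Longrightarrow> g' a = g a" "selfsuff (g' ` C) M"
    using generic_extend[OF M _ ss _ A(5)] by auto
  have "pullback g' C M = ?R2 \<union> S" by (rule embedding_pullback[OF g'(1)]) (use R2C in blast)
  then have "matches C X0 (pullback f' C N) (pullback g' C M)"
    using matches_extend[OF X0(3) C(2,1) X0(1) R1 R2 SA] dec by simp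
  moreover have "inj_on g' C" using g'(1) by (simp add: embedding_def)
  moreover have "f' ` X0 = X" using X0 C(3) by (metis image_cong subsetD)
  ultimately have "partial_iso N M X C f' g'"
    unfolding partial_iso_def using C X0(1) B(3) g'(3) by blast
  moreover have "b \<in> f' ` C" using C(5) B(1) by simp
  ultimately show ?thesis using C(1,3) g'(2) by (intro exI[of _ C] exI[of _ f'] exI[of _ g']) simp
qed

text \<open>The labels run periodically through \<open>y1\<close>, \<open>y2\<close>,
  \<open>y3\<close>, with \<open>p\<close> in place of \<open>y3\<close> at index 0. As the length
  is a multiple of 3, the neighbours of \<open>p\<close> on the cycle are \<open>y1\<close> and
  \<open>y2\<close>. With at least two periods, \<open>y3\<close> still occurs, at index 3.\<close>

lemma cycle_labelling:
  assumes "card X3 = 3" "2 \<le> q"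
  shows "\<exists>l. l 0 = p \<and> l ` {0<..<3 * q} = X3 \<and> (\<forall>k<3 * q. l k \<noteq> l (Suc k mod (3 * q)))"
proof -
  \<comment> \<open>At most one point of \<open>X3\<close> equals \<open>p\<close>; if there is one,
    it is called \<open>y3\<close>.\<close>
  obtain y1 y2 y3 where y: "X3 = {y1, y2, y3}" "y1 \<noteq> y2" "y1 \<noteq> y3" "y2 \<noteq> y3" "p \<noteq> y1" "p \<noteq> y2"
  proof -
    obtain a b c where abc: "X3 = {a, b, c}" "a \<noteq> b" "a \<noteq> c" "b \<noteq> c"
      using assms(1) by (auto simp: card_3_iff)
    consider "p \<noteq> a" "p \<noteq> b" | "p = a" | "p = b" by blast
    then show ?thesis
    proof cases
      case 1 then show ?thesis using that[of a b c] abc by blast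
    next
      case 2 then show ?thesis using that[of b c a] abc by auto
    next
      case 3 then show ?thesis using that[of a c b] abc by auto
    qed
  qed
  define l where "l k = (if k = 0 then p else if k mod 3 = 0 then y3 else if k mod 3 = 1 then y1 else y2)"
    for k :: nat
  have "l ` {0<..<3 * q} \<subseteq> X3" using y(1) by (auto simp: l_def)
  moreover have "X3 \<subseteq> l ` {0<..<3 * q}"
  proof -
    have "l 1 = y1" "l 2 = y2" "l 3 = y3" by (simp_all add: l_def)
    moreover have "{1, 2, 3} \<subseteq> {0<..<3 * q}" using assms(2) by auto
    ultimately show ?thesis using y(1) by auto
  qed
  moreover have "l k \<noteq> l (Suc k mod (3 * q))" if k: "k < 3 * q" for k
  proof (cases "Suc k = 3 * q")
    case True
    then have "k mod 3 = 2" "k \<noteq> 0" using assms(2) by presburger+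
    then show ?thesis using True y by (simp add: l_def)
  next
    case False
    then have "Suc k mod (3 * q) = Suc k" using k by simp
    then show ?thesis using y by (auto simp: l_def mod_Suc)
  qed
  moreover have "l 0 = p" by (simp add: l_def)
  ultimately show ?thesis by (intro exI[of _ l] conjI subset_antisym) blast+
qed

lemma sum_double: "(\<Sum>j<i. c * 2 ^ j) + c = c * 2 ^ (i :: nat)" for c :: nat
  by (induction i) auto

lemma cycle_gadget_exists:
  fixes H :: "nat set"
  assumes "finite H" "A \<subseteq> H" "\<And>r. r \<in> RA \<Longrightarrow> r \<subseteq> A \<and> card r = 3"
    "\<And>r. r \<in> S \<Longrightarrow> r \<subseteq> H \<and> card r = 3 \<and> \<not> r \<subseteq> A" "X3 \<subseteq> A" "card X3 = 3"
  shows "\<exists>m base host u L lab. cycle_gadget H A RA S X3 m base host u L lab"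
proof -
  let ?I = "{(p, r). r \<in> S \<and> p \<in> r}"
  have "?I \<subseteq> H \<times> Pow H" using assms(4) by auto
  then have "finite ?I" using assms(1) finite_subset by blast
  from ex_bij_betw_nat_finite[OF this]
  obtain h where h: "bij_betw h {0..<card ?I} ?I" by blast
  define m where "m = card ?I"
  have I: "bij_betw (\<lambda>i. (fst (h i), snd (h i))) {..<m} ?I"
    using h by (simp add: m_def lessThan_atLeast0)
  define b where "b = Suc (Max (insert 0 H))"
  have b: "k < b" if "k \<in> H" for k using that assms(1) by (simp add: b_def less_Suc_eq_le)
  \<comment> \<open>New points are numbers beyond \<open>H\<close>, because the classes live on
    natural numbers.\<close>
  define u where "u i k = b + prod_encode (i, k)" for i k
  \<comment> \<open>The factor 3 serves the labelling. The doubling makes \<open>L i\<close> exceed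
    the sum of all earlier lengths by exactly \<open>3 * Suc (card H)\<close>, hence by more than
    \<open>card H\<close>.\<close>
  define L where "L i = 3 * Suc (card H) * 2 ^ i" for i :: nat
  have cH: "3 \<le> card H" using card_mono[of H X3] assms by auto
  have "\<exists>l. l 0 = fst (h i) \<and> l ` {0<..<L i} = X3 \<and> (\<forall>k<L i. l k \<noteq> l (Suc k mod L i))" for i
  proof -
    have "2 * 1 \<le> Suc (card H) * 2 ^ i" by (rule mult_le_mono) (use cH in auto)
    then have "2 \<le> Suc (card H) * 2 ^ i" by simp
    from cycle_labelling[OF assms(6) this] show ?thesis unfolding L_def mult.assoc .
  qed
  then obtain lab where lab: "\<And>i. lab i 0 = fst (h i)" "\<And>i. lab i ` {0<..<L i} = X3"
    "\<And>i k. k < L i \<Longrightarrow> lab i k \<noteq> lab i (Suc k mod L i)"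
    by metis
  have "cycle_gadget H A RA S X3 m (\<lambda>i. fst (h i)) (\<lambda>i. snd (h i)) u L lab"
  proof
    show "inj (\<lambda>(i, k). u i k)" by (auto simp: inj_def u_def prod_encode_eq)
    show "u i k \<notin> H" for i k using b[of "u i k"] by (auto simp: u_def)
    have L: "(\<Sum>j<i. L j) + 3 * Suc (card H) = L i" for i unfolding L_def by (rule sum_double)
    show "3 \<le> L i" for i using L[of i] by simp
    show "card H + (\<Sum>j<i. L j) < L i" for i using L[of i] by simp
  qed (use assms I lab in auto)
  then show ?thesis by blast
qed

section \<open>Finite subsets of a generic structure\<close>

lemma selfsuff_chain_mono:
  assumes "\<forall>i. selfsuff (A i) (induced M (A (Suc i)))"
  shows "i \<le> j \<Longrightarrow> A i \<subseteq> A j"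
  by (rule lift_Suc_mono_le[of A]) (use assms in \<open>auto simp: selfsuff_def\<close>)

lemma generic_finite_embeds:
  assumes "is_generic \<A> N" "finite F" "F \<subseteq> pts N"
  shows "\<exists>B\<in>\<A>. \<exists>h. embedding h (induced N F) B"
proof -
  obtain A where A: "\<forall>i. \<exists>B\<in>\<A>. \<exists>g. isomorphism g B (induced N (A i))"
      "\<forall>i. selfsuff (A i) (induced N (A (Suc i)))" "(\<Union>i. A i) = pts N"
    using assms(1) unfolding is_generic_def by (elim conjE exE)
  have "\<exists>i. F \<subseteq> A i"
    using assms(2,3)
  proof (induction F rule: finite_induct)
    case (insert x F)
    then obtain i j where "F \<subseteq> A i" "x \<in> A j" using A(3) by blast
    then have "insert x F \<subseteq> A (max i j)"
      using selfsuff_chain_mono[OF A(2), of i "max i j"] selfsuff_chain_mono[OF A(2), of j "max i j"] by auto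
    then show ?case by blast
  qed simp
  then obtain i where i: "F \<subseteq> A i" by blast
  obtain B g where B: "B \<in> \<A>" "isomorphism g B (induced N (A i))" using A(1) by blast
  have "embedding (\<lambda>x. x) (induced N F) (induced N (A i))"
    using i by (auto simp: embedding_def)
  from embedding_comp[OF this embedding_inv[OF B(2)]] B(1) show ?thesis by blast
qed

lemma generic_pullback_Kmu:
  assumes "is_generic (Kmu \<mu>) N" "finite C" "inj_on f C" "f ` C \<subseteq> pts N"
  shows "LStruct C (pullback f C N) \<in> Kmu \<mu>"
proof -
  obtain B :: "nat lstruct" and h where B: "B \<in> Kmu \<mu>" "embedding h (induced N (f ` C)) B"
    using generic_finite_embeds[OF assms(1) finite_imageI[OF assms(2)] assms(4)] by blast
  have "embedding f (LStruct C (pullback f C N)) (induced N (f ` C))"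
    unfolding embedding_def pullback_def using assms(3) by simp blast
  from embedding_comp[OF this B(2)] B(1) show ?thesis
    by (rule Kmu_embedding) (auto simp: pullback_def)
qed

text \<open>Of two triples with two common points at most one is a relation, so four points suffice;
  three points of predimension 3 are no relation themselves. Applied to \<open>X\<close>, this
  provides the labels.\<close>

lemma K0_noncollinear:
  assumes "B \<in> K0" "W \<subseteq> pts B" "3 \<le> delta B W"
  shows "\<exists>T\<subseteq>W. card T = 3 \<and> T \<notin> rel B"
proof (rule ccontr)
  assume neg: "\<not> ?thesis"
  have l: "is_lstruct B" using assms(1) by (simp add: K0_iff)
  have "3 \<le> card W" using assms(3) predim_le_card[of "rel B" W] by (simp add: delta_predim)
  moreover have "card W \<noteq> 3"
    using neg delta_card_3[OF l, of W] assms(3) by (auto split: if_splits)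
  ultimately have "4 \<le> card W" by simp
  then obtain Q where Q: "Q \<subseteq> W" "card Q = Suc 3" using obtain_subset_with_card_n by (metis Suc_numeral semiring_norm(2) semiring_norm(8))
  then obtain a Q' where a: "Q = insert a Q'" "a \<notin> Q'" "card Q' = 3" by (metis card_Suc_eq)
  then obtain b c d where b: "Q' = {b, c, d}" "b \<noteq> c" "b \<noteq> d" "c \<noteq> d" by (auto simp: card_3_iff)
  have "{a, b, c} \<subseteq> W" "{a, b, d} \<subseteq> W" "card {a, b, c} = 3" "card {a, b, d} = 3" using Q a b by auto
  then have "{a, b, c} \<in> rel B" "{a, b, d} \<in> rel B" using neg by blast+
  moreover have "{a, b, c} \<noteq> {a, b, d}" using a b by auto
  ultimately have "card ({a, b, c} \<inter> {a, b, d}) \<le> 1" using K0_linear[OF assms(1)] by blast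
  moreover have "{a, b, c} \<inter> {a, b, d} = {a, b}" using a b by auto
  moreover have "card {a, b} = 2" using a b by auto
  ultimately show False by simp
qed

text \<open>Both sides are extended to the index set \<open>H \<union> U\<close>. On the
  \<open>N\<close> side triangles and cycles stand for \<open>S\<close>. On the \<open>M\<close>
  side \<open>H\<close> is already realised together with \<open>S\<close>, and only the cycles are
  added, so that the new points of \<open>N\<close> obtain partners.\<close>

lemma partial_iso_back:
  assumes mu3: "\<And>Y Z. msa Y Z \<Longrightarrow> Z \<in> K0 \<Longrightarrow> 3 \<le> delta Z Y \<Longrightarrow> 3 \<le> \<mu> Y Z"
    and N: "is_generic (Kmu \<mu>) N" and ne: "rel N \<noteq> {}"
    and M: "is_generic C0 M" and p: "partial_iso N M X A f g" and b: "b \<in> pts M"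
    and X: "3 \<le> delta N X"
  shows "\<exists>C f' g'. partial_iso N M X C f' g' \<and> A \<subseteq> C \<and> (\<forall>k\<in>A. f' k = f k \<and> g' k = g k) \<and> b \<in> g' ` C"
proof -
  have MC: "M \<in> C0bar" and NC: "N \<in> C0bar" using M N by (auto simp: is_generic_def)
  have lN: "is_lstruct N" and lM: "is_lstruct M" using MC NC C0bar_D(1) by blast+
  obtain X0 where A: "finite A" "inj_on f A" "inj_on g A" "selfsuff (f ` A) N" "selfsuff (g ` A) M"
    and X0: "X0 \<subseteq> A" "f ` X0 = X" "matches A X0 (pullback f A N) (pullback g A M)"
    using p unfolding partial_iso_def by blast
  have fA: "f ` A \<subseteq> pts N" "g ` A \<subseteq> pts M" using A by (auto simp: selfsuff_def)
  obtain B where B: "insert b (g ` A) \<subseteq> B" "finite B" "selfsuff B M"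
    using exists_hull[OF MC, of "insert b (g ` A)"] b fA A(1) by auto
  obtain H g' where H: "A \<subseteq> H" "finite H" "\<forall>k\<in>A. g' k = g k" "inj_on g' H" "g' ` H = B"
    using extend_enumeration[OF A(1,3), of B] B by auto
  have BM: "g' ` H \<subseteq> pts M" using B H by (simp add: selfsuff_def)
  define S where "S = {r \<in> pullback g' H M. \<not> r \<subseteq> A}"
  let ?R1 = "pullback f A N" and ?R2 = "pullback g A M"
  have dec: "pullback g' H M = ?R2 \<union> S" unfolding S_def using pullback_decompose[of A H g' g M] H by blast
  have R1: "r \<subseteq> A \<and> card r = 3" if "r \<in> ?R1" for r using pullback_card[OF lN A(2) that] .
  have R2: "r \<subseteq> A" if "r \<in> ?R2" for r using pullback_card[OF lM A(3) that] ..
  have S: "r \<subseteq> H \<and> card r = 3 \<and> \<not> r \<subseteq> A" if "r \<in> S" for r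
    using pullback_card[OF lM H(4), of r] that by (simp add: S_def)
  have "g' ` A = g ` A" using H(3) by simp
  then have "selfsuff A (LStruct H (?R2 \<union> S))"
    using selfsuff_pullback[of g' A M H] A(5) H BM dec by simp
  then have ss: "selfsuff A (LStruct H (?R1 \<union> S))"
    using selfsuff_swap[OF H(2,1), of ?R2 ?R1 S] R1 R2 S by blast
  have KA: "LStruct A ?R1 \<in> Kmu \<mu>" by (rule generic_pullback_Kmu[OF N A(1,2) fA(1)])
  then have K0A: "LStruct A ?R1 \<in> K0" by (simp add: Kmu_def)
  have "3 \<le> delta (LStruct A ?R1) X0"
    using pullback_delta[OF A(2) X0(1) fA(1)] X X0(2) by (simp add: delta_predim)
  \<comment> \<open>The labels are taken inside \<open>X\<close>, so every set over which relative
    dimensions are computed contains them.\<close>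
  then obtain X3 where x3: "X3 \<subseteq> X0" "card X3 = 3" "X3 \<notin> ?R1"
    using K0_noncollinear[OF K0A, of X0] X0(1) by auto
  obtain m base host u L lab where "cycle_gadget H A ?R1 S X3 m base host u L lab"
    using cycle_gadget_exists[OF H(2,1), of ?R1 S X3] R1 S x3 X0(1) by fast
  then interpret cycle_gadget H A ?R1 S X3 m base host u L lab .
  \<comment> \<open>This relation yields a member of the class with a relation, as
    \<open>CS_Kmu\<close> requires.\<close>
  obtain r0 where r0: "r0 \<in> rel N" using ne by blast
  have fr0: "finite r0" "r0 \<subseteq> pts N"
    using r0 lN card.infinite[of r0] unfolding is_lstruct_def by fastforce+
  obtain B0 :: "nat lstruct" and h0 where B0: "B0 \<in> Kmu \<mu>" "embedding h0 (induced N r0) B0"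
    using generic_finite_embeds[OF N fr0] by blast
  have "h0 ` r0 \<in> rel B0" using B0(2) r0 by (auto simp: embedding_def)
  then have CK: "CS \<in> Kmu \<mu>" using CS_Kmu[OF ss KA x3(2,3) _ B0(1)] mu3 by blast
  have ssC: "selfsuff A CS" by (rule selfsuff_CS[OF ss])
  have indC: "induced CS A = LStruct A ?R1"
    using RC_in_H AH R1 by (auto simp: induced_def)
  have "embedding f (induced CS A) N" unfolding indC by (rule pullback_embedding[OF A(2) fA(1)])
  then obtain f' where f': "embedding f' CS N" "\<And>a. a \<in> A \<Longrightarrow> f' a = f a" "selfsuff (f' ` pts CS) N"
    using generic_extend[OF N CK ssC _ A(4)] by blast
  let ?C = "H \<union> U"
  let ?D = "LStruct ?C (?R2 \<union> S \<union> E)"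
  have QH: "r \<subseteq> H" if "r \<in> ?R2 \<union> S" for r using that R2 S H(1) by blast
  have EC: "r \<subseteq> ?C \<and> card r = 3" if "r \<in> E" for r
    using that CS_lstruct by (auto simp: is_lstruct_def)
  have EH: "\<not> r \<subseteq> H" if "r \<in> E" for r using that u_new by (auto simp: E_def edge_def)
  have DC: "r \<subseteq> ?C \<and> card r = 3" if "r \<in> ?R2 \<union> S \<union> E" for r
  proof (cases "r \<in> E")
    case False
    then have "r \<in> pullback g' H M" using that dec by blast
    then show ?thesis using pullback_card[OF lM H(4)] by blast
  qed (rule EC)
  have fD: "finite (pts ?D)" using finite_CS by simp
  have ssD: "selfsuff H ?D"
    unfolding selfsuff_finite_iff[OF fD]
  proof (intro conjI allI impI)
    fix W assume W: "H \<subseteq> W \<and> W \<subseteq> pts ?D"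
    have "supp W = H" using W supp_sub[of W] by (auto simp: supp_def)
    moreover have "predim (?R2 \<union> S) (supp W) \<le> predim (?R2 \<union> S \<union> E) W"
      by (rule predim_cycles_lower) (use W QH in auto)
    moreover have "predim (?R2 \<union> S \<union> E) H = predim (?R2 \<union> S) H"
      by (rule predim_cong) (use EH in blast)
    ultimately show "delta ?D H \<le> delta ?D W" by (simp add: delta_predim)
  qed simp
  have indD: "induced ?D H = LStruct H (pullback g' H M)"
    unfolding dec induced_def using QH EH by auto
  have "?D \<in> C0"
  proof (rule C0_of_selfsuff[OF _ fD ssD])
    show "is_lstruct ?D" using DC by (simp add: is_lstruct_def)
    show "induced ?D H \<in> C0" unfolding indD by (rule pullback_C0[OF MC H(2,4) BM])
  qed
  moreover have "embedding g' (induced ?D H) M" unfolding indD by (rule pullback_embedding[OF H(4) BM])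
  moreover have "selfsuff (g' ` H) M" using H(5) B(3) by simp
  ultimately obtain g'' where g'': "embedding g'' ?D M" "\<And>a. a \<in> H \<Longrightarrow> g'' a = g' a" "selfsuff (g'' ` pts ?D) M"
    using generic_extend[OF M _ ssD] by blast
  \<comment> \<open>An intermediate comparison, with the same new relations
    \<open>S \<union> E\<close> on both sides.\<close>
  have "matches ?C X0 (?R1 \<union> (S \<union> E)) (?R2 \<union> (S \<union> E))"
  proof (rule matches_extend[OF X0(3) finite_CS _ X0(1)])
    show "\<not> r \<subseteq> A" if "r \<in> S \<union> E" for r using that S EH AH by blast
  qed (use R1 R2 AH in auto)
  then have "matches ?C X0 RC (?R2 \<union> (S \<union> E))"
  proof (rule matches_change)
    fix W assume W: "W \<subseteq> ?C" "X0 \<subseteq> W"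
    have P: "X3 \<subseteq> supp W" "supp W \<subseteq> H"
      using x3(1) W(2) X0(1) AH supp_sub by (auto simp: supp_def)
    have Q: "r \<subseteq> H" if "r \<in> ?R1 \<union> S" for r using that R1 S AH by blast
    \<comment> \<open>Both estimates descend to \<open>?R1 \<union> S\<close> on
      \<open>supp W\<close> and rise from there to \<open>full (supp W)\<close>, once with
      \<open>S\<close> and once with \<open>T\<close>.\<close>
    have "predim (?R1 \<union> S \<union> E) (full (supp W)) \<le> predim RC W"
      using order_trans[OF predim_cycles_full[OF P Q] predim_replaced_lower[OF W(1)]] by blast
    then show "\<exists>W'. W \<subseteq> W' \<and> W' \<subseteq> ?C \<and> predim (?R1 \<union> (S \<union> E)) W' \<le> predim RC W"
      using subset_full_supp[OF W(1)] full_sub[OF P(2)] by (auto simp: Un_assoc)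
    have "predim RC (full (supp W)) \<le> predim (?R1 \<union> S \<union> E) W"
      using order_trans[OF predim_replaced_full[OF P] predim_cycles_lower[OF W(1) Q]] by blast
    then show "\<exists>W'. W \<subseteq> W' \<and> W' \<subseteq> ?C \<and> predim RC W' \<le> predim (?R1 \<union> (S \<union> E)) W"
      using subset_full_supp[OF W(1)] full_sub[OF P(2)] by (auto simp: Un_assoc)
  qed
  moreover have "pullback f' ?C N = RC" by (rule embedding_pullback[OF f'(1)]) (use CS_lstruct in \<open>simp add: is_lstruct_def\<close>)
  moreover have "pullback g'' ?C M = ?R2 \<union> (S \<union> E)"
    unfolding Un_assoc[symmetric] by (rule embedding_pullback[OF g''(1)]) (use DC in blast)
  ultimately have "matches ?C X0 (pullback f' ?C N) (pullback g'' ?C M)" by simp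
  moreover have "inj_on f' ?C" "inj_on g'' ?C" using f'(1) g''(1) by (auto simp: embedding_def)
  moreover have "f' ` X0 = X" using X0 f'(2) by (metis image_cong subsetD)
  ultimately have "partial_iso N M X ?C f' g''"
    unfolding partial_iso_def using finite_CS X0(1) AH f'(3) g''(3) by auto
  moreover have "b \<in> g'' ` ?C"
  proof -
    have "b \<in> g' ` H" using H(5) B(1) by simp
    then obtain k where "k \<in> H" "b = g'' k" using g''(2) by auto
    then show ?thesis by blast
  qed
  moreover have "\<forall>k\<in>A. f' k = f k \<and> g'' k = g k" using f'(2) g''(2) H(1,3) by auto
  ultimately show ?thesis using H(1) by blast
qed

section \<open>Back and forth\<close>

lemma dim_le:
  assumes "B \<in> C0bar" "A \<subseteq> A'" "A' \<subseteq> pts B" "finite A'"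
  shows "dim B A \<le> delta B A'"
proof -
  have "finite A" "A \<subseteq> pts B" using assms finite_subset by blast+
  from dim_attained[OF assms(1) this] show ?thesis using assms(2-4) by metis
qed

lemma selfsuff_dim:
  assumes "B \<in> C0bar" "finite A" "selfsuff A B"
  shows "dim B A = delta B A"
proof -
  have A: "A \<subseteq> pts B" using assms(3) by (simp add: selfsuff_def)
  obtain A' where A': "A \<subseteq> A'" "A' \<subseteq> pts B" "finite A'" "dim B A = delta B A'"
    using dim_attained[OF assms(1,2) A] by metis
  have "delta B (A' \<inter> A) \<le> delta B A'" using assms(3) A' by (simp add: selfsuff_def)
  moreover have "A' \<inter> A = A" using A' by blast
  ultimately show ?thesis using A'(4) dim_le[OF assms(1) subset_refl A assms(2)] by simp
qed

lemma selfsuff_of_dim: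
  assumes "B \<in> C0bar" "A \<subseteq> A'" "A' \<subseteq> pts B" "finite A'" "delta B A' \<le> dim B A"
  shows "selfsuff A' B"
  unfolding selfsuff_def
proof (intro conjI allI impI assms(3))
  fix C assume C: "C \<subseteq> pts B" "finite C"
  have "dim B A \<le> delta B (C \<union> A')" by (rule dim_le[OF assms(1)]) (use assms C in auto)
  then show "delta B (C \<inter> A') \<le> delta B C"
    using delta_submodular[OF assms(4) C(2), of B] assms(5) by linarith
qed

section \<open>The initial matching\<close>

lemma generic_small_selfsuff:
  assumes "is_generic (Kmu \<mu>) N" "F \<subseteq> pts N" "finite F" "card F \<le> 3"
  shows "selfsuff F N"
  unfolding selfsuff_def
proof (intro conjI allI impI assms(2))
  fix C assume C: "C \<subseteq> pts N" "finite C"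
  let ?G = "C \<union> F"
  obtain B :: "nat lstruct" and h where B: "B \<in> Kmu \<mu>" "embedding h (induced N ?G) B"
    using generic_finite_embeds[OF assms(1), of ?G] C assms by auto
  have h: "inj_on h ?G" "h ` ?G \<subseteq> pts B" using B(2) by (auto simp: embedding_def)
  have d: "delta B (h ` W) = delta N W" if "W \<subseteq> ?G" for W
    using delta_embedding[OF B(2), of W] delta_induced[OF that, of N] that by simp
  have "card (h ` F) \<le> 3" using card_image_le[OF assms(3), of h] assms(4) by linarith
  moreover have "h ` F \<subseteq> pts B" "h ` C \<subseteq> pts B" using h(2) by auto
  ultimately have "selfsuff (h ` F) B" using B(1) by (simp add: Kmu_def K0_def)
  then have "delta B (h ` C \<inter> h ` F) \<le> delta B (h ` C)"
    using \<open>h ` C \<subseteq> pts B\<close> C(2) by (simp add: selfsuff_def)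
  moreover have "h ` C \<inter> h ` F = h ` (C \<inter> F)" using inj_on_image_Int[OF h(1)] by simp
  ultimately show "delta N (C \<inter> F) \<le> delta N C" using d[of C] d[of "C \<inter> F"] by (simp add: le_supI1)
qed

text \<open>Two points are self-sufficient both in \<open>N\<close> and in a single related triple,
  so genericity completes every pair to such a triple.\<close>

lemma generic_third_point:
  assumes N: "is_generic (Kmu \<mu>) N" "rel N \<noteq> {}" and xy: "x \<in> pts N" "y \<in> pts N" "x \<noteq> y"
  shows "\<exists>c. {x, y, c} \<in> rel N"
proof -
  have lN: "is_lstruct N" using N C0bar_D(1) by (auto simp: is_generic_def)
  obtain r0 where r0: "r0 \<in> rel N" using N by blast
  then have r3: "card r0 = 3" "r0 \<subseteq> pts N" using lN by (auto simp: is_lstruct_def)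
  then have fr: "finite r0" using card.infinite by fastforce
  let ?C = "{0..<3::nat}"
  obtain e where e: "bij_betw e ?C r0" using ex_bij_betw_nat_finite[OF fr] r3 by auto
  let ?B = "LStruct ?C (pullback e ?C N)"
  have eC: "inj_on e ?C" "e ` ?C \<subseteq> pts N" "e ` ?C = r0" using e r3 by (auto simp: bij_betw_def)
  have BK: "?B \<in> Kmu \<mu>" by (rule generic_pullback_Kmu[OF N(1) _ eC(1,2)]) simp
  have CB: "?C \<in> pullback e ?C N" using eC r0 by (simp add: pullback_def)
  have ss: "selfsuff {0, 1} ?B" using BK by (simp add: Kmu_def K0_def)
  define k where "k i = (if i = 0 then x else y)" for i :: nat
  have small: "r \<notin> rel A" if "is_lstruct A" "card r \<le> 2" for A :: "'c lstruct" and r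
    using that by (auto simp: is_lstruct_def)
  have "embedding k (induced ?B {0, 1}) N"
    unfolding embedding_def
  proof (intro conjI allI impI)
    show "inj_on k (pts (induced ?B {0, 1}))" using xy by (auto simp: k_def inj_on_def)
    show "k ` pts (induced ?B {0, 1}) \<subseteq> pts N" using xy by (auto simp: k_def)
    fix r assume "r \<subseteq> pts (induced ?B {0, 1})"
    then have r: "r \<subseteq> {0, 1}" by simp
    then have fin: "finite r" and c2: "card r \<le> 2"
      using finite_subset[of r "{0, 1}"] card_mono[of "{0, 1}" r] by auto
    have "card (k ` r) \<le> 2" using card_image_le[OF fin, of k] c2 by linarith
    then have "k ` r \<notin> rel N" by (rule small[OF lN])
    moreover have "r \<notin> rel ?B"
      by (rule small[OF _ c2]) (use BK in \<open>simp add: Kmu_def K0_iff\<close>)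
    ultimately show "k ` r \<in> rel N \<longleftrightarrow> r \<in> rel (induced ?B {0, 1})" by simp
  qed
  moreover have "selfsuff (k ` {0, 1}) N"
    by (rule generic_small_selfsuff[OF N(1)]) (use xy in \<open>auto simp: k_def\<close>)
  ultimately obtain f where f: "embedding f ?B N" "\<And>a. a \<in> {0, 1} \<Longrightarrow> f a = k a"
    using generic_extend[OF N(1) BK ss] by blast
  have "f ` ?C \<in> rel N" using f(1) CB by (simp add: embedding_def)
  moreover have "?C = {0, 1, 2}" by auto
  moreover have "f 0 = x" "f 1 = y" using f(2)[of 0] f(2)[of 1] by (auto simp: k_def)
  ultimately show ?thesis by auto
qed

text \<open>The set matched with \<open>X1\<close> in \<open>M\<close> is to have predimension 0,
  which is impossible for three points. If \<open>X\<close> has only three, a point related to two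
  of them is added; it stays in the closure of \<open>X\<close>.\<close>

lemma enlarge_base:
  assumes N: "is_generic (Kmu \<mu>) N" "rel N \<noteq> {}" and X: "finite X" "selfsuff X N" "dim N X = 3"
  shows "\<exists>X1. X \<subseteq> X1 \<and> finite X1 \<and> selfsuff X1 N \<and> delta N X1 = 3 \<and> 4 \<le> card X1"
proof (cases "4 \<le> card X")
  case True
  have "N \<in> C0bar" using N by (simp add: is_generic_def)
  then show ?thesis using True X selfsuff_dim[of N X] by auto
next
  case False
  have NC: "N \<in> C0bar" using N by (simp add: is_generic_def)
  note lN = C0bar_D(1)[OF NC]
  have dX: "delta N X = 3" using selfsuff_dim[OF NC X(1,2)] X(3) by simp
  then have c3: "card X = 3" using False predim_le_card[of "rel N" X] by (simp add: delta_predim)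
  then have nX: "X \<notin> rel N" using delta_card_3[OF lN c3] dX by (auto split: if_splits)
  obtain x y z where xyz: "X = {x, y, z}" "x \<noteq> y" "x \<noteq> z" "y \<noteq> z" using c3 by (auto simp: card_3_iff)
  have Xp: "X \<subseteq> pts N" using X(2) by (simp add: selfsuff_def)
  obtain c where c: "{x, y, c} \<in> rel N" using generic_third_point[OF N, of x y] Xp xyz by auto
  then have "card {x, y, c} = 3" and cN: "{x, y, c} \<subseteq> pts N" using lN by (auto simp: is_lstruct_def)
  then have cX: "c \<notin> X" using xyz c nX by (auto simp: card_insert_if split: if_splits)
  let ?X = "insert c X"
  have "{{x, y, c}} \<subseteq> {r \<in> rel N. c \<in> r \<and> r \<subseteq> ?X}" using c xyz by auto
  moreover have "finite {r \<in> rel N. c \<in> r \<and> r \<subseteq> ?X}"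
    by (rule finite_subset[of _ "Pow ?X"]) (use X(1) in auto)
  ultimately have "card {{x, y, c}} \<le> card {r \<in> rel N. c \<in> r \<and> r \<subseteq> ?X}" by (intro card_mono)
  then have "1 \<le> card {r \<in> rel N. c \<in> r \<and> r \<subseteq> ?X}" by simp
  then have le: "delta N ?X \<le> 3" using predim_insert[OF X(1) cX, of "rel N"] dX by (simp add: delta_predim)
  have Xp': "?X \<subseteq> pts N" using Xp cN by auto
  have "selfsuff ?X N" by (rule selfsuff_of_dim[OF NC, of X]) (use X le Xp' in auto)
  moreover have "3 \<le> delta N ?X" using dim_le[OF NC, of X ?X] X Xp' by auto
  ultimately show ?thesis using le X(1) c3 cX by (intro exI[of _ ?X]) auto
qed

text \<open>Four is the least positive number of points that have as many triples as points. The
  structure provides the image of the enlarged base in \<open>M\<close>, which has to consist of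
  loops.\<close>

lemma C0_delta_zero:
  assumes "4 \<le> n"
  shows "\<exists>B. B \<in> C0 \<and> pts B = {0..<n :: nat} \<and> delta B {0..<n} = 0"
proof -
  \<comment> \<open>Since \<open>k \<in> \<phi> k\<close>, a set has at least as many points as relations.\<close>
  define \<phi> where "\<phi> k = (if k = 0 then {0, 2, 3} else if k = 1 then {1, 2, 3} else {0, 1, k})"
    for k :: nat
  let ?R = "\<phi> ` {0..<n}"
  let ?B = "LStruct {0..<n} ?R"
  have self: "k \<in> \<phi> k" for k by (auto simp: \<phi>_def)
  have "r \<subseteq> {0..<n} \<and> card r = 3" if "r \<in> ?R" for r
    using that assms by (auto simp: \<phi>_def split: if_splits)
  then have l: "is_lstruct ?B" by (simp add: is_lstruct_def)
  have "0 \<le> delta ?B W" if W: "W \<subseteq> {0..<n}" for W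
  proof -
    have fW: "finite W" using W finite_subset by blast
    have "{r \<in> ?R. r \<subseteq> W} \<subseteq> \<phi> ` W" using self by blast
    then have "card {r \<in> ?R. r \<subseteq> W} \<le> card (\<phi> ` W)" using fW by (intro card_mono) auto
    also have "\<dots> \<le> card W" by (rule card_image_le[OF fW])
    finally show ?thesis by (simp add: delta_def)
  qed
  then have "?B \<in> C0" using l by (simp add: C0_def)
  moreover have "delta ?B {0..<n} = 0"
  proof -
    have "\<phi> j \<noteq> \<phi> k" if "j < k" for j k
    proof (cases "2 \<le> k")
      case True
      consider "j = 0" | "j = 1" | "2 \<le> j" by linarith
      then show ?thesis
      proof cases
        case 1 then have "1 \<in> \<phi> k" "1 \<notin> \<phi> j" using True by (auto simp: \<phi>_def)
        then show ?thesis by metis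
      next
        case 2 then have "0 \<in> \<phi> k" "0 \<notin> \<phi> j" using True by (auto simp: \<phi>_def)
        then show ?thesis by metis
      next
        case 3 then have "j \<in> \<phi> j" "j \<notin> \<phi> k" using True that by (auto simp: \<phi>_def)
        then show ?thesis by metis
      qed
    next
      case False
      then have "j = 0" "k = 1" using that by auto
      then have "0 \<in> \<phi> j" "0 \<notin> \<phi> k" by (auto simp: \<phi>_def)
      then show ?thesis by metis
    qed
    then have "inj_on \<phi> {0..<n}" by (intro linorder_inj_onI) auto
    then have "card ?R = n" by (simp add: card_image)
    moreover have "{r \<in> ?R. r \<subseteq> {0..<n}} = ?R" using l by (auto simp: is_lstruct_def)
    ultimately show ?thesis by (simp only: delta_def lstruct.sel) simp
  qed
  ultimately show ?thesis by (intro exI[of _ ?B]) simp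
qed

lemma partial_iso_initial:
  assumes N: "is_generic (Kmu \<mu>) N" "rel N \<noteq> {}" and M: "is_generic C0 M"
    and X: "finite X" "selfsuff X N" "dim N X = 3"
  shows "\<exists>C f g. partial_iso N M X C f g"
proof -
  have NC: "N \<in> C0bar" and MC: "M \<in> C0bar" using N M by (auto simp: is_generic_def)
  obtain X1 where X1: "X \<subseteq> X1" "finite X1" "selfsuff X1 N" "delta N X1 = 3" "4 \<le> card X1"
    using enlarge_base[OF N X] by blast
  let ?C = "{0..<card X1}"
  obtain f where f: "bij_betw f ?C X1" using ex_bij_betw_nat_finite[OF X1(2)] by blast
  obtain B where B: "B \<in> C0" "pts B = ?C" "delta B ?C = 0" using C0_delta_zero[OF X1(5)] by blast
  note BD = C0_D[OF B(1)]
  have nB: "{} \<notin> rel B" using BD(1) by (auto simp: is_lstruct_def)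
  have nM: "{} \<notin> rel M" using C0bar_D(1)[OF MC] by (auto simp: is_lstruct_def)
  have d0: "delta A {} = 0" if "{} \<notin> rel A" for A :: "'c lstruct"
  proof -
    have "{r \<in> rel A. r \<subseteq> {}} = {}" using that by auto
    then show ?thesis by (simp only: delta_def) simp
  qed
  have "selfsuff {} B" using BD(3) d0[OF nB] by (simp add: selfsuff_def)
  \<comment> \<open>The map is defined on the empty set, so its values do not matter.\<close>
  moreover have "embedding undefined (induced B {}) M" using nB nM by (simp add: embedding_def)
  moreover have "selfsuff (undefined ` {}) M"
    using C0bar_D(2)[OF MC] d0[OF nM] by (simp add: selfsuff_def)
  ultimately obtain g where g: "embedding g B M" "selfsuff (g ` pts B) M"
    using generic_extend[OF M B(1)] by metis
  have gC: "inj_on g ?C" "g ` ?C \<subseteq> pts M" using g(1) B(2) by (auto simp: embedding_def)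
  have fC: "inj_on f ?C" "f ` ?C = X1" using f by (auto simp: bij_betw_def)
  have fN: "f ` ?C \<subseteq> pts N" using fC X1(3) by (simp add: selfsuff_def)
  define X0 where "X0 = {k \<in> ?C. f k \<in> X}"
  have X0: "X0 \<subseteq> ?C" by (auto simp: X0_def)
  have fX0: "f ` X0 = X"
  proof (intro subset_antisym subsetI)
    fix x assume "x \<in> X"
    moreover from this obtain k where "k \<in> ?C" "x = f k" using fC(2) X1(1) by blast
    ultimately show "x \<in> f ` X0" unfolding X0_def by blast
  qed (auto simp: X0_def)
  have d2: "predim (pullback g ?C M) W = delta B W" if "W \<subseteq> ?C" for W
    using pullback_delta[OF gC(1) that gC(2)] delta_embedding[OF g(1)] that B(2) by simp
  \<comment> \<open>Both halves of the matching enlarge \<open>W\<close> to the whole index set: its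
    predimension is 3 in \<open>N\<close>, the least value over \<open>X\<close>, and 0 in
    \<open>M\<close>, the least value of all.\<close>
  have "predim (pullback g ?C M) ?C + 3 \<le> predim (pullback f ?C N) W" if W: "W \<subseteq> ?C" "X0 \<subseteq> W" for W
  proof -
    have "dim N X \<le> delta N (f ` W)"
    proof (rule dim_le[OF NC])
      show "X \<subseteq> f ` W" using fX0 W by blast
      show "f ` W \<subseteq> pts N" using fN W by blast
      show "finite (f ` W)" using W finite_subset by blast
    qed
    then show ?thesis using d2[of ?C] B(3) X(3) pullback_delta[OF fC(1) W(1) fN] by simp
  qed
  moreover have "predim (pullback f ?C N) ?C \<le> predim (pullback g ?C M) W + 3" if W: "W \<subseteq> ?C" for W
    using pullback_delta[OF fC(1) subset_refl fN] fC(2) X1(4) d2[OF W] BD(3)[of W] B(2) W by simp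
  ultimately have "matches ?C X0 (pullback f ?C N) (pullback g ?C M)"
    unfolding matches_def using X0 by blast
  then have "partial_iso N M X ?C f g"
    unfolding partial_iso_def using fC gC X0 fX0 g(2) B(2) X1(3) by auto
  then show ?thesis by blast
qed

section \<open>From dimensions to geometries\<close>

lemma partial_iso_dim:
  assumes N: "N \<in> C0bar" and M: "M \<in> C0bar" and p: "partial_iso N M X C f g" and Q: "Q \<subseteq> C"
  shows "dim N (X \<union> f ` Q) = dim M (g ` Q) + 3"
proof -
  obtain X0 where C: "finite C" "inj_on f C" "inj_on g C" "selfsuff (f ` C) N" "selfsuff (g ` C) M"
    and X0: "X0 \<subseteq> C" "f ` X0 = X" and m: "matches C X0 (pullback f C N) (pullback g C M)"
    using p unfolding partial_iso_def by blast
  have fC: "f ` C \<subseteq> pts N" "g ` C \<subseteq> pts M" using C by (auto simp: selfsuff_def)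
  have fin: "finite (X \<union> f ` Q)" "finite (g ` Q)"
    using X0 Q C(1) by (auto intro: finite_subset[of _ C])
  have sub: "X \<union> f ` Q \<subseteq> f ` C" "g ` Q \<subseteq> g ` C" using X0 Q by auto
  have "dim M (g ` Q) + 3 \<le> dim N (X \<union> f ` Q)"
  proof -
    obtain A' where A': "X \<union> f ` Q \<subseteq> A'" "A' \<subseteq> pts N" "finite A'" "dim N (X \<union> f ` Q) = delta N A'"
      using dim_attained[OF N fin(1)] sub fC by (metis subset_trans)
    define W where "W = {k \<in> C. f k \<in> A'}"
    have W: "W \<subseteq> C" "f ` W = A' \<inter> f ` C" "X0 \<subseteq> W" "Q \<subseteq> W" using A'(1) X0 Q by (auto simp: W_def)
    \<comment> \<open>A minimising set may leave the image of \<open>C\<close>; as that image is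
      self-sufficient, the set can be cut down to it.\<close>
    have le: "delta N (f ` W) \<le> delta N A'" using C(4) A' W(2) by (simp add: selfsuff_def)
    obtain V where V: "W \<subseteq> V" "V \<subseteq> C" "predim (pullback g C M) V + 3 \<le> predim (pullback f C N) W"
      using matchesD1[OF m W(1,3)] by blast
    have "dim M (g ` Q) \<le> delta M (g ` V)"
    proof (rule dim_le[OF M])
      show "g ` Q \<subseteq> g ` V" using W V by blast
      show "g ` V \<subseteq> pts M" using V fC by blast
      show "finite (g ` V)" using V(2) C(1) finite_subset by blast
    qed
    then show ?thesis using V(3) le A'(4) pullback_delta[OF C(2) W(1) fC(1)] pullback_delta[OF C(3) V(2) fC(2)] by linarith
  qed
  moreover have "dim N (X \<union> f ` Q) \<le> dim M (g ` Q) + 3"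
  proof -
    obtain A' where A': "g ` Q \<subseteq> A'" "A' \<subseteq> pts M" "finite A'" "dim M (g ` Q) = delta M A'"
      using dim_attained[OF M fin(2)] sub fC by (metis subset_trans)
    define W where "W = {k \<in> C. g k \<in> A'}"
    have W: "W \<subseteq> C" "g ` W = A' \<inter> g ` C" "Q \<subseteq> W" using A'(1) Q by (auto simp: W_def)
    have le: "delta M (g ` W) \<le> delta M A'" using C(5) A' W(2) by (simp add: selfsuff_def)
    obtain V where V: "W \<subseteq> V" "X0 \<subseteq> V" "V \<subseteq> C" "predim (pullback f C N) V \<le> predim (pullback g C M) W + 3"
      using matchesD2[OF m W(1)] by blast
    have "dim N (X \<union> f ` Q) \<le> delta N (f ` V)"
    proof (rule dim_le[OF N])
      show "X \<union> f ` Q \<subseteq> f ` V" using W V X0 by blast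
      show "f ` V \<subseteq> pts N" using V fC by blast
      show "finite (f ` V)" using V(3) C(1) finite_subset by blast
    qed
    then show ?thesis using V(4) le A'(4) pullback_delta[OF C(3) W(1) fC(2)] pullback_delta[OF C(2) V(3) fC(1)] by linarith
  qed
  ultimately show ?thesis by simp
qed

text \<open>As \<open>X\<close> is finite, it can be added to each finite set that the closure uses.
  With \<open>X = {}\<close> the same statement serves for \<open>M\<close>.\<close>

lemma cl_localized:
  assumes B: "B \<in> C0bar" and X: "finite X" "X \<subseteq> pts B" and Z: "Z \<subseteq> pts B"
  shows "c \<in> cl B (X \<union> Z) \<longleftrightarrow>
    c \<in> pts B \<and> (\<exists>Q\<subseteq>Z. finite Q \<and> dim B (X \<union> insert c Q) = dim B (X \<union> Q))"
proof
  assume "c \<in> cl B (X \<union> Z)"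
  then obtain A where A: "finite A" "A \<subseteq> X \<union> Z" "c \<in> fin_cl B A" unfolding cl_def by blast
  let ?Q = "A \<inter> Z"
  have "c \<in> cl B (X \<union> ?Q)" unfolding cl_def using A by blast
  then have "c \<in> fin_cl B (X \<union> ?Q)" using cl_finite[OF B, of "X \<union> ?Q"] A(1) X Z by auto
  then show "c \<in> pts B \<and> (\<exists>Q\<subseteq>Z. finite Q \<and> dim B (X \<union> insert c Q) = dim B (X \<union> Q))"
    unfolding fin_cl_def using A(1) by (intro conjI exI[of _ ?Q]) auto
next
  assume "c \<in> pts B \<and> (\<exists>Q\<subseteq>Z. finite Q \<and> dim B (X \<union> insert c Q) = dim B (X \<union> Q))"
  then obtain Q where Q: "c \<in> pts B" "Q \<subseteq> Z" "finite Q" "dim B (X \<union> insert c Q) = dim B (X \<union> Q)"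
    by blast
  then have "c \<in> fin_cl B (X \<union> Q)" by (simp add: fin_cl_def)
  then show "c \<in> cl B (X \<union> Z)" unfolding cl_def using Q X(1) by blast
qed

lemma geometry_isomorphic_of_bij:
  assumes F: "bij_betw F S S'" and c: "\<And>Z. Z \<subseteq> S \<Longrightarrow> c Z \<subseteq> S \<and> F ` c Z = c' (F ` Z)"
  shows "geometry_isomorphic (geometry_of S c) (geometry_of S' c')"
proof -
  have inj: "inj_on F S" and im: "F ` S = S'" using F by (auto simp: bij_betw_def)
  have pt: "F ` (c {x} - c {}) = c' {F x} - c' {}" if "x \<in> S" for x
    using inj_on_image_set_diff[OF inj, of "c {x}" "c {}"] c[of "{x}"] c[of "{}"] that by auto
  have mem: "F x \<in> c' {} \<longleftrightarrow> x \<in> c {}" if "x \<in> S" for x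
    using inj_on_image_mem_iff[OF inj that, of "c {}"] c[of "{}"] by simp
  have sub: "q \<subseteq> S" if "q \<in> geom_points S c" for q
    using that c by (auto simp: geom_points_def)
  have pts: "(`) F ` geom_points S c = geom_points S' c'"
  proof (intro subset_antisym subsetI)
    fix q assume "q \<in> (`) F ` geom_points S c"
    then obtain x where "x \<in> S" "x \<notin> c {}" "q = F ` (c {x} - c {})" by (auto simp: geom_points_def)
    then show "q \<in> geom_points S' c'" using pt[of x] mem[of x] im unfolding geom_points_def by blast
  next
    fix q assume "q \<in> geom_points S' c'"
    then obtain y where y: "y \<in> S'" "y \<notin> c' {}" "q = c' {y} - c' {}" by (auto simp: geom_points_def)
    then obtain x where x: "x \<in> S" "y = F x" using im by blast
    then have "q = F ` (c {x} - c {})" "x \<notin> c {}" using pt[of x] mem[of x] y by auto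
    then show "q \<in> (`) F ` geom_points S c" using x unfolding geom_points_def by blast
  qed
  have "inj_on ((`) F) (geom_points S c)"
    by (rule inj_on_subset[OF inj_on_image_Pow[OF inj]]) (use sub in blast)
  then have "bij_betw ((`) F) (geom_points S c) (geom_points S' c')" using pts by (simp add: bij_betw_def)
  moreover have "(`) F ` {q \<in> geom_points S c. q \<subseteq> c (\<Union>P)} =
      {q \<in> geom_points S' c'. q \<subseteq> c' (\<Union>((`) F ` P))}" if P: "P \<subseteq> geom_points S c" for P
  proof -
    have UP: "\<Union>P \<subseteq> S" using P sub by blast
    have FU: "\<Union>((`) F ` P) = F ` \<Union>P" by blast
    have "F ` q \<subseteq> c' (F ` \<Union>P) \<longleftrightarrow> q \<subseteq> c (\<Union>P)" if q: "q \<in> geom_points S c" for q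
    proof -
      have "F ` q \<subseteq> F ` c (\<Union>P) \<longleftrightarrow> q \<subseteq> c (\<Union>P)"
        using inj_on_image_mem_iff[OF inj] sub[OF q] c[OF UP] by (metis image_mono image_subset_iff subset_iff)
      then show ?thesis using c[OF UP] by simp
    qed
    then show ?thesis unfolding FU pts[symmetric] by blast
  qed
  ultimately show ?thesis unfolding geometry_isomorphic_def geometry_of_def by auto
qed

section \<open>The limit of the back-and-forth\<close>

theorem theorem4p2:
  fixes \<mu> :: "nat set \<Rightarrow> nat lstruct \<Rightarrow> nat"
    and N :: "'a lstruct" and M :: "'b lstruct" and X :: "'a set"
  assumes mu: "iso_invariant \<mu>"
    and free: "\<And>A B1 B2 :: nat lstruct.
      B1 \<in> Kmu \<mu> \<Longrightarrow> B2 \<in> Kmu \<mu> \<Longrightarrow> pts A = pts B1 \<inter> pts B2 \<Longrightarrow>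
      A = induced B1 (pts A) \<Longrightarrow> A = induced B2 (pts A) \<Longrightarrow>
      selfsuff (pts A) B1 \<Longrightarrow> selfsuff (pts A) B2 \<Longrightarrow>
      free_amalgam B1 B2 \<notin> Kmu \<mu> \<Longrightarrow>
        (\<exists>a\<in>pts A. \<exists>a'\<in>pts A. \<exists>b1\<in>pts B1 - pts A. \<exists>b2\<in>pts B2 - pts A.
            {a, a', b1} \<in> rel B1 \<and> {a, a', b2} \<in> rel B2) \<or>
        (\<exists>Y Z1 Z2. Y \<subseteq> pts A \<and> delta A Y \<ge> 3 \<and> Z1 \<subseteq> pts B1 \<and> Z2 \<subseteq> pts B2 \<and>
            msa Y (induced B1 Z1) \<and> msa Y (induced B2 Z2) \<and>
            (\<exists>g. isomorphism g (induced B1 Z1) (induced B2 Z2) \<and> (\<forall>y\<in>Y. g y = y)) \<and>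
            Z1 - Y \<subseteq> pts B1 - pts A \<and> Z2 - Y \<subseteq> pts B2 - pts A)"
    and amalg: "amalgamation_class (Kmu \<mu>)"
    and mu_ge3: "\<And>Y Z. msa Y Z \<Longrightarrow> Z \<in> K0 \<Longrightarrow> delta Z Y \<ge> 3 \<Longrightarrow> \<mu> Y Z \<ge> 3"
    and N: "is_generic (Kmu \<mu>) N"
    (* Non-degeneracy. If \<mu> is 0 on the msa extension {a,b} \<subseteq> {a,b,c} with R = {{a,b,c}},
       then N is a pure infinite set, all other assumptions can hold, and the conclusion fails. *)
    and R_nonempty: "rel N \<noteq> {}"
    and M: "is_generic C0 M"
    and X: "finite X" "selfsuff X N" "dim N X = 3"
  shows "geometry_isomorphic (Geom_loc X N) (Geom M)"
proof -
  have NC: "N \<in> C0bar" and MC: "M \<in> C0bar" using N M by (auto simp: is_generic_def)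
  have XN: "X \<subseteq> pts N" using X(2) by (simp add: selfsuff_def)
  have dX: "delta N X = 3" using selfsuff_dim[OF NC X(1,2)] X(3) by simp
  \<comment> \<open>Keeping only the graph forgets the index sets, so that an extension becomes an
    inclusion.\<close>
  define ok where "ok = {(\<lambda>k. (f k, g k)) ` C | C f g. partial_iso N M X C f g}"
  have step: "\<exists>Q\<in>ok. P \<subseteq> Q \<and> a \<in> fst ` Q \<and> b \<in> snd ` Q"
    if P: "P \<in> ok" and a: "a \<in> pts N" and b: "b \<in> pts M" for P a b
  proof -
    obtain C f g where p: "partial_iso N M X C f g" "P = (\<lambda>k. (f k, g k)) ` C"
      using P unfolding ok_def by blast
    obtain C1 f1 g1 where p1: "partial_iso N M X C1 f1 g1" "C \<subseteq> C1"
        "\<forall>k\<in>C. f1 k = f k \<and> g1 k = g k" "a \<in> f1 ` C1"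
      using partial_iso_forth[OF NC M p(1) a] by blast
    obtain C2 f2 g2 where p2: "partial_iso N M X C2 f2 g2" "C1 \<subseteq> C2"
        "\<forall>k\<in>C1. f2 k = f1 k \<and> g2 k = g1 k" "b \<in> g2 ` C2"
      using partial_iso_back[OF mu_ge3 N R_nonempty M p1(1) b] dX by auto
    let ?Q = "(\<lambda>k. (f2 k, g2 k)) ` C2"
    have "P \<subseteq> ?Q" unfolding p(2) using p1(2,3) p2(2,3) by force
    moreover have "a \<in> fst ` ?Q" using p1(4) p2(2,3) by force
    moreover have "b \<in> snd ` ?Q" using p2(4) by force
    moreover have "?Q \<in> ok" unfolding ok_def using p2(1) by blast
    ultimately show ?thesis by blast
  qed
  obtain C0' f0 g0 where p0: "partial_iso N M X C0' f0 g0"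
    using partial_iso_initial[OF N R_nonempty M X] by blast
  have Nne: "pts N \<noteq> {}" using dX XN by (auto simp: delta_def)
  have Mne: "pts M \<noteq> {}"
  proof -
    have "X \<noteq> {}" using dX by (auto simp: delta_def)
    then have "C0' \<noteq> {}" using p0 unfolding partial_iso_def by blast
    then show ?thesis using p0 unfolding partial_iso_def selfsuff_def by blast
  qed
  have cN: "countable (pts N)" and cM: "countable (pts M)" using N M by (auto simp: is_generic_def)
  let ?a = "from_nat_into (pts N)" and ?b = "from_nat_into (pts M)"
  \<comment> \<open>Stage \<open>n + 1\<close> takes care of the points with number \<open>n\<close>
    on both sides; the enumerations may repeat points.\<close>
  have "\<exists>P. \<forall>n. P n \<in> ok \<and> (P n \<subseteq> P (Suc n) \<and> ?a n \<in> fst ` P (Suc n) \<and> ?b n \<in> snd ` P (Suc n))"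
  proof (rule dependent_nat_choice)
    show "\<exists>P. P \<in> ok" unfolding ok_def using p0 by blast
    show "\<exists>Q. Q \<in> ok \<and> (P \<subseteq> Q \<and> ?a n \<in> fst ` Q \<and> ?b n \<in> snd ` Q)" if "P \<in> ok" for P n
      using step[OF that from_nat_into[OF Nne] from_nat_into[OF Mne]] by blast
  qed
  then obtain P where P: "\<And>n. P n \<in> ok" "\<And>n. P n \<subseteq> P (Suc n)"
    "\<And>n. ?a n \<in> fst ` P (Suc n)" "\<And>n. ?b n \<in> snd ` P (Suc n)" by blast
  have mono: "P i \<subseteq> P j" if "i \<le> j" for i j by (rule lift_Suc_mono_le[of P, OF P(2) that])
  have Pn: "inj_on fst (P n)" "inj_on snd (P n)" "P n \<subseteq> pts N \<times> pts M" for n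
  proof -
    obtain C f g where p: "partial_iso N M X C f g" "P n = (\<lambda>k. (f k, g k)) ` C"
      using P(1)[of n] unfolding ok_def by blast
    then have "inj_on f C" "inj_on g C" "f ` C \<subseteq> pts N" "g ` C \<subseteq> pts M"
      by (auto simp: partial_iso_def selfsuff_def)
    then show "inj_on fst (P n)" "inj_on snd (P n)" "P n \<subseteq> pts N \<times> pts M"
      unfolding p(2) by (auto simp: inj_on_def)
  qed
  define G where "G = (\<Union>n. P n)"
  have joint: "\<exists>n. p \<in> P n \<and> q \<in> P n" if "p \<in> G" "q \<in> G" for p q
  proof -
    obtain i j where "p \<in> P i" "q \<in> P j" using \<open>p \<in> G\<close> \<open>q \<in> G\<close> unfolding G_def by blast
    then show ?thesis using mono[of i "max i j"] mono[of j "max i j"] by (metis max.cobounded1 max.cobounded2 subsetD)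
  qed
  have Gfst: "p = q" if pq: "p \<in> G" "q \<in> G" and eq: "fst p = fst q" for p q
  proof -
    obtain n where "p \<in> P n" "q \<in> P n" using joint[OF pq] by blast
    then show ?thesis using Pn(1)[of n] eq by (auto dest: inj_onD)
  qed
  have Gsnd: "p = q" if pq: "p \<in> G" "q \<in> G" and eq: "snd p = snd q" for p q
  proof -
    obtain n where "p \<in> P n" "q \<in> P n" using joint[OF pq] by blast
    then show ?thesis using Pn(2)[of n] eq by (auto dest: inj_onD)
  qed
  have dom: "\<exists>b. (a, b) \<in> G" if a: "a \<in> pts N" for a
  proof -
    obtain n where "a = ?a n" using from_nat_into_surj[OF cN a] by blast
    then obtain q where "q \<in> P (Suc n)" "fst q = a" using P(3)[of n] by auto
    then show ?thesis unfolding G_def by (metis UN_I UNIV_I prod.collapse)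
  qed
  have ran: "\<exists>a. (a, b) \<in> G" if b: "b \<in> pts M" for b
  proof -
    obtain n where "b = ?b n" using from_nat_into_surj[OF cM b] by blast
    then obtain q where "q \<in> P (Suc n)" "snd q = b" using P(4)[of n] by auto
    then show ?thesis unfolding G_def by (metis UN_I UNIV_I prod.collapse)
  qed
  have GNM: "a \<in> pts N \<and> b \<in> pts M" if "(a, b) \<in> G" for a b
    using that Pn(3) unfolding G_def by blast
  obtain F where F: "\<And>a. a \<in> pts N \<Longrightarrow> (a, F a) \<in> G" using dom by metis
  have Fbij: "bij_betw F (pts N) (pts M)"
  proof (rule bij_betw_imageI)
    show "inj_on F (pts N)"
    proof (rule inj_onI)
      fix a a' assume "a \<in> pts N" "a' \<in> pts N" "F a = F a'"
      then show "a = a'" using Gsnd[OF F F, of a a'] by simp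
    qed
    show "F ` pts N = pts M"
    proof (intro subset_antisym subsetI)
      fix b assume "b \<in> F ` pts N" then show "b \<in> pts M" using F GNM by blast
    next
      fix b assume "b \<in> pts M"
      then obtain a where a: "(a, b) \<in> G" using ran by blast
      then have "a \<in> pts N" using GNM by blast
      moreover have "b = F a" using Gfst[OF a F[OF \<open>a \<in> pts N\<close>]] by simp
      ultimately show "b \<in> F ` pts N" by blast
    qed
  qed
  \<comment> \<open>The graph over finitely many points lies in one stage, where the dimensions are
    already matched.\<close>
  have dimF: "dim N (X \<union> Q) = dim M (F ` Q) + 3" if Q: "finite Q" "Q \<subseteq> pts N" for Q
  proof -
    have "\<exists>n. \<forall>a\<in>Q. (a, F a) \<in> P n"
      using Q
    proof (induction Q rule: finite_induct)
      case (insert a Q)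
      then obtain i where i: "\<forall>a\<in>Q. (a, F a) \<in> P i" by blast
      obtain j where "(a, F a) \<in> P j" using F[of a] insert.prems unfolding G_def by blast
      then have "\<forall>x\<in>insert a Q. (x, F x) \<in> P (max i j)"
        using i mono[of i "max i j"] mono[of j "max i j"] by auto
      then show ?case by blast
    qed simp
    then obtain n where n: "\<And>a. a \<in> Q \<Longrightarrow> (a, F a) \<in> P n" by blast
    obtain C f g where p: "partial_iso N M X C f g" "P n = (\<lambda>k. (f k, g k)) ` C"
      using P(1)[of n] unfolding ok_def by blast
    define Q0 where "Q0 = {k \<in> C. f k \<in> Q \<and> g k = F (f k)}"
    have "f ` Q0 = Q"
    proof (intro subset_antisym subsetI)
      fix a assume a: "a \<in> Q"
      then obtain k where k: "k \<in> C" "a = f k" "F a = g k" using n[OF a] p(2) by auto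
      then have "k \<in> Q0" using a by (simp add: Q0_def)
      then show "a \<in> f ` Q0" using k(2) by simp
    qed (auto simp: Q0_def)
    moreover have "g ` Q0 = F ` f ` Q0" unfolding image_image by (rule image_cong) (auto simp: Q0_def)
    moreover have "Q0 \<subseteq> C" by (auto simp: Q0_def)
    ultimately show ?thesis using partial_iso_dim[OF NC MC p(1), of Q0] by simp
  qed
  have clF: "cl N (X \<union> Z) \<subseteq> pts N \<and> F ` cl N (X \<union> Z) = cl M (F ` Z)" if Z: "Z \<subseteq> pts N" for Z
  proof -
    have FZ: "F ` Z \<subseteq> pts M" using Z Fbij by (auto simp: bij_betw_def)
    have clM: "b \<in> cl M (F ` Z) \<longleftrightarrow> b \<in> pts M \<and>
        (\<exists>Q\<subseteq>F ` Z. finite Q \<and> dim M (insert b Q) = dim M Q)" for b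
      using cl_localized[OF MC _ _ FZ, of "{}" b] by simp
    have key: "a \<in> cl N (X \<union> Z) \<longleftrightarrow> F a \<in> cl M (F ` Z)" if a: "a \<in> pts N" for a
    proof -
      have Fa: "F a \<in> pts M" using a Fbij by (auto simp: bij_betw_def)
      \<comment> \<open>The offset 3 cancels, so adding a point changes both dimensions by the same
        amount.\<close>
      have eq: "dim N (X \<union> insert a Q) = dim N (X \<union> Q) \<longleftrightarrow> dim M (insert (F a) (F ` Q)) = dim M (F ` Q)"
        if "Q \<subseteq> Z" "finite Q" for Q
        using dimF[of Q] dimF[of "insert a Q"] that Z a by auto
      have "(\<exists>Q\<subseteq>Z. finite Q \<and> dim N (X \<union> insert a Q) = dim N (X \<union> Q)) \<longleftrightarrow>
          (\<exists>Q\<subseteq>F ` Z. finite Q \<and> dim M (insert (F a) Q) = dim M Q)"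
      proof
        assume "\<exists>Q\<subseteq>Z. finite Q \<and> dim N (X \<union> insert a Q) = dim N (X \<union> Q)"
        then obtain Q where "Q \<subseteq> Z" "finite Q" "dim N (X \<union> insert a Q) = dim N (X \<union> Q)" by blast
        then show "\<exists>Q\<subseteq>F ` Z. finite Q \<and> dim M (insert (F a) Q) = dim M Q"
          using eq[of Q] by (intro exI[of _ "F ` Q"]) auto
      next
        assume "\<exists>Q\<subseteq>F ` Z. finite Q \<and> dim M (insert (F a) Q) = dim M Q"
        then obtain Q' where Q': "Q' \<subseteq> F ` Z" "finite Q'" "dim M (insert (F a) Q') = dim M Q'" by blast
        then obtain Q where Q: "Q \<subseteq> Z" "finite Q" "Q' = F ` Q" by (meson finite_subset_image)
        then show "\<exists>Q\<subseteq>Z. finite Q \<and> dim N (X \<union> insert a Q) = dim N (X \<union> Q)"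
          using eq[of Q] Q'(3) by blast
      qed
      then show ?thesis using cl_localized[OF NC X(1) XN Z, of a] clM[of "F a"] a Fa by blast
    qed
    have sub: "cl N (X \<union> Z) \<subseteq> pts N" using cl_localized[OF NC X(1) XN Z] by blast
    moreover have "F ` cl N (X \<union> Z) = cl M (F ` Z)"
    proof (intro subset_antisym subsetI)
      fix b assume "b \<in> F ` cl N (X \<union> Z)"
      then show "b \<in> cl M (F ` Z)" using key sub by blast
    next
      fix b assume b: "b \<in> cl M (F ` Z)"
      then have "b \<in> F ` pts N" using clM Fbij by (simp add: bij_betw_def)
      then show "b \<in> F ` cl N (X \<union> Z)" using key b by blast
    qed
    ultimately show ?thesis by blast
  qed
  show ?thesis unfolding Geom_def Geom_loc_def
    by (rule geometry_isomorphic_of_bij[OF Fbij]) (rule clF)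
qed

end
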